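(* Suppose a prime $p$, a Dynkin diagram $S$, and a positive integer $n$ satisfy one of the following. \begin{enumerate} \item $p=2$, $S\in\{E_7,E_8\}$, $n\le3$. \item $p=3$, $S=E_8$, $n\le2$. \item $p=2$, $S=E_6$, $n=1$. \item $p=3$, $S\in\{E_6,E_7\}$, $n=1$. \item $p=5$, $S=E_8$, $n=1$. \end{enumerate} Let $A$ be an RDP in characteristic $p$ of type $S^r$ with $0\le r\le r_{\max}(p,S)+1-n$. Then there is an element $e\in H^2_{\mathfrak m_A}(W_n(A))[\mathfrak m_A]$ whose restriction $R^{n-1}(e)$ is a generator of $H^2_{\mathfrak m_A}(A)[\mathfrak m_A]$ and satisfying \[F(e)=\begin{cases}0&(\text{if }r<r_{\max}(p,S)+1-n),\\ V^{n-1}(e')&(\text{if }r=r_{\max}(p,S)+1-n)\end{cases}\] for some generator $e'\in H^2_{\mathfrak m_A}(A)[\mathfrak m_A]$.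
   Context: Let $k$ be an algebraically closed field of characteristic $p$. Here $r_{\max}(2,E_6)=1$, $r_{\max}(2,E_7)=3$, $r_{\max}(2,E_8)=4$, $r_{\max}(3,E_6)=r_{\max}(3,E_7)=1$, $r_{\max}(3,E_8)=2$, $r_{\max}(5,E_8)=1$. An RDP of type $S^r$ ($0\le r\le r_{\max}(p,S)$) is a local ring $A\cong k[[x,y,z]]/(f)$ with $f$ as follows. For $p=2$: $E_6^r$ ($r=1,0$): $f=z^2+x^3+y^2z+bxyz$ with $b=1,0$ respectively; $E_7^r$ ($r=3,2,1,0$): $f=z^2+x^3+xy^3+\beta$ with $\beta=zxy,\ zy^3,\ zx^2y,\ 0$ respectively; $E_8^r$ ($r=4,3,2,1,0$): $f=z^2+x^3+y^5+\beta$ with $\beta=zxy,\ zy^3,\ zxy^2,\ zxy^3,\ 0$ respectively. For $p=3$: $E_6^r$ ($r=1,0$): $f=z^2+x^3+y^4+bx^2y^2$, $b=1,0$; $E_7^r$ ($r=1,0$): $f=z^2+x^3+xy^3+bx^2y^2$, $b=1,0$; $E_8^r$ ($r=2,1,0$): $f=z^2+x^3+y^5+\lambda x^2y^2$, $\lambda=1,y,0$. For $p=5$: $E_8^r$ ($r=1,0$): $f=z^2+x^3+y^5+(b/2)xy^4$, $b=2,0$. $W_n(A)$ is the ring of $p$-typical Witt vectors of length $n$; $F(a_0,\dots,a_{n-1})=(a_0^p,\dots,a_{n-1}^p)$, $V\colon W_n(A)\to W_{n+1}(A)$ is the Verschiebung (shift), and $R\colon W_n(A)\to W_{n-1}(A)$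 is the truncation. $H^2_{\mathfrak m_A}(W_n(A))$ denotes the local cohomology of the ring $W_n(A)$ with support at its maximal ideal; it is $\mathrm{Coker}\bigl(W_n(A[x_1^{-1}])\oplus W_n(A[x_2^{-1}])\to W_n(A[(x_1x_2)^{-1}])\bigr)$ for any regular sequence $x_1,x_2$ in $\mathfrak m_A$, and $F,V,R$ act compatibly. For an $\mathfrak m_A$-primary ideal $I\subset A$, $H^2_{\mathfrak m_A}(W_n(A))[I]$ denotes the submodule of classes annihilated by the ideal $(R^{n-1})^{-1}(I)\subset W_n(A)$. "Generator" means generator as an $A$-module. *)

theory Defs
  imports
    "HOL-Algebra.Algebra"
    "HOL-Algebra.Algebraic_Closure_Type"
    "HOL-Library.Poly_Mapping"
    "HOL-Computational_Algebra.Computational_Algebra"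
begin

section \<open>Rational double points of type E\<close>

datatype dynkin_E = E6 | E7 | E8

text \<open>The exceptional pairs are E6, E7, E8 for $p = 2, 3$ and E8 for $p = 5$; the value 0 for
  the remaining pairs is a dummy.\<close>

definition r_max :: "nat \<Rightarrow> dynkin_E \<Rightarrow> nat" where
  "r_max p S =
    (if p = 2 then (case S of E6 \<Rightarrow> 1 | E7 \<Rightarrow> 3 | E8 \<Rightarrow> 4)
     else if p = 3 then (case S of E6 \<Rightarrow> 1 | E7 \<Rightarrow> 1 | E8 \<Rightarrow> 2)
     else if p = 5 then (case S of E6 \<Rightarrow> 0 | E7 \<Rightarrow> 0 | E8 \<Rightarrow> 1)
     else 0)"

text \<open>The ring $k[[x,y,z]]$ is rendered as the iterated power series ring $k[[x]][[y]][[z]]$.\<close>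

type_synonym 'k fps3 = "'k fps fps fps"

definition ps_const :: "'k::comm_ring_1 \<Rightarrow> 'k fps3" where
  "ps_const c = fps_const (fps_const (fps_const c))"

definition ps_x :: "'k::comm_ring_1 fps3" where
  "ps_x = fps_const (fps_const fps_X)"

definition ps_y :: "'k::comm_ring_1 fps3" where
  "ps_y = fps_const fps_X"

definition ps_z :: "'k::comm_ring_1 fps3" where
  "ps_z = fps_X"

text \<open>For \<open>r > r_max p S\<close> and for non-exceptional pairs $(p,S)$ the value is irrelevant.\<close>

definition rdp_eq :: "nat \<Rightarrow> dynkin_E \<Rightarrow> nat \<Rightarrow> 'k::field fps3" where
  "rdp_eq p S r = (let x = ps_x; y = ps_y; z = ps_z in
    if p = 2 then
      (case S of
         E6 \<Rightarrow> let b = (if r = 1 then 1 else 0) in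
                z^2 + x^3 + y^2 * z + ps_const b * x * y * z
       | E7 \<Rightarrow> let \<beta> = (if r = 3 then z * x * y
                         else if r = 2 then z * y^3
                         else if r = 1 then z * x^2 * y
                         else 0) in
                z^2 + x^3 + x * y^3 + \<beta>
       | E8 \<Rightarrow> let \<beta> = (if r = 4 then z * x * y
                         else if r = 3 then z * y^3
                         else if r = 2 then z * x * y^2
                         else if r = 1 then z * x * y^3
                         else 0) in
                z^2 + x^3 + y^5 + \<beta>)
    else if p = 3 then
      (case S of
         E6 \<Rightarrow> let b = (if r = 1 then 1 else 0) in
                z^2 + x^3 + y^4 + ps_const b * x^2 * y^2
       | E7 \<Rightarrow> let b = (if r = 1 then 1 else 0) in
                z^2 + x^3 + x * y^3 + ps_const b * x^2 * y^2
       | E8 \<Rightarrow> let l = (if r = 2 then 1 else if r = 1 then y else 0) in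
                z^2 + x^3 + y^5 + l * x^2 * y^2)
    else if p = 5 \<and> S = E8 then
      (let b = (if r = 1 then 2 else 0) in
        z^2 + x^3 + y^5 + ps_const (b / 2) * x * y^4)
    else undefined)"

definition is_RDP ::
    "'k::alg_closed_field itself \<Rightarrow> nat \<Rightarrow> dynkin_E \<Rightarrow> nat \<Rightarrow> ('a, 'm) ring_scheme \<Rightarrow> bool" where
  "is_RDP k p S r A \<longleftrightarrow>
     cring A \<and>
     A \<simeq> ((ring_of_type_algebra :: 'k fps3 ring) Quot
           (Idl\<^bsub>ring_of_type_algebra :: 'k fps3 ring\<^esub> {rdp_eq p S r}))"

definition regular_pair :: "('a, 'm) ring_scheme \<Rightarrow> 'a \<Rightarrow> 'a \<Rightarrow> bool" where
  "regular_pair A x y \<longleftrightarrow>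
     x \<in> carrier A \<and> y \<in> carrier A \<and>
     (\<forall>a\<in>carrier A. x \<otimes>\<^bsub>A\<^esub> a = \<zero>\<^bsub>A\<^esub> \<longrightarrow> a = \<zero>\<^bsub>A\<^esub>) \<and>
     (\<forall>a\<in>carrier A. y \<otimes>\<^bsub>A\<^esub> a \<in> Idl\<^bsub>A\<^esub> {x} \<longrightarrow> a \<in> Idl\<^bsub>A\<^esub> {x}) \<and>
     Idl\<^bsub>A\<^esub> {x, y} \<noteq> carrier A"


section \<open>Witt vectors of finite length\<close>

text \<open>Polynomials over the integers in the variables $X_0, X_1, \dots$ (indices \<open>Inl i\<close>) and
  $Y_0, Y_1, \dots$ (indices \<open>Inr i\<close>).\<close>

type_synonym witt_poly = "((nat + nat) \<Rightarrow>\<^sub>0 nat) \<Rightarrow>\<^sub>0 int"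

definition wvar :: "nat + nat \<Rightarrow> witt_poly" where
  "wvar v = Poly_Mapping.single (Poly_Mapping.single v 1) 1"

definition ghost :: "nat \<Rightarrow> nat \<Rightarrow> (nat \<Rightarrow> witt_poly) \<Rightarrow> witt_poly" where
  "ghost p n T = (\<Sum>i\<le>n. of_nat (p ^ i) * T i ^ (p ^ (n - i)))"

text \<open>\<open>witt_solve p g\<close> solves \<open>ghost p n T = g n\<close> (for all \<open>n\<close>) for \<open>T\<close>, by recursion on \<open>n\<close>.
  For \<open>p\<close> prime and the two right-hand sides used below, the coefficientwise division is exact;
  this is the classical integrality of the Witt addition and multiplication polynomials.\<close>

fun witt_solve :: "nat \<Rightarrow> (nat \<Rightarrow> witt_poly) \<Rightarrow> nat \<Rightarrow> witt_poly" where
  "witt_solve p g n =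
     Poly_Mapping.map (\<lambda>c. c div int (p ^ n))
       (g n - (\<Sum>i<n. of_nat (p ^ i) * witt_solve p g i ^ (p ^ (n - i))))"

declare witt_solve.simps [simp del]

definition witt_add_poly :: "nat \<Rightarrow> nat \<Rightarrow> witt_poly" where
  "witt_add_poly p =
     witt_solve p (\<lambda>n. ghost p n (\<lambda>i. wvar (Inl i)) + ghost p n (\<lambda>i. wvar (Inr i)))"

definition witt_mult_poly :: "nat \<Rightarrow> nat \<Rightarrow> witt_poly" where
  "witt_mult_poly p =
     witt_solve p (\<lambda>n. ghost p n (\<lambda>i. wvar (Inl i)) * ghost p n (\<lambda>i. wvar (Inr i)))"

definition witt_eval :: "('a, 'm) ring_scheme \<Rightarrow> (nat + nat \<Rightarrow> 'a) \<Rightarrow> witt_poly \<Rightarrow> 'a" where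
  "witt_eval R v P =
     (\<Oplus>\<^bsub>R\<^esub>m\<in>Poly_Mapping.keys P.
        [Poly_Mapping.lookup P m] \<cdot>\<^bsub>R\<^esub>
          (\<Otimes>\<^bsub>R\<^esub>i\<in>Poly_Mapping.keys m. v i [^]\<^bsub>R\<^esub> Poly_Mapping.lookup m i))"

definition witt_op ::
    "(nat \<Rightarrow> witt_poly) \<Rightarrow> nat \<Rightarrow> ('a, 'm) ring_scheme \<Rightarrow> 'a list \<Rightarrow> 'a list \<Rightarrow> 'a list" where
  "witt_op T n R a b =
     map (\<lambda>i. witt_eval R (case_sum (\<lambda>j. a ! j) (\<lambda>j. b ! j)) (T i)) [0..<n]"

text \<open>$W_n(R)$: the vector $(a_0, \dots, a_{n-1})$ is the list \<open>[a\<^sub>0, \<dots>, a\<^sub>n\<^sub>-\<^sub>1]\<close>.\<close>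

definition witt_ring :: "nat \<Rightarrow> nat \<Rightarrow> ('a, 'm) ring_scheme \<Rightarrow> 'a list ring" where
  "witt_ring p n R = \<lparr>
     carrier = {a. length a = n \<and> set a \<subseteq> carrier R},
     monoid.mult = witt_op (witt_mult_poly p) n R,
     one = map (\<lambda>i. if i = 0 then \<one>\<^bsub>R\<^esub> else \<zero>\<^bsub>R\<^esub>) [0..<n],
     ring.zero = replicate n \<zero>\<^bsub>R\<^esub>,
     add = witt_op (witt_add_poly p) n R \<rparr>"

text \<open>$F$ in characteristic $p$, Verschiebung $V : W_n(R) \to W_{n+1}(R)$ and truncation
  $R : W_n(R) \to W_{n-1}(R)$. The functorial map $W_n(R) \to W_n(R')$ of a ring
  homomorphism \<open>h\<close> is \<open>map h\<close>.\<close>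

definition witt_F :: "nat \<Rightarrow> ('a, 'm) ring_scheme \<Rightarrow> 'a list \<Rightarrow> 'a list" where
  "witt_F p R = map (\<lambda>a. a [^]\<^bsub>R\<^esub> p)"

definition witt_V :: "('a, 'm) ring_scheme \<Rightarrow> 'a list \<Rightarrow> 'a list" where
  "witt_V R a = \<zero>\<^bsub>R\<^esub> # a"

definition witt_R :: "'a list \<Rightarrow> 'a list" where
  "witt_R = butlast"


section \<open>Localization at an element\<close>

text \<open>$A[s^{-1}]$ consists of the classes of pairs \<open>(a, i)\<close>, standing for $a/s^i$.\<close>

definition loc_rel :: "('a, 'm) ring_scheme \<Rightarrow> 'a \<Rightarrow> (('a \<times> nat) \<times> ('a \<times> nat)) set" where
  "loc_rel A s = {((a, i), (b, j)). a \<in> carrier A \<and> b \<in> carrier A \<and>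
     (\<exists>k::nat. s [^]\<^bsub>A\<^esub> k \<otimes>\<^bsub>A\<^esub> (s [^]\<^bsub>A\<^esub> j \<otimes>\<^bsub>A\<^esub> a) = s [^]\<^bsub>A\<^esub> k \<otimes>\<^bsub>A\<^esub> (s [^]\<^bsub>A\<^esub> i \<otimes>\<^bsub>A\<^esub> b))}"

definition loc_frac :: "('a, 'm) ring_scheme \<Rightarrow> 'a \<Rightarrow> 'a \<Rightarrow> nat \<Rightarrow> ('a \<times> nat) set" where
  "loc_frac A s a i = loc_rel A s `` {(a, i)}"

definition loc :: "('a, 'm) ring_scheme \<Rightarrow> 'a \<Rightarrow> ('a \<times> nat) set ring" where
  "loc A s = \<lparr>
     carrier = (carrier A \<times> UNIV) // loc_rel A s,
     monoid.mult = (\<lambda>u v. \<Union>(a, i)\<in>u. \<Union>(b, j)\<in>v. loc_frac A s (a \<otimes>\<^bsub>A\<^esub> b) (i + j)),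
     one = loc_frac A s \<one>\<^bsub>A\<^esub> 0,
     ring.zero = loc_frac A s \<zero>\<^bsub>A\<^esub> 0,
     add = (\<lambda>u v. \<Union>(a, i)\<in>u. \<Union>(b, j)\<in>v.
              loc_frac A s (s [^]\<^bsub>A\<^esub> j \<otimes>\<^bsub>A\<^esub> a \<oplus>\<^bsub>A\<^esub> s [^]\<^bsub>A\<^esub> i \<otimes>\<^bsub>A\<^esub> b) (i + j)) \<rparr>"

text \<open>The canonical map $A[s^{-1}] \to A[(st)^{-1}]$, $a/s^i \mapsto a t^i/(st)^i$.\<close>

definition loc_map ::
    "('a, 'm) ring_scheme \<Rightarrow> 'a \<Rightarrow> 'a \<Rightarrow> ('a \<times> nat) set \<Rightarrow> ('a \<times> nat) set" where
  "loc_map A s t u = (\<Union>(a, i)\<in>u. loc_frac A (s \<otimes>\<^bsub>A\<^esub> t) (a \<otimes>\<^bsub>A\<^esub> t [^]\<^bsub>A\<^esub> i) i)"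


section \<open>Second local cohomology of Witt vector rings\<close>

text \<open>In everything below \<open>x1\<close>, \<open>x2\<close> is the regular sequence by means of which the cokernel
  $H^2_{\mathfrak m}(W_n(A))$ is formed.\<close>

definition W_loc ::
    "('a, 'm) ring_scheme \<Rightarrow> nat \<Rightarrow> 'a \<Rightarrow> 'a \<Rightarrow> nat \<Rightarrow> ('a \<times> nat) set list ring" where
  "W_loc A p x1 x2 n = witt_ring p n (loc A (x1 \<otimes>\<^bsub>A\<^esub> x2))"

text \<open>The image of $W_n(A[x_1^{-1}]) \oplus W_n(A[x_2^{-1}])$. The second map has target
  $A[(x_2x_1)^{-1}]$, which is $A[(x_1x_2)^{-1}]$ by commutativity.\<close>

definition cech_image ::
    "('a, 'm) ring_scheme \<Rightarrow> nat \<Rightarrow> 'a \<Rightarrow> 'a \<Rightarrow> nat \<Rightarrow> ('a \<times> nat) set list set" where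
  "cech_image A p x1 x2 n =
     map (loc_map A x1 x2) ` carrier (witt_ring p n (loc A x1))
       <+>\<^bsub>W_loc A p x1 x2 n\<^esub>
     map (loc_map A x2 x1) ` carrier (witt_ring p n (loc A x2))"

definition lc_class ::
    "('a, 'm) ring_scheme \<Rightarrow> nat \<Rightarrow> 'a \<Rightarrow> 'a \<Rightarrow> nat \<Rightarrow>
      ('a \<times> nat) set list \<Rightarrow> ('a \<times> nat) set list set" where
  "lc_class A p x1 x2 n w = cech_image A p x1 x2 n +>\<^bsub>W_loc A p x1 x2 n\<^esub> w"

text \<open>The module $H^2_{\mathfrak m}(W_n(A))$ over $W_n(A)$, whose elements are the cosets of
  \<open>cech_image\<close>. The fields \<open>mult\<close> and \<open>one\<close> of the record type play no role for modules.\<close>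

definition local_cohomology ::
    "('a, 'm) ring_scheme \<Rightarrow> nat \<Rightarrow> 'a \<Rightarrow> 'a \<Rightarrow> nat \<Rightarrow>
      ('a list, ('a \<times> nat) set list set) module" where
  "local_cohomology A p x1 x2 n = \<lparr>
     carrier = a_rcosets\<^bsub>W_loc A p x1 x2 n\<^esub> (cech_image A p x1 x2 n),
     monoid.mult = undefined,
     one = undefined,
     ring.zero = cech_image A p x1 x2 n,
     add = set_add (W_loc A p x1 x2 n),
     module.smult = (\<lambda>a C. \<Union>w\<in>C. lc_class A p x1 x2 n
       (map (\<lambda>c. loc_frac A (x1 \<otimes>\<^bsub>A\<^esub> x2) c 0) a \<otimes>\<^bsub>W_loc A p x1 x2 n\<^esub> w)) \<rparr>"

text \<open>The map $H^2_{\mathfrak m}(W_l(A)) \to H^2_{\mathfrak m}(W_n(A))$ induced by an additive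
  map \<open>h\<close> from $W_l$ to $W_n$.\<close>

definition lc_map ::
    "('a, 'm) ring_scheme \<Rightarrow> nat \<Rightarrow> 'a \<Rightarrow> 'a \<Rightarrow> nat \<Rightarrow>
      (('a \<times> nat) set list \<Rightarrow> ('a \<times> nat) set list) \<Rightarrow>
      ('a \<times> nat) set list set \<Rightarrow> ('a \<times> nat) set list set" where
  "lc_map A p x1 x2 n h C = (\<Union>w\<in>C. lc_class A p x1 x2 n (h w))"

definition lc_F ::
    "('a, 'm) ring_scheme \<Rightarrow> nat \<Rightarrow> 'a \<Rightarrow> 'a \<Rightarrow> nat \<Rightarrow>
      ('a \<times> nat) set list set \<Rightarrow> ('a \<times> nat) set list set" where
  "lc_F A p x1 x2 n = lc_map A p x1 x2 n (witt_F p (loc A (x1 \<otimes>\<^bsub>A\<^esub> x2)))"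

text \<open>$V^{n-1} : H^2_{\mathfrak m}(W_1(A)) \to H^2_{\mathfrak m}(W_n(A))$ and
  $R^{n-1} : H^2_{\mathfrak m}(W_n(A)) \to H^2_{\mathfrak m}(W_1(A))$, where $W_1(A) = A$.\<close>

definition lc_V_iter ::
    "('a, 'm) ring_scheme \<Rightarrow> nat \<Rightarrow> 'a \<Rightarrow> 'a \<Rightarrow> nat \<Rightarrow>
      ('a \<times> nat) set list set \<Rightarrow> ('a \<times> nat) set list set" where
  "lc_V_iter A p x1 x2 n =
     lc_map A p x1 x2 n (witt_V (loc A (x1 \<otimes>\<^bsub>A\<^esub> x2)) ^^ (n - 1))"

definition lc_R_iter ::
    "('a, 'm) ring_scheme \<Rightarrow> nat \<Rightarrow> 'a \<Rightarrow> 'a \<Rightarrow> nat \<Rightarrow>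
      ('a \<times> nat) set list set \<Rightarrow> ('a \<times> nat) set list set" where
  "lc_R_iter A p x1 x2 n = lc_map A p x1 x2 1 (witt_R ^^ (n - 1))"

text \<open>$H^2_{\mathfrak m}(W_n(A))[I]$; an element \<open>c\<close> of \<open>A\<close> is identified with \<open>[c]\<close> in $W_1(A)$.\<close>

definition lc_torsion ::
    "('a, 'm) ring_scheme \<Rightarrow> nat \<Rightarrow> 'a \<Rightarrow> 'a \<Rightarrow> nat \<Rightarrow> 'a set \<Rightarrow> ('a \<times> nat) set list set set" where
  "lc_torsion A p x1 x2 n I =
     {C \<in> carrier (local_cohomology A p x1 x2 n).
        \<forall>a\<in>carrier (witt_ring p n A). (witt_R ^^ (n - 1)) a \<in> (\<lambda>c. [c]) ` I \<longrightarrow>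
          a \<odot>\<^bsub>local_cohomology A p x1 x2 n\<^esub> C = \<zero>\<^bsub>local_cohomology A p x1 x2 n\<^esub>}"

text \<open>\<open>e\<close> generates $H^2_{\mathfrak m}(A)[I]$ as a module over $A = W_1(A)$.\<close>

definition lc_torsion_generator ::
    "('a, 'm) ring_scheme \<Rightarrow> nat \<Rightarrow> 'a \<Rightarrow> 'a \<Rightarrow> 'a set \<Rightarrow> ('a \<times> nat) set list set \<Rightarrow> bool" where
  "lc_torsion_generator A p x1 x2 I e \<longleftrightarrow>
     e \<in> lc_torsion A p x1 x2 1 I \<and>
     lc_torsion A p x1 x2 1 I = (\<lambda>c. [c] \<odot>\<^bsub>local_cohomology A p x1 x2 1\<^esub> e) ` carrier A"

end

theory Submission
  imports Defs
begin

text \<open>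
  Let $f = z^2 + Bz + C$ with $B, C \<in> k[[x,y]]$. The class $e$ is represented by the Teichmueller
  representative $[z/(xy)]$ for the regular sequence $x, y$. To compute $F(e)$ one writes
  $(z/(xy))^p = P + Q$ with $P \<in> A[x^{-1}]$ and $Q \<in> A[y^{-1}]$; then $[P + Q] = [P] + [Q] - V(c)$, where
  $c$ is the carry of Witt vector addition, so $F(e) = -V(c)$ and the argument is repeated with $c$. For
  $r = r_{\max} + 1 - n$ a multiple of $z/(xy)$ by a unit is left over in the last step. The maximal
  ideal kills $e$ because $[x]e = [y]e = [z]e = 0$ and $V(a)e = V(a F(e))$.

  Since $C$ has odd order 3 and $B$ has order at least 2, $f$ has no root over the fraction field of
  $k[[x,y]]$, so $A$ is a domain and all Witt vectors can be taken over an algebraically closed field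
  containing $A$. Classes are moved from $x, y$ to an arbitrary regular sequence $x_1, x_2$ by the double
  complex of the two covers; for a class killed by the maximal ideal this needs no vanishing theorem, as
  a relation $[x_j] e = u + v$ can be divided by $[x_j]$.
\<close>

section \<open>Evaluation of integer polynomials\<close>

text \<open>One computation per equation serves every n. For each f there are a length N and an
  integer k with F[t] = V^(N-1)[k t] in H^2(W_N), where t = z/(xy). In lengths below N the right
  side truncates to 0, and for non-zero k the length N is r_max + 1 - r. The splitting P + Q has to
  be chosen with care: terms without denominators could go to either side, and the carry, a
  polynomial in P and Q, has to split again.

  The obstacle for n > 1 is [z]e = 0, the vanishing of the class of [z^2/(xy)]. If z^2 = x^2 a + y^2
  b, the two parts xa/y and yb/x have the regular product ab, which makes all carries split. Hence B
  and C are required to lie in (x^2, y^2) as soon as N > 1.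

  The relation V(a)e = V(a F(e)) uses F(e) = 0 in length n - 1 only, because V shifts; as n - 1 < N,
  this comes from the same computation and no induction on n occurs.

  Inside one field all localizations are subrings, so gluing on overlaps becomes
  intersection.\<close>

definition monom_eval :: "('v \<Rightarrow> 'r::comm_ring_1) \<Rightarrow> ('v \<Rightarrow>\<^sub>0 nat) \<Rightarrow> 'r" where
  "monom_eval v m = (\<Prod>i\<in>Poly_Mapping.keys m. v i ^ Poly_Mapping.lookup m i)"

text \<open>The analogue of \<open>witt_eval\<close> for a ring given as a type;
  \<open>witt_eval_loc\<close> identifies the two over a localization.\<close>

definition poly_eval :: "('v \<Rightarrow> 'r::comm_ring_1) \<Rightarrow> (('v \<Rightarrow>\<^sub>0 nat) \<Rightarrow>\<^sub>0 int) \<Rightarrow> 'r" where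
  "poly_eval v P = (\<Sum>m\<in>Poly_Mapping.keys P. of_int (Poly_Mapping.lookup P m) * monom_eval v m)"

lemma monom_eval_superset:
  assumes "finite K" "Poly_Mapping.keys m \<subseteq> K"
  shows "monom_eval v m = (\<Prod>i\<in>K. v i ^ Poly_Mapping.lookup m i)"
  unfolding monom_eval_def using assms
  by (intro prod.mono_neutral_left) (auto simp: in_keys_iff)

lemma monom_eval_add: "monom_eval v (m + m') = monom_eval v m * monom_eval v m'"
proof -
  let ?K = "Poly_Mapping.keys m \<union> Poly_Mapping.keys m'"
  have K: "finite ?K" by simp
  have "Poly_Mapping.keys (m + m') \<subseteq> ?K" by (rule Poly_Mapping.keys_add)
  then show ?thesis
    by (simp add: monom_eval_superset[OF K] lookup_add power_add prod.distrib)
qed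

lemma monom_eval_0 [simp]: "monom_eval v 0 = 1"
  by (simp add: monom_eval_def)

lemma poly_eval_superset:
  assumes "finite K" "Poly_Mapping.keys P \<subseteq> K"
  shows "poly_eval v P = (\<Sum>m\<in>K. of_int (Poly_Mapping.lookup P m) * monom_eval v m)"
  unfolding poly_eval_def using assms
  by (intro sum.mono_neutral_left) (auto simp: in_keys_iff)

lemma poly_eval_0 [simp]: "poly_eval v 0 = 0"
  by (simp add: poly_eval_def)

lemma poly_eval_single: "poly_eval v (Poly_Mapping.single m c) = of_int c * monom_eval v m"
  by (subst poly_eval_superset[of "{m}"]) auto

lemma poly_eval_1 [simp]: "poly_eval v 1 = 1"
  using poly_eval_single[of v 0 1] by simp

lemma poly_eval_add [simp]: "poly_eval v (P + Q) = poly_eval v P + poly_eval v Q"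
proof -
  let ?K = "Poly_Mapping.keys P \<union> Poly_Mapping.keys Q"
  have K: "finite ?K" by simp
  have "Poly_Mapping.keys (P + Q) \<subseteq> ?K" by (rule Poly_Mapping.keys_add)
  then show ?thesis
    by (simp add: poly_eval_superset[OF K] lookup_add distrib_right sum.distrib)
qed

lemma poly_eval_sum [simp]: "poly_eval v (\<Sum>i\<in>I. f i) = (\<Sum>i\<in>I. poly_eval v (f i))"
  by (induction I rule: infinite_finite_induct) auto

lemma poly_eval_uminus [simp]: "poly_eval v (- P) = - poly_eval v P"
  using poly_eval_add[of v P "-P"] by (simp add: add_eq_0_iff)

lemma poly_eval_diff [simp]: "poly_eval v (P - Q) = poly_eval v P - poly_eval v Q"
  using poly_eval_add[of v P "-Q"] by simp

lemma poly_mapping_eq_sum_single: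
  "P = (\<Sum>m\<in>Poly_Mapping.keys P. Poly_Mapping.single m (Poly_Mapping.lookup P m))"
  by (rule poly_mapping_eqI)
    (simp add: lookup_sum lookup_single when_def in_keys_iff)

lemma poly_eval_mult [simp]: "poly_eval v (P * Q) = poly_eval v P * poly_eval v Q"
proof -
  let ?s = "\<lambda>P m. Poly_Mapping.single m (Poly_Mapping.lookup P m)"
  have "P * Q = (\<Sum>m\<in>Poly_Mapping.keys P. ?s P m) * (\<Sum>m\<in>Poly_Mapping.keys Q. ?s Q m)"
    by (simp only: poly_mapping_eq_sum_single[symmetric])
  also have "poly_eval v \<dots> =
      poly_eval v (\<Sum>m\<in>Poly_Mapping.keys P. ?s P m) * poly_eval v (\<Sum>m\<in>Poly_Mapping.keys Q. ?s Q m)"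
    by (simp only: sum_product poly_eval_sum mult_single poly_eval_single monom_eval_add of_int_mult)
      (simp add: mult_ac)
  also have "\<dots> = poly_eval v P * poly_eval v Q"
    by (simp only: poly_mapping_eq_sum_single[symmetric])
  finally show ?thesis .
qed

lemma poly_eval_power [simp]: "poly_eval v (P ^ k) = poly_eval v P ^ k"
  by (induction k) auto

lemma poly_eval_of_nat [simp]: "poly_eval v (of_nat k) = of_nat k"
  by (induction k) auto

lemma poly_eval_of_int [simp]: "poly_eval v (of_int k) = of_int k"
  by (cases k) (auto simp del: of_nat_Suc)

lemma poly_eval_numeral [simp]: "poly_eval v (numeral k) = numeral k"
  using poly_eval_of_nat[of v "numeral k"] by simp

lemma poly_eval_wvar [simp]: "poly_eval v (wvar i) = v i"
  by (simp add: wvar_def poly_eval_single monom_eval_def)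

lemma poly_eval_prod [simp]: "poly_eval v (\<Prod>i\<in>I. f i) = (\<Prod>i\<in>I. poly_eval v (f i))"
  by (induction I rule: infinite_finite_induct) auto

lemma poly_eval_hom:
  fixes h :: "'r::comm_ring_1 \<Rightarrow> 's::comm_ring_1" and v :: "'v \<Rightarrow> 'r"
  assumes "\<And>a b. h (a + b) = h a + h b" "\<And>a b. h (a * b) = h a * h b" "h 1 = 1"
  shows "h (poly_eval v P) = poly_eval (\<lambda>i. h (v i)) P"
proof -
  have 0: "h 0 = 0" using assms(1)[of 0 0] by simp
  have neg: "h (- a) = - h a" for a using assms(1)[of a "-a"] 0 by (simp add: eq_neg_iff_add_eq_0 add.commute)
  have nat: "h (of_nat k) = of_nat k" for k by (induction k) (auto simp: assms 0)
  have int: "h (of_int k) = of_int k" for k by (cases k) (auto simp: nat neg simp del: of_nat_Suc)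
  have sum: "h (sum f I) = (\<Sum>i\<in>I. h (f i))" for f and I :: "('v \<Rightarrow>\<^sub>0 nat) set"
    by (induction I rule: infinite_finite_induct) (auto simp: assms 0)
  have pow: "h (a ^ k) = h a ^ k" for a k by (induction k) (auto simp: assms)
  have prod: "h (prod f I) = (\<Prod>i\<in>I. h (f i))" for f and I :: "'v set"
    by (induction I rule: infinite_finite_induct) (auto simp: assms)
  show ?thesis by (simp add: poly_eval_def monom_eval_def sum assms(2) int prod pow)
qed

lemma wvar_power: "wvar i ^ k = Poly_Mapping.single (Poly_Mapping.single i k) 1"
  by (induction k) (simp_all add: wvar_def mult_single flip: single_add)

lemma prod_wvar: "finite I \<Longrightarrow>
  (\<Prod>i\<in>I. wvar i ^ f i) = Poly_Mapping.single (\<Sum>i\<in>I. Poly_Mapping.single i (f i)) 1"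
  by (induction I rule: finite_induct) (simp_all add: wvar_power mult_single)

lemma monom_eval_wvar: "monom_eval wvar m = Poly_Mapping.single m 1"
  by (simp add: monom_eval_def prod_wvar flip: poly_mapping_eq_sum_single)

lemma of_int_mult_single: "of_int c * Poly_Mapping.single m d = Poly_Mapping.single m (c * d :: int)"
  by (simp flip: single_of_int add: mult_single)

lemma poly_eval_wvar_id [simp]: "poly_eval wvar P = P"
  by (simp add: poly_eval_def monom_eval_wvar of_int_mult_single flip: poly_mapping_eq_sum_single)

lemma lookup_of_nat_mult: "Poly_Mapping.lookup (of_nat k * P :: ('v \<Rightarrow>\<^sub>0 nat) \<Rightarrow>\<^sub>0 int) m = int k * Poly_Mapping.lookup P m"
  by (induction k) (auto simp: distrib_right lookup_add)

lemma of_nat_mult_eq_0_poly: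
  fixes P :: "('v \<Rightarrow>\<^sub>0 nat) \<Rightarrow>\<^sub>0 int"
  assumes "of_nat k * P = 0" "k > 0"
  shows "P = 0"
proof (rule poly_mapping_eqI)
  fix m show "Poly_Mapping.lookup P m = Poly_Mapping.lookup 0 m"
    using assms lookup_of_nat_mult[of k P m] by simp
qed

text \<open>Turns the rounding division in \<open>witt_solve\<close> into an exact one as soon as
  divisibility is known.\<close>

lemma of_nat_mult_map_div:
  fixes P :: "('v \<Rightarrow>\<^sub>0 nat) \<Rightarrow>\<^sub>0 int"
  assumes "of_nat k dvd P" "k > 0"
  shows "of_nat k * Poly_Mapping.map (\<lambda>c. c div int k) P = P"
proof -
  obtain Q where Q: "P = of_nat k * Q" using assms by auto
  have "Poly_Mapping.map (\<lambda>c. c div int k) P = Q"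
    by (rule poly_mapping_eqI)
      (use assms in \<open>auto simp: Q lookup_of_nat_mult Poly_Mapping.map.rep_eq when_def\<close>)
  with Q show ?thesis by simp
qed

section \<open>Integrality of the Witt polynomials\<close>

lemma prime_dvd_binomial_power:
  fixes a b :: "'r::comm_ring_1"
  assumes "Factorial_Ring.prime (p::nat)"
  shows "of_nat p dvd (a + b) ^ p - (a ^ p + b ^ p)"
proof -
  have p: "p > 1" using assms prime_gt_1_nat by blast
  have "{..p} = insert 0 (insert p {1..<p})" using p by auto
  then have "(a + b) ^ p - (a ^ p + b ^ p) = (\<Sum>k=1..<p. of_nat (p choose k) * a ^ k * b ^ (p - k))"
    using p by (simp add: binomial_ring)
  moreover have "of_nat p dvd of_nat (p choose k) * a ^ k * b ^ (p - k)" if "k \<in> {1..<p}" for k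
  proof -
    have "p dvd (p choose k)" using that assms by (intro dvd_choose_prime) auto
    then have "of_nat p dvd (of_nat (p choose k) :: 'r)" by (metis dvd_def of_nat_mult)
    then show ?thesis by (metis dvd_mult2)
  qed
  ultimately show ?thesis by (simp only:) (rule dvd_sum, simp)
qed

lemma fermat_int: 
  assumes "Factorial_Ring.prime (p::nat)"
  shows "int p dvd c ^ p - c"
proof (induction c rule: int_induct[where k = 0])
  case base
  then show ?case using assms prime_gt_0_nat by (simp add: power_0_left)
next
  case (step1 i)
  then show ?case using prime_dvd_binomial_power[OF assms, of i 1] 
    by (simp add: dvd_diff_commute) (smt (verit, best) dvd_add_right_iff of_nat_dvd_iff)
next
  case (step2 i)
  then show ?case using prime_dvd_binomial_power[OF assms, of "i - 1" 1] 
    by (simp) (smt (verit, best) dvd_add_right_iff dvd_diff)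
qed

text \<open>A lift of Frobenius to the integral polynomial ring, as in Dwork's integrality
  criterion.\<close>

definition phi :: "nat \<Rightarrow> witt_poly \<Rightarrow> witt_poly" where
  "phi p = poly_eval (\<lambda>v. wvar v ^ p)"

text \<open>Modulo p both sides are additive, by the binomial theorem, so it is enough to compare
  them on single terms, where Fermat's little theorem takes care of the coefficient.\<close>

lemma phi_cong_power:
  assumes "Factorial_Ring.prime p"
  shows "of_nat p dvd P ^ p - phi p P"
proof -
  have p0: "p > 0" using assms prime_gt_0_nat by blast
  have single: "of_nat p dvd (Poly_Mapping.single m c) ^ p - phi p (Poly_Mapping.single m c)" for m c
  proof -
    let ?M = "Poly_Mapping.single m 1 :: witt_poly"
    have "Poly_Mapping.single m c = of_int c * ?M" by (simp add: of_int_mult_single)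
    moreover have "phi p ?M = monom_eval wvar m ^ p"
      by (simp add: phi_def poly_eval_single monom_eval_def prod_power_distrib mult.commute[of _ p]
          flip: power_mult)
    ultimately have "(Poly_Mapping.single m c) ^ p - phi p (Poly_Mapping.single m c) = of_int (c ^ p - c) * ?M ^ p"
      by (simp add: phi_def monom_eval_wvar power_mult_distrib left_diff_distrib)
    moreover have "of_nat p dvd (of_int (c ^ p - c) :: witt_poly)"
      by (metis fermat_int[OF assms] dvd_def of_int_mult of_int_of_nat_eq)
    ultimately show ?thesis by (metis dvd_mult2)
  qed
  have "of_nat p dvd (\<Sum>m\<in>I. Poly_Mapping.single m (c m)) ^ p - phi p (\<Sum>m\<in>I. Poly_Mapping.single m (c m))"
    if "finite I" for I and c :: "(nat + nat \<Rightarrow>\<^sub>0 nat) \<Rightarrow> int"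
    using that
  proof (induction I rule: finite_induct)
    case empty
    then show ?case using p0 by (simp add: phi_def power_0_left)
  next
    case (insert m I)
    let ?a = "Poly_Mapping.single m (c m)" let ?b = "\<Sum>m\<in>I. Poly_Mapping.single m (c m)"
    have "(?a + ?b) ^ p - phi p (?a + ?b) = ((?a + ?b) ^ p - (?a ^ p + ?b ^ p)) + (?a ^ p - phi p ?a) + (?b ^ p - phi p ?b)"
      by (simp add: phi_def)
    then have "of_nat p dvd (?a + ?b) ^ p - phi p (?a + ?b)"
      using prime_dvd_binomial_power[OF assms, of ?a ?b] single[of m "c m"] insert.IH
      by (simp only: dvd_add)
    then show ?case using insert by simp
  qed
  from this[of "Poly_Mapping.keys P" "Poly_Mapping.lookup P"] show ?thesis
    by (simp flip: poly_mapping_eq_sum_single)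
qed

text \<open>In a^p - b^p = (a - b) s the cofactor s is congruent to p b^(p-1) modulo p, because a
  and b agree modulo p; so s contributes one more factor p.\<close>

lemma dvd_power_prime_diff:
  fixes a b :: "'r::comm_ring_1"
  assumes "of_nat p dvd m" "m dvd a - b" "p > 0"
  shows "of_nat p * m dvd a ^ p - b ^ p"
proof -
  have "of_nat p dvd a - b" using assms dvd_trans by blast
  then have ab: "of_nat p dvd a ^ i - b ^ i" for i
    unfolding power_diff_sumr2[of a i b] by (rule dvd_mult2)
  have "(\<Sum>i<p. b ^ (p - Suc i) * a ^ i) = (\<Sum>i<p. b ^ (p - Suc i) * (a ^ i - b ^ i)) + of_nat p * b ^ (p - 1)"
  proof -
    have "(\<Sum>i<p. b ^ (p - Suc i) * b ^ i) = (\<Sum>i<p. b ^ (p - 1))"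
      by (intro sum.cong) (auto simp flip: power_add)
    then show ?thesis by (simp add: right_diff_distrib sum_subtractf)
  qed
  also have "of_nat p dvd \<dots>"
    by (intro dvd_add dvd_sum dvd_mult ab dvd_triv_left)
  finally have "of_nat p dvd (\<Sum>i<p. b ^ (p - Suc i) * a ^ i)" .
  from mult_dvd_mono[OF assms(2) this] show ?thesis
    unfolding power_diff_sumr2[of a p b] by (simp add: mult.commute)
qed

lemma dvd_prime_power_diff:
  fixes a b :: "'r::comm_ring_1"
  assumes "of_nat p dvd a - b" "p > 0"
  shows "of_nat (p ^ Suc k) dvd a ^ (p ^ k) - b ^ (p ^ k)"
proof (induction k)
  case 0
  then show ?case using assms by simp
next
  case (Suc k)
  have "of_nat p * of_nat (p ^ Suc k) dvd (a ^ (p ^ k)) ^ p - (b ^ (p ^ k)) ^ p"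
    by (rule dvd_power_prime_diff) (use Suc assms in \<open>auto\<close>)
  then show ?case by (simp add: mult.commute flip: power_mult)
qed

text \<open>Dwork's criterion: the congruence between g (n+1) and phi (g n) modulo p^(n+1) is what
  makes the division in \<open>witt_solve\<close> exact at every stage.\<close>

lemma witt_solve_ghost:
  assumes p: "Factorial_Ring.prime p"
    and g: "\<And>n. of_nat (p ^ Suc n) dvd g (Suc n) - phi p (g n)"
  shows "ghost p n (witt_solve p g) = g n"
proof (induction n rule: less_induct)
  case (less n)
  have p0: "p > 0" using p prime_gt_0_nat by blast
  let ?T = "witt_solve p g"
  let ?h = "\<Sum>i<n. of_nat (p ^ i) * ?T i ^ (p ^ (n - i))"
  have dv: "of_nat (p ^ n) dvd g n - ?h"
  proof (cases n)
    case (Suc m)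
    \<comment> \<open>\<open>?h\<close> is compared with phi (g m) term by term: T_i^p and phi T_i
      agree modulo p, so their p^(m-i)-th powers agree modulo p^(m-i+1), and the weight p^i supplies
      the remaining factor.\<close>
    have "phi p (g m) = phi p (ghost p m ?T)" using less Suc by simp
    also have "\<dots> = (\<Sum>i<n. of_nat (p ^ i) * phi p (?T i) ^ (p ^ (m - i)))"
      by (simp add: ghost_def phi_def Suc lessThan_Suc_atMost)
    finally have "?h - phi p (g m) = (\<Sum>i<n. of_nat (p ^ i) * ((?T i ^ p) ^ (p ^ (m - i)) - phi p (?T i) ^ (p ^ (m - i))))"
      by (simp add: right_diff_distrib sum_subtractf Suc Suc_diff_le less_Suc_eq_le flip: power_mult)
    moreover have "of_nat (p ^ n) dvd of_nat (p ^ i) * ((?T i ^ p) ^ (p ^ (m - i)) - phi p (?T i) ^ (p ^ (m - i)))"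
      if "i < n" for i
    proof -
      have "of_nat (p ^ Suc (m - i)) dvd ((?T i ^ p) ^ (p ^ (m - i)) - phi p (?T i) ^ (p ^ (m - i)))"
        by (rule dvd_prime_power_diff) (use phi_cong_power[OF p] p0 in auto)
      moreover have "of_nat (p ^ n) = of_nat (p ^ i) * (of_nat (p ^ Suc (m - i)) :: witt_poly)"
        using that Suc by (simp flip: of_nat_mult power_add of_nat_power power_Suc)
      ultimately show ?thesis by (simp add: mult_dvd_mono)
    qed
    ultimately have "of_nat (p ^ n) dvd ?h - phi p (g m)" by (simp only:) (rule dvd_sum, simp)
    moreover have "of_nat (p ^ n) dvd g n - phi p (g m)" using g[of m] Suc by simp
    ultimately have "of_nat (p ^ n) dvd (g n - phi p (g m)) - (?h - phi p (g m))" by (rule dvd_diff[rotated])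
    then show ?thesis by simp
  qed simp
  have "of_nat (p ^ n) * ?T n = g n - ?h"
    using of_nat_mult_map_div[OF dv] p0 by (simp add: witt_solve.simps[of p g n])
  then show ?case
    by (simp add: ghost_def lessThan_Suc_atMost[symmetric] del: of_nat_power)
qed

text \<open>\<open>phi\<close> turns the n-th ghost polynomial in variables into the (n+1)-st
  without its last term, and that term has the coefficient p^(n+1).\<close>

lemma phi_ghost_wvar: "of_nat (p ^ Suc n) dvd ghost p (Suc n) (\<lambda>i. wvar (f i)) - phi p (ghost p n (\<lambda>i. wvar (f i)))"
proof -
  have "phi p (ghost p n (\<lambda>i. wvar (f i))) = (\<Sum>i\<le>n. of_nat (p ^ i) * wvar (f i) ^ (p ^ (Suc n - i)))"
    by (auto simp: ghost_def phi_def Suc_diff_le intro!: sum.cong simp flip: power_mult)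
  then show ?thesis by (simp add: ghost_def)
qed

lemma ghost_witt_add_poly:
  assumes "Factorial_Ring.prime p"
  shows "ghost p n (witt_add_poly p) = ghost p n (\<lambda>i. wvar (Inl i)) + ghost p n (\<lambda>i. wvar (Inr i))"
  unfolding witt_add_poly_def
proof (rule witt_solve_ghost[OF assms])
  fix n
  show "of_nat (p ^ Suc n) dvd ghost p (Suc n) (\<lambda>i. wvar (Inl i)) + ghost p (Suc n) (\<lambda>i. wvar (Inr i)) - phi p (ghost p n (\<lambda>i. wvar (Inl i)) + ghost p n (\<lambda>i. wvar (Inr i)))"
    using dvd_add[OF phi_ghost_wvar[of p n Inl] phi_ghost_wvar[of p n Inr]]
    by (simp add: phi_def algebra_simps)
qed

lemma ghost_witt_mult_poly:
  assumes "Factorial_Ring.prime p"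
  shows "ghost p n (witt_mult_poly p) = ghost p n (\<lambda>i. wvar (Inl i)) * ghost p n (\<lambda>i. wvar (Inr i))"
  unfolding witt_mult_poly_def
proof (rule witt_solve_ghost[OF assms])
  fix n
  let ?a = "ghost p (Suc n) (\<lambda>i. wvar (Inl i))" let ?b = "ghost p (Suc n) (\<lambda>i. wvar (Inr i))"
  let ?c = "phi p (ghost p n (\<lambda>i. wvar (Inl i)))" let ?d = "phi p (ghost p n (\<lambda>i. wvar (Inr i)))"
  have "?a * ?b - ?c * ?d = (?a - ?c) * ?b + (?b - ?d) * ?c" by (simp add: algebra_simps)
  then show "of_nat (p ^ Suc n) dvd ?a * ?b - phi p (ghost p n (\<lambda>i. wvar (Inl i)) * ghost p n (\<lambda>i. wvar (Inr i)))"
    using dvd_add[OF dvd_mult2[OF phi_ghost_wvar[of p n Inl], of ?b] dvd_mult2[OF phi_ghost_wvar[of p n Inr], of ?c]]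
    by (simp add: phi_def)
qed

definition witt_m1_poly :: "nat \<Rightarrow> nat \<Rightarrow> witt_poly" where
  "witt_m1_poly p = witt_solve p (\<lambda>_. - 1)"

lemma ghost_witt_m1_poly:
  assumes "Factorial_Ring.prime p"
  shows "ghost p n (witt_m1_poly p) = - 1"
  unfolding witt_m1_poly_def
  by (rule witt_solve_ghost[OF assms]) (simp add: phi_def)

text \<open>The n-th entry enters the n-th ghost component linearly with factor p^n, next to earlier
  entries only, and the polynomial ring is torsion-free.\<close>

lemma ghost_inj:
  assumes "p > 0" "\<And>n. ghost p n a = ghost p n b"
  shows "a = b"
proof
  fix n
  show "a n = b n"
  proof (induction n rule: less_induct)
    case (less n)
    have "of_nat (p ^ n) * (a n - b n) = ghost p n a - ghost p n b"
      by (simp add: ghost_def lessThan_Suc_atMost[symmetric] less right_diff_distrib)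
    then have "of_nat (p ^ n) * (a n - b n) = 0" using assms by simp
    then have "a n - b n = 0" by (rule of_nat_mult_eq_0_poly) (use assms in simp)
    then show ?case by simp
  qed
qed

lemma ghost_poly_eval: "ghost p n (\<lambda>i. poly_eval v (a i)) = poly_eval v (ghost p n a)"
  by (simp add: ghost_def)

section \<open>The ring of Witt vectors\<close>

definition wadd :: "nat \<Rightarrow> (nat \<Rightarrow> 'r::comm_ring_1) \<Rightarrow> (nat \<Rightarrow> 'r) \<Rightarrow> nat \<Rightarrow> 'r" where
  "wadd p a b i = poly_eval (case_sum a b) (witt_add_poly p i)"

definition wmul :: "nat \<Rightarrow> (nat \<Rightarrow> 'r::comm_ring_1) \<Rightarrow> (nat \<Rightarrow> 'r) \<Rightarrow> nat \<Rightarrow> 'r" where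
  "wmul p a b i = poly_eval (case_sum a b) (witt_mult_poly p i)"

definition teich :: "'r::comm_ring_1 \<Rightarrow> nat \<Rightarrow> 'r" where
  "teich t i = (if i = 0 then t else 0)"

abbreviation wone :: "nat \<Rightarrow> 'r::comm_ring_1" where "wone \<equiv> teich 1"

abbreviation wzero :: "nat \<Rightarrow> 'r::comm_ring_1" where "wzero \<equiv> (\<lambda>_. 0)"

text \<open>For \<open>p = 2\<close> negation is not coordinatewise, whence the universal Witt vector $-1$.\<close>

definition wneg :: "nat \<Rightarrow> (nat \<Rightarrow> 'r::comm_ring_1) \<Rightarrow> nat \<Rightarrow> 'r" where
  "wneg p a = wmul p (\<lambda>i. poly_eval (\<lambda>_. 0) (witt_m1_poly p i)) a"

definition wsub :: "nat \<Rightarrow> (nat \<Rightarrow> 'r::comm_ring_1) \<Rightarrow> (nat \<Rightarrow> 'r) \<Rightarrow> nat \<Rightarrow> 'r" where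
  "wsub p a b = wadd p a (wneg p b)"

definition wV :: "(nat \<Rightarrow> 'r::comm_ring_1) \<Rightarrow> nat \<Rightarrow> 'r" where
  "wV a i = (case i of 0 \<Rightarrow> 0 | Suc j \<Rightarrow> a j)"

definition wF :: "nat \<Rightarrow> (nat \<Rightarrow> 'r::comm_ring_1) \<Rightarrow> nat \<Rightarrow> 'r" where
  "wF p a i = a i ^ p"

lemma wV_simps [simp]: "wV a 0 = 0" "wV a (Suc i) = a i"
  by (simp_all add: wV_def)

lemma teich_simps [simp]: "teich t 0 = t" "teich t (Suc i) = 0"
  by (simp_all add: teich_def)

text \<open>Witt operations are integer polynomials in the components, hence functorial. This is
  applied to \<open>poly_eval\<close> and, in characteristic p, to the Frobenius.\<close>

lemma witt_hom:
  fixes h :: "'r::comm_ring_1 \<Rightarrow> 's::comm_ring_1"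
  assumes "\<And>a b. h (a + b) = h a + h b" "\<And>a b. h (a * b) = h a * h b" "h 1 = 1"
  shows "h (wadd p a b i) = wadd p (\<lambda>i. h (a i)) (\<lambda>i. h (b i)) i"
    and "h (wmul p a b i) = wmul p (\<lambda>i. h (a i)) (\<lambda>i. h (b i)) i"
    and "h (wneg p a i) = wneg p (\<lambda>i. h (a i)) i"
    and "h (wsub p a b i) = wsub p (\<lambda>i. h (a i)) (\<lambda>i. h (b i)) i"
proof -
  have cs: "h (case_sum a b x) = case_sum (\<lambda>i. h (a i)) (\<lambda>i. h (b i)) x" for a b :: "nat \<Rightarrow> 'r" and x
    by (simp split: sum.split)
  have 0: "h 0 = 0" using assms(1)[of 0 0] by simp
  show add: "h (wadd p a b i) = wadd p (\<lambda>i. h (a i)) (\<lambda>i. h (b i)) i" for a b i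
    by (simp add: wadd_def poly_eval_hom[of h, OF assms] cs)
  show mul: "h (wmul p a b i) = wmul p (\<lambda>i. h (a i)) (\<lambda>i. h (b i)) i" for a b i
    by (simp add: wmul_def poly_eval_hom[of h, OF assms] cs)
  show neg: "h (wneg p a i) = wneg p (\<lambda>i. h (a i)) i" for a i
    by (simp add: wneg_def mul poly_eval_hom[of h, OF assms] 0)
  show "h (wsub p a b i) = wsub p (\<lambda>i. h (a i)) (\<lambda>i. h (b i)) i"
    by (simp add: wsub_def add neg)
qed

lemmas poly_eval_witt [simp] =
  witt_hom[of "poly_eval v" for v, OF poly_eval_add poly_eval_mult poly_eval_1]

lemma ghost_wadd [simp]:
  assumes "Factorial_Ring.prime p"
  shows "ghost p n (wadd p a b) = ghost p n a + ghost p n b"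
proof -
  have "wadd p a b = (\<lambda>i. poly_eval (case_sum a b) (witt_add_poly p i))"
    by (rule ext) (rule wadd_def)
  then have "ghost p n (wadd p a b) = poly_eval (case_sum a b) (ghost p n (witt_add_poly p))"
    by (simp only: ghost_poly_eval)
  then show ?thesis by (simp add: ghost_witt_add_poly[OF assms] flip: ghost_poly_eval)
qed

lemma ghost_wmul [simp]:
  assumes "Factorial_Ring.prime p"
  shows "ghost p n (wmul p a b) = ghost p n a * ghost p n b"
proof -
  have "wmul p a b = (\<lambda>i. poly_eval (case_sum a b) (witt_mult_poly p i))"
    by (rule ext) (rule wmul_def)
  then have "ghost p n (wmul p a b) = poly_eval (case_sum a b) (ghost p n (witt_mult_poly p))"
    by (simp only: ghost_poly_eval)
  then show ?thesis by (simp add: ghost_witt_mult_poly[OF assms] flip: ghost_poly_eval)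
qed

lemma ghost_wneg [simp]:
  assumes "Factorial_Ring.prime p"
  shows "ghost p n (wneg p a) = - ghost p n a"
  by (simp add: wneg_def assms ghost_poly_eval ghost_witt_m1_poly)

lemma ghost_wsub [simp]:
  assumes "Factorial_Ring.prime p"
  shows "ghost p n (wsub p a b) = ghost p n a - ghost p n b"
  by (simp add: wsub_def assms)

lemma ghost_wzero [simp]: "p > 0 \<Longrightarrow> ghost p n wzero = 0"
  by (simp add: ghost_def power_0_left)

lemma ghost_teich [simp]: "p > 0 \<Longrightarrow> ghost p n (teich t) = t ^ (p ^ n)"
  by (simp add: ghost_def sum.atMost_shift power_0_left)

lemma ghost_wV: "p > 0 \<Longrightarrow> ghost p n (wV a) = (case n of 0 \<Rightarrow> 0 | Suc m \<Rightarrow> of_nat p * ghost p m a)"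
  by (cases n) (simp_all add: ghost_def sum.atMost_Suc_shift power_0_left sum_distrib_left mult.assoc del: sum.atMost_Suc)

text \<open>Three Witt vectors over any ring are specialisations of three families of variables, so
  identities of Witt vectors may be checked over the polynomial ring, where the ghost map is
  injective.\<close>

lemma universal_witt_vectors:
  fixes a b c :: "nat \<Rightarrow> 'r::comm_ring_1"
  obtains v :: "nat + nat \<Rightarrow> 'r" and \<alpha> \<beta> \<gamma> where
    "a = (\<lambda>i. poly_eval v (\<alpha> i))" "b = (\<lambda>i. poly_eval v (\<beta> i))" "c = (\<lambda>i. poly_eval v (\<gamma> i))"
proof
  let ?v = "case_sum (\<lambda>j. if even j then a (j div 2) else b (j div 2)) c"
  show "a = (\<lambda>i. poly_eval ?v (wvar (Inl (2 * i))))" by simp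
  show "b = (\<lambda>i. poly_eval ?v (wvar (Inl (Suc (2 * i)))))" by simp
  show "c = (\<lambda>i. poly_eval ?v (wvar (Inr i)))" by simp
qed

locale witt =
  fixes p :: nat and ty :: "'r::comm_ring_1 itself"
  assumes prime_p: "Factorial_Ring.prime p"
begin

lemma p_pos [simp]: "p > 0"
  using prime_p prime_gt_0_nat by blast

lemma ghostI: "(\<And>n. ghost p n a = ghost p n b) \<Longrightarrow> a = b"
  by (rule ghost_inj[OF p_pos])

text \<open>\<open>f\<close> and \<open>g\<close> are the two sides of an identity over the
  polynomial ring, where \<open>ghostI\<close> proves it; \<open>f'\<close> and \<open>g'\<close>
  are the same expressions over the given ring. The last two premises say that evaluation commutes
  with them.\<close>

lemma witt_identity:
  fixes a b c :: "nat \<Rightarrow> 'r"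
  assumes "\<And>\<alpha> \<beta> \<gamma> :: nat \<Rightarrow> witt_poly. f \<alpha> \<beta> \<gamma> = g \<alpha> \<beta> \<gamma>"
    and "\<And>(v :: nat + nat \<Rightarrow> 'r) \<alpha> \<beta> \<gamma>. (\<lambda>i. poly_eval v (f \<alpha> \<beta> \<gamma> i)) =
      f' (\<lambda>i. poly_eval v (\<alpha> i)) (\<lambda>i. poly_eval v (\<beta> i)) (\<lambda>i. poly_eval v (\<gamma> i))"
    and "\<And>(v :: nat + nat \<Rightarrow> 'r) \<alpha> \<beta> \<gamma>. (\<lambda>i. poly_eval v (g \<alpha> \<beta> \<gamma> i)) =
      g' (\<lambda>i. poly_eval v (\<alpha> i)) (\<lambda>i. poly_eval v (\<beta> i)) (\<lambda>i. poly_eval v (\<gamma> i))"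
  shows "f' a b c = g' a b c"
proof -
  show ?thesis
  proof (rule universal_witt_vectors[of a b c])
    fix v :: "nat + nat \<Rightarrow> 'r" and \<alpha> \<beta> \<gamma> :: "nat \<Rightarrow> witt_poly"
    assume abc: "a = (\<lambda>i. poly_eval v (\<alpha> i))" "b = (\<lambda>i. poly_eval v (\<beta> i))" "c = (\<lambda>i. poly_eval v (\<gamma> i))"
    show ?thesis unfolding abc assms(2)[of v \<alpha> \<beta> \<gamma>, symmetric] assms(3)[of v \<alpha> \<beta> \<gamma>, symmetric] assms(1) ..
  qed
qed

lemma ring_axioms_aux:
  fixes a b c :: "nat \<Rightarrow> 'r"
  shows "wadd p (wadd p a b) c = wadd p a (wadd p b c)"
    and "wadd p a b = wadd p b a"
    and "wadd p wzero a = a"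
    and "wadd p (wneg p a) a = wzero"
    and "wmul p (wmul p a b) c = wmul p a (wmul p b c)"
    and "wmul p a b = wmul p b a"
    and "wmul p wone a = a"
    and "wmul p (wadd p a b) c = wadd p (wmul p a c) (wmul p b c)"
proof -
  note [simp] = prime_p
  have t: "(\<lambda>i. poly_eval v (teich 1 i)) = wone" for v :: "nat + nat \<Rightarrow> 'r"
    by (rule ext) (simp add: teich_def)
  show "wadd p (wadd p a b) c = wadd p a (wadd p b c)"
    by (rule witt_identity[of "\<lambda>a b c. wadd p (wadd p a b) c" "\<lambda>a b c. wadd p a (wadd p b c)"])
      (auto intro: ghostI)
  show "wadd p a b = wadd p b a"
    by (rule witt_identity[of "\<lambda>a b c. wadd p a b" "\<lambda>a b c. wadd p b a" "\<lambda>a b c. wadd p a b" "\<lambda>a b c. wadd p b a" a b a])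
      (auto intro: ghostI)
  show "wadd p wzero a = a"
    by (rule witt_identity[of "\<lambda>a b c. wadd p wzero a" "\<lambda>a b c. a" "\<lambda>a b c. wadd p wzero a" "\<lambda>a b c. a" a a a])
      (auto intro: ghostI)
  show "wadd p (wneg p a) a = wzero"
    by (rule witt_identity[of "\<lambda>a b c. wadd p (wneg p a) a" "\<lambda>a b c. wzero" "\<lambda>a b c. wadd p (wneg p a) a" "\<lambda>a b c. wzero" a a a])
      (auto intro: ghostI)
  show "wmul p (wmul p a b) c = wmul p a (wmul p b c)"
    by (rule witt_identity[of "\<lambda>a b c. wmul p (wmul p a b) c" "\<lambda>a b c. wmul p a (wmul p b c)"])
      (auto intro: ghostI)
  show "wmul p a b = wmul p b a"
    by (rule witt_identity[of "\<lambda>a b c. wmul p a b" "\<lambda>a b c. wmul p b a" "\<lambda>a b c. wmul p a b" "\<lambda>a b c. wmul p b a" a b a])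
      (auto intro: ghostI)
  show "wmul p wone a = a"
    by (rule witt_identity[of "\<lambda>a b c. wmul p wone a" "\<lambda>a b c. a" "\<lambda>a b c. wmul p wone a" "\<lambda>a b c. a" a a a])
      (auto intro: ghostI simp: t)
  show "wmul p (wadd p a b) c = wadd p (wmul p a c) (wmul p b c)"
    by (rule witt_identity[of "\<lambda>a b c. wmul p (wadd p a b) c" "\<lambda>a b c. wadd p (wmul p a c) (wmul p b c)"])
      (auto intro: ghostI simp: distrib_right)
qed

end

sublocale witt \<subseteq> W: comm_ring_1 "wmul p :: (nat \<Rightarrow> 'r) \<Rightarrow> _" wone "wadd p" wzero "wsub p" "wneg p"
proof
  show "wzero \<noteq> (wone :: nat \<Rightarrow> 'r)"
    by (metis teich_simps(1) zero_neq_one)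
qed (metis ring_axioms_aux wsub_def)+

context witt
begin

lemma wV_add: "wV (wadd p a b) = wadd p (wV a) (wV (b :: nat \<Rightarrow> 'r))"
proof (rule witt_identity[of "\<lambda>a b c. wV (wadd p a b)" "\<lambda>a b c. wadd p (wV a) (wV b)" "\<lambda>a b c. wV (wadd p a b)" "\<lambda>a b c. wadd p (wV a) (wV b)" a b a])
  show "wV (wadd p \<alpha> \<beta>) = wadd p (wV \<alpha>) (wV \<beta>)" for \<alpha> \<beta> :: "nat \<Rightarrow> witt_poly"
    by (rule ghostI) (simp add: ghost_wV prime_p distrib_left split: nat.split)
  have V: "poly_eval v (wV \<alpha> i) = wV (\<lambda>i. poly_eval v (\<alpha> i)) i" for v :: "nat + nat \<Rightarrow> 'r" and \<alpha> i
    by (simp add: wV_def split: nat.split)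
  show "(\<lambda>i. poly_eval v (wV (wadd p \<alpha> \<beta>) i)) = wV (wadd p (\<lambda>i. poly_eval v (\<alpha> i)) (\<lambda>i. poly_eval v (\<beta> i)))"
    "(\<lambda>i. poly_eval v (wadd p (wV \<alpha>) (wV \<beta>) i)) = wadd p (wV (\<lambda>i. poly_eval v (\<alpha> i))) (wV (\<lambda>i. poly_eval v (\<beta> i)))"
    for v :: "nat + nat \<Rightarrow> 'r" and \<alpha> \<beta> 
    by (auto simp: V)
qed

lemma wV_zero [simp]: "wV wzero = wzero"
  by (rule ext) (simp add: wV_def split: nat.split)

lemma wV_neg: "wV (wneg p a) = wneg p (wV (a :: nat \<Rightarrow> 'r))"
proof -
  have "wadd p (wV a) (wV (wneg p a)) = wzero" by (simp flip: wV_add)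
  then show ?thesis by (rule W.minus_unique[symmetric])
qed

lemma wV_sub: "wV (wsub p a b) = wsub p (wV a) (wV (b :: nat \<Rightarrow> 'r))"
  by (simp only: wV_add wV_neg wsub_def)

text \<open>On ghost components the factor t^(p^n) is absorbed summand by summand, as
  (t^(p^i))^(p^(n-i)) = t^(p^n).\<close>

lemma wmul_teich: "wmul p (teich t) a i = t ^ (p ^ i) * (a i :: 'r)"
proof -
  \<comment> \<open>The scalar is passed as \<open>c 0\<close> because \<open>witt_identity\<close>
    speaks about sequences only.\<close>
  have "wmul p (teich (c 0)) a = (\<lambda>i. c 0 ^ (p ^ i) * (a i :: 'r))" for c :: "nat \<Rightarrow> 'r"
  proof (rule witt_identity[of "\<lambda>a b c. wmul p (teich (c 0)) a" "\<lambda>a b c i. c 0 ^ (p ^ i) * a i"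
        "\<lambda>a b c. wmul p (teich (c 0)) a" "\<lambda>a b c i. c 0 ^ (p ^ i) * a i" a a c])
    show "wmul p (teich (\<gamma> 0)) \<alpha> = (\<lambda>i. \<gamma> 0 ^ (p ^ i) * \<alpha> i)" for \<alpha> \<gamma> :: "nat \<Rightarrow> witt_poly"
    proof (rule ghostI)
      fix n
      have "(\<gamma> 0 ^ p ^ i) ^ (p ^ (n - i)) = \<gamma> 0 ^ p ^ n" if "i \<le> n" for i
        using that by (simp flip: power_mult power_add)
      then show "ghost p n (wmul p (teich (\<gamma> 0)) \<alpha>) = ghost p n (\<lambda>i. \<gamma> 0 ^ (p ^ i) * \<alpha> i)"
        by (simp add: prime_p) (simp add: ghost_def power_mult_distrib sum_distrib_left mult_ac)
    qed
    have t: "(\<lambda>i. poly_eval v (teich t i)) = teich (poly_eval v t)" for v :: "nat + nat \<Rightarrow> 'r" and t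
      by (rule ext) (simp add: teich_def)
    show "(\<lambda>i. poly_eval v (wmul p (teich (\<gamma> 0)) \<alpha> i)) = wmul p (teich (poly_eval v (\<gamma> 0))) (\<lambda>i. poly_eval v (\<alpha> i))" 
      for v :: "nat + nat \<Rightarrow> 'r" and \<alpha> \<gamma> by (simp add: t)
  qed auto
  from this[of "\<lambda>_. t"] show ?thesis by simp
qed

lemma teich_mult: "teich (s * t) = wmul p (teich s) (teich (t :: 'r))"
  by (rule ext) (simp add: wmul_teich, simp add: teich_def)

text \<open>The summand i = 0 of a ghost sum is that of the Teichmueller part; the others are p
  times a ghost sum of the shifted vector.\<close>

lemma witt_decompose: "a = wadd p (teich (a 0)) (wV (\<lambda>i. a (Suc i) :: 'r))"
proof (rule witt_identity[of "\<lambda>a b c. a" "\<lambda>a b c. wadd p (teich (a 0)) (wV (\<lambda>i. a (Suc i)))"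
        "\<lambda>a b c. a" "\<lambda>a b c. wadd p (teich (a 0)) (wV (\<lambda>i. a (Suc i)))" a a a])
  show "\<alpha> = wadd p (teich (\<alpha> 0)) (wV (\<lambda>i. \<alpha> (Suc i)))" for \<alpha> :: "nat \<Rightarrow> witt_poly"
  proof (rule ghostI)
    fix n show "ghost p n \<alpha> = ghost p n (wadd p (teich (\<alpha> 0)) (wV (\<lambda>i. \<alpha> (Suc i))))"
    proof (cases n)
      case 0 then show ?thesis by (simp add: prime_p ghost_wV) (simp add: ghost_def)
    next
      case (Suc m)
      then show ?thesis
        by (simp add: prime_p ghost_wV)
          (simp add: ghost_def sum.atMost_Suc_shift sum_distrib_left mult.assoc del: sum.atMost_Suc)
    qed
  qed
  have t: "poly_eval v (teich t i) = teich (poly_eval v t) i" for v :: "nat + nat \<Rightarrow> 'r" and t i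
    by (simp add: teich_def)
  have V: "poly_eval v (wV \<alpha> i) = wV (\<lambda>i. poly_eval v (\<alpha> i)) i" for v :: "nat + nat \<Rightarrow> 'r" and \<alpha> i
    by (simp add: wV_def split: nat.split)
  show "(\<lambda>i. poly_eval v (wadd p (teich (\<alpha> 0)) (wV (\<lambda>i. \<alpha> (Suc i))) i)) 
     = wadd p (teich (poly_eval v (\<alpha> 0))) (wV (\<lambda>i. poly_eval v (\<alpha> (Suc i))))" 
      for v :: "nat + nat \<Rightarrow> 'r" and \<alpha> by (auto simp: t V)
qed auto

lemma wadd_0 [simp]: "wadd p a b 0 = a 0 + (b 0 :: 'r)"
proof -
  have "(\<lambda>i::nat. wadd p a b 0) = (\<lambda>i. a 0 + (b 0 :: 'r))"
  proof (rule witt_identity[of "\<lambda>a b c i. wadd p a b 0" "\<lambda>a b c i. a 0 + b 0"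
        "\<lambda>a b c i. wadd p a b 0" "\<lambda>a b c i. a 0 + b 0" a b a])
    show "(\<lambda>i::nat. wadd p \<alpha> \<beta> 0) = (\<lambda>i. \<alpha> 0 + \<beta> 0)" for \<alpha> \<beta> :: "nat \<Rightarrow> witt_poly"
      using ghost_wadd[OF prime_p, of 0 \<alpha> \<beta>] by (simp add: ghost_def)
  qed auto
  from fun_cong[OF this] show ?thesis .
qed

lemma wneg_0 [simp]: "wneg p a 0 = - (a 0 :: 'r)"
  using wadd_0[of "wneg p a" a] by (simp add: eq_neg_iff_add_eq_0)

lemma wsub_0 [simp]: "wsub p a b 0 = a 0 - (b 0 :: 'r)"
  by (simp only: wsub_def wadd_0 wneg_0 add_uminus_conv_diff)

end

section \<open>Truncation\<close>

text \<open>Serves to show that component i of a sum or product depends on components up to i only,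
  so that truncation respects the ring operations.\<close>

definition poly_vars :: "(('v \<Rightarrow>\<^sub>0 nat) \<Rightarrow>\<^sub>0 int) \<Rightarrow> 'v set" where
  "poly_vars P = (\<Union>m\<in>Poly_Mapping.keys P. Poly_Mapping.keys m)"

lemma poly_vars_0 [simp]: "poly_vars 0 = {}"
  by (simp add: poly_vars_def)

lemma poly_vars_of_nat [simp]: "poly_vars (of_nat k) = {}"
  by (auto simp: poly_vars_def simp flip: single_of_nat)

lemma poly_vars_1 [simp]: "poly_vars 1 = {}"
  using poly_vars_of_nat[of 1] by simp

lemma poly_vars_wvar [simp]: "poly_vars (wvar v) = {v}"
  by (simp add: poly_vars_def wvar_def)

lemma poly_vars_add: "poly_vars (P + Q) \<subseteq> poly_vars P \<union> poly_vars Q"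
  using Poly_Mapping.keys_add[of P Q] unfolding poly_vars_def by blast

lemma poly_vars_diff: "poly_vars (P - Q) \<subseteq> poly_vars P \<union> poly_vars Q"
  using Poly_Mapping.keys_diff[of P Q] unfolding poly_vars_def by blast

lemma poly_vars_mult: "poly_vars (P * Q) \<subseteq> poly_vars P \<union> poly_vars Q"
proof
  fix v assume "v \<in> poly_vars (P * Q)"
  then obtain m where "m \<in> Poly_Mapping.keys (P * Q)" "v \<in> Poly_Mapping.keys m"
    by (auto simp: poly_vars_def)
  with keys_mult[of P Q] obtain a b where "a \<in> Poly_Mapping.keys P" "b \<in> Poly_Mapping.keys Q" "v \<in> Poly_Mapping.keys (a + b)"
    by auto
  with Poly_Mapping.keys_add[of a b] show "v \<in> poly_vars P \<union> poly_vars Q"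
    by (auto simp: poly_vars_def)
qed

lemma poly_vars_power: "poly_vars (P ^ k) \<subseteq> poly_vars P"
  by (induction k) (use poly_vars_mult in fastforce)+

lemma poly_vars_sum: "poly_vars (\<Sum>i\<in>I. f i) \<subseteq> (\<Union>i\<in>I. poly_vars (f i))"
  by (induction I rule: infinite_finite_induct) (use poly_vars_add in fastforce)+

lemma poly_vars_map: "poly_vars (Poly_Mapping.map f P) \<subseteq> poly_vars P"
  by (auto simp: poly_vars_def in_keys_iff Poly_Mapping.map.rep_eq when_def split: if_splits)

lemma poly_vars_weighted_power: "poly_vars (of_nat k * P ^ l) \<subseteq> poly_vars P"
  using poly_vars_mult[of "of_nat k" "P ^ l"] poly_vars_power[of P l] by auto

lemma poly_vars_ghost: "poly_vars (ghost p n T) \<subseteq> (\<Union>i\<le>n. poly_vars (T i))"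
  unfolding ghost_def by (rule order_trans[OF poly_vars_sum UN_mono[OF order_refl poly_vars_weighted_power]])

lemma poly_vars_witt_solve:
  assumes "\<And>n. poly_vars (g n) \<subseteq> U n" "\<And>m n. m \<le> n \<Longrightarrow> U m \<subseteq> U n"
  shows "poly_vars (witt_solve p g n) \<subseteq> U n"
proof (induction n rule: less_induct)
  case (less n)
  let ?s = "\<Sum>i<n. of_nat (p ^ i) * witt_solve p g i ^ (p ^ (n - i))"
  have "poly_vars ?s \<subseteq> (\<Union>i<n. U i)"
    by (rule order_trans[OF poly_vars_sum UN_mono[OF order_refl order_trans[OF poly_vars_weighted_power]]])
      (simp add: less)
  also have "\<dots> \<subseteq> U n" using assms(2)[of _ n] less_imp_le by blast
  finally have "poly_vars (g n) \<union> poly_vars ?s \<subseteq> U n" using assms(1) by blast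
  then show ?case
    by (subst witt_solve.simps) (rule order_trans[OF order_trans[OF poly_vars_map poly_vars_diff]])
qed

lemma poly_vars_ghost_wvar: "poly_vars (ghost p n (\<lambda>i. wvar (f i))) \<subseteq> f ` {..n}"
  using poly_vars_ghost[of p n "\<lambda>i. wvar (f i)"] by auto

lemma poly_vars_witt_add: "poly_vars (witt_add_poly p n) \<subseteq> Inl ` {..n} \<union> Inr ` {..n}"
  unfolding witt_add_poly_def
  by (rule poly_vars_witt_solve, 
      rule order_trans[OF poly_vars_add Un_mono[OF poly_vars_ghost_wvar poly_vars_ghost_wvar]]) auto

lemma poly_vars_witt_mult: "poly_vars (witt_mult_poly p n) \<subseteq> Inl ` {..n} \<union> Inr ` {..n}"
  unfolding witt_mult_poly_def
  by (rule poly_vars_witt_solve, 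
      rule order_trans[OF poly_vars_mult Un_mono[OF poly_vars_ghost_wvar poly_vars_ghost_wvar]]) auto

lemma poly_eval_cong:
  assumes "\<And>i. i \<in> poly_vars P \<Longrightarrow> v i = w i"
  shows "poly_eval v P = poly_eval w P"
proof -
  have "monom_eval v m = monom_eval w m" if "m \<in> Poly_Mapping.keys P" for m
    unfolding monom_eval_def
    by (rule prod.cong) (use assms that in \<open>auto simp: poly_vars_def simp del: UN_iff intro!: arg_cong2[where f = "(^)"]\<close>)
  then show ?thesis by (simp add: poly_eval_def)
qed

lemma wadd_cong:
  assumes "\<And>j. j \<le> i \<Longrightarrow> a j = a' j" "\<And>j. j \<le> i \<Longrightarrow> b j = b' j"
  shows "wadd p a b i = wadd p a' b' i"
  unfolding wadd_def using assms poly_vars_witt_add[of p i] by (intro poly_eval_cong) auto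

lemma wmul_cong:
  assumes "\<And>j. j \<le> i \<Longrightarrow> a j = a' j" "\<And>j. j \<le> i \<Longrightarrow> b j = b' j"
  shows "wmul p a b i = wmul p a' b' i"
  unfolding wmul_def using assms poly_vars_witt_mult[of p i] by (intro poly_eval_cong) auto

lemma wneg_cong:
  assumes "\<And>j. j \<le> i \<Longrightarrow> a j = a' j"
  shows "wneg p a i = wneg p a' i"
  unfolding wneg_def using assms by (intro wmul_cong) auto

lemma wsub_cong:
  assumes "\<And>j. j \<le> i \<Longrightarrow> a j = a' j" "\<And>j. j \<le> i \<Longrightarrow> b j = b' j"
  shows "wsub p a b i = wsub p a' b' i"
  unfolding wsub_def using assms by (intro wadd_cong wneg_cong) auto

section \<open>Witt vectors over subrings of a field\<close>

definition is_subring :: "'r::comm_ring_1 set \<Rightarrow> bool" where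
  "is_subring B \<longleftrightarrow> 1 \<in> B \<and> (\<forall>a\<in>B. \<forall>b\<in>B. a - b \<in> B \<and> a * b \<in> B)"

definition WS :: "'r set \<Rightarrow> (nat \<Rightarrow> 'r) set" where
  "WS B = {w. \<forall>i. w i \<in> B}"

lemma is_subringD:
  assumes "is_subring B"
  shows "1 \<in> B" "0 \<in> B" "a \<in> B \<Longrightarrow> b \<in> B \<Longrightarrow> a + b \<in> B" "a \<in> B \<Longrightarrow> b \<in> B \<Longrightarrow> a - b \<in> B"
    "a \<in> B \<Longrightarrow> b \<in> B \<Longrightarrow> a * b \<in> B" "a \<in> B \<Longrightarrow> - a \<in> B" "a \<in> B \<Longrightarrow> a ^ k \<in> B"
proof -
  show 1: "1 \<in> B" and diff: "a \<in> B \<Longrightarrow> b \<in> B \<Longrightarrow> a - b \<in> B" and mult: "a \<in> B \<Longrightarrow> b \<in> B \<Longrightarrow> a * b \<in> B" for a b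
    using assms unfolding is_subring_def by auto
  show 0: "0 \<in> B" using diff[OF 1 1] by simp
  show neg: "a \<in> B \<Longrightarrow> - a \<in> B" for a using diff[OF 0, of a] by simp
  show "a \<in> B \<Longrightarrow> b \<in> B \<Longrightarrow> a + b \<in> B" using diff[OF _ neg, of a b] by simp
  show "a \<in> B \<Longrightarrow> a ^ k \<in> B" by (induction k) (auto simp: 1 mult)
qed

lemma is_subring_sum: "is_subring B \<Longrightarrow> (\<And>i. i \<in> I \<Longrightarrow> f i \<in> B) \<Longrightarrow> sum f I \<in> B"
  by (induction I rule: infinite_finite_induct) (auto simp: is_subringD)

lemma is_subring_prod: "is_subring B \<Longrightarrow> (\<And>i. i \<in> I \<Longrightarrow> f i \<in> B) \<Longrightarrow> prod f I \<in> B"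
  by (induction I rule: infinite_finite_induct) (auto simp: is_subringD)

lemma is_subring_of_nat: "is_subring B \<Longrightarrow> of_nat k \<in> B"
  by (induction k) (auto simp: is_subringD)

lemma is_subring_of_int: "is_subring B \<Longrightarrow> of_int k \<in> B"
  by (cases k) (auto simp: is_subringD is_subring_of_nat simp del: of_nat_Suc)

lemma is_subring_poly_eval: "is_subring B \<Longrightarrow> (\<And>i. v i \<in> B) \<Longrightarrow> poly_eval v P \<in> B"
  unfolding poly_eval_def monom_eval_def
  by (intro is_subring_sum is_subring_prod is_subringD(5,7) is_subring_of_int) auto

lemma WS_closed:
  assumes "is_subring B"
  shows "a \<in> WS B \<Longrightarrow> b \<in> WS B \<Longrightarrow> wadd p a b \<in> WS B"
    "a \<in> WS B \<Longrightarrow> b \<in> WS B \<Longrightarrow> wmul p a b \<in> WS B"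
    "a \<in> WS B \<Longrightarrow> wneg p a \<in> WS B"
    "a \<in> WS B \<Longrightarrow> b \<in> WS B \<Longrightarrow> wsub p a b \<in> WS B"
    "t \<in> B \<Longrightarrow> teich t \<in> WS B"
    "wzero \<in> WS B"
    "a \<in> WS B \<Longrightarrow> wV a \<in> WS B"
    "a \<in> WS B \<Longrightarrow> wF p a \<in> WS B"
proof -
  show add: "a \<in> WS B \<Longrightarrow> b \<in> WS B \<Longrightarrow> wadd p a b \<in> WS B" for a b
    by (auto simp: WS_def wadd_def intro!: is_subring_poly_eval[OF assms] split: sum.split)
  show mul: "a \<in> WS B \<Longrightarrow> b \<in> WS B \<Longrightarrow> wmul p a b \<in> WS B" for a b
    by (auto simp: WS_def wmul_def intro!: is_subring_poly_eval[OF assms] split: sum.split)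
  show neg: "a \<in> WS B \<Longrightarrow> wneg p a \<in> WS B" for a
    unfolding wneg_def by (intro mul) (auto simp: WS_def is_subringD[OF assms] intro!: is_subring_poly_eval[OF assms])
  show "a \<in> WS B \<Longrightarrow> b \<in> WS B \<Longrightarrow> wsub p a b \<in> WS B"
    unfolding wsub_def by (intro add neg)
qed (auto simp: WS_def teich_def wV_def wF_def is_subringD[OF assms] split: nat.split)

lemma WS_mono: "B \<subseteq> C \<Longrightarrow> w \<in> WS B \<Longrightarrow> w \<in> WS C"
  by (auto simp: WS_def)

text \<open>Witt vectors have infinite length throughout; W_n is obtained by comparing the first n
  components, a relation that all operations respect.\<close>

definition weq :: "nat \<Rightarrow> (nat \<Rightarrow> 'r) \<Rightarrow> (nat \<Rightarrow> 'r) \<Rightarrow> bool" where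
  "weq n a b \<longleftrightarrow> (\<forall>i<n. a i = b i)"

lemma weq_refl [simp]: "weq n a a"
  by (simp add: weq_def)

lemma weq_sym: "weq n a b \<Longrightarrow> weq n b a"
  by (simp add: weq_def)

lemma weq_trans [trans]: "weq n a b \<Longrightarrow> weq n b c \<Longrightarrow> weq n a c"
  by (simp add: weq_def)

lemma weq_mono: "weq n a b \<Longrightarrow> m \<le> n \<Longrightarrow> weq m a b"
  by (simp add: weq_def)

lemma weq_wadd: "weq n a a' \<Longrightarrow> weq n b b' \<Longrightarrow> weq n (wadd p a b) (wadd p a' b')"
  unfolding weq_def by (auto intro: wadd_cong)

lemma weq_wmul: "weq n a a' \<Longrightarrow> weq n b b' \<Longrightarrow> weq n (wmul p a b) (wmul p a' b')"
  unfolding weq_def by (auto intro: wmul_cong)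

lemma weq_wneg: "weq n a a' \<Longrightarrow> weq n (wneg p a) (wneg p a')"
  unfolding weq_def by (auto intro: wneg_cong)

lemma weq_wsub: "weq n a a' \<Longrightarrow> weq n b b' \<Longrightarrow> weq n (wsub p a b) (wsub p a' b')"
  unfolding weq_def by (auto intro: wsub_cong)

lemma weq_wV: "weq n a b \<Longrightarrow> weq (Suc n) (wV a) (wV b)"
  by (auto simp: weq_def wV_def split: nat.split)

lemma weq_wF: "weq n a b \<Longrightarrow> weq n (wF p a) (wF p b)"
  by (auto simp: weq_def wF_def)

text \<open>Up to truncation this is W_n(B) + W_n(C), the image of the Cech differential; for B =
  A[1/x] and C = A[1/y] the cokernel is H^2.\<close>

definition Bd :: "nat \<Rightarrow> nat \<Rightarrow> 'r::comm_ring_1 set \<Rightarrow> 'r set \<Rightarrow> (nat \<Rightarrow> 'r) set" where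
  "Bd p n B C = {w. \<exists>u\<in>WS B. \<exists>v\<in>WS C. weq n w (wadd p u v)}"

lemma Bd_weq: "weq n w w' \<Longrightarrow> w' \<in> Bd p n B C \<Longrightarrow> w \<in> Bd p n B C"
  unfolding Bd_def by (blast intro: weq_trans)

lemma Bd_mono: "m \<le> n \<Longrightarrow> w \<in> Bd p n B C \<Longrightarrow> w \<in> Bd p m B C"
  unfolding Bd_def by (blast intro: weq_mono)

section \<open>Localizations as subrings of a field\<close>

definition frac_set :: "'r::field set \<Rightarrow> 'r \<Rightarrow> 'r set" where
  "frac_set A s = {a / s ^ i | a i. a \<in> A}"

lemma frac_setI: "a \<in> A \<Longrightarrow> u = a / s ^ i \<Longrightarrow> u \<in> frac_set A s"
  by (auto simp: frac_set_def)

lemma frac_set_subset: "A \<subseteq> frac_set A s"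
  by (auto intro: frac_setI[where i = 0])

lemma frac_set_is_subring:
  assumes A: "is_subring A" and s: "s \<in> A" "s \<noteq> 0"
  shows "is_subring (frac_set A s)"
  unfolding is_subring_def
proof (intro conjI ballI)
  show "1 \<in> frac_set A s" by (rule frac_setI[of 1 _ _ _ 0]) (use A in \<open>auto simp: is_subringD\<close>)
  fix u v assume "u \<in> frac_set A s" "v \<in> frac_set A s"
  then obtain a b i j where *: "a \<in> A" "b \<in> A" "u = a / s ^ i" "v = b / s ^ j"
    by (auto simp: frac_set_def)
  show "u - v \<in> frac_set A s"
    by (rule frac_setI[of "a * s ^ j - b * s ^ i" _ _ _ "i + j"])
      (use * s A in \<open>auto simp: is_subringD power_add divide_simps algebra_simps\<close>)
  show "u * v \<in> frac_set A s"
    by (rule frac_setI[of "a * b" _ _ _ "i + j"])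
      (use * s A in \<open>auto simp: is_subringD power_add\<close>)
qed

lemma frac_set_mult:
  assumes A: "is_subring A" and s: "s \<in> A" "t \<in> A" "t \<noteq> 0"
  shows "frac_set A s \<subseteq> frac_set A (s * t)"
proof
  fix u assume "u \<in> frac_set A s"
  then obtain a i where "a \<in> A" "u = a / s ^ i" by (auto simp: frac_set_def)
  then show "u \<in> frac_set A (s * t)"
    by (intro frac_setI[of "a * t ^ i" _ _ _ i]) (use s A in \<open>auto simp: is_subringD power_mult_distrib\<close>)
qed

lemma frac_set_inverse: "is_subring A \<Longrightarrow> 1 / s \<in> frac_set A s"
  by (rule frac_setI[of 1 _ _ _ 1]) (auto simp: is_subringD)

text \<open>The sheaf condition for the cover D(x), D(y), restricted to D(s): multiplication by
  s^(i+j) clears the powers of s, the given inclusion applies, and s is inverted again.\<close>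

lemma frac_set_Int:
  assumes A: "is_subring A" and s: "s \<in> A" "s \<noteq> 0" and xy: "x \<in> A" "x \<noteq> 0" "y \<in> A" "y \<noteq> 0"
    and int: "frac_set A x \<inter> frac_set A y \<subseteq> A"
  shows "frac_set A (x * s) \<inter> frac_set A (y * s) \<subseteq> frac_set A s"
proof
  fix w assume w: "w \<in> frac_set A (x * s) \<inter> frac_set A (y * s)"
  obtain a i where a: "a \<in> A" "w = a / (x * s) ^ i" using w by (auto simp: frac_set_def)
  obtain b j where b: "b \<in> A" "w = b / (y * s) ^ j" using w by (auto simp: frac_set_def)
  have "w * s ^ (i + j) = a * s ^ j / x ^ i"
    using a s xy by (simp add: power_mult_distrib power_add field_simps)
  moreover have "w * s ^ (i + j) = b * s ^ i / y ^ j"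
    using b s xy by (simp add: power_mult_distrib power_add field_simps)
  ultimately have "w * s ^ (i + j) \<in> frac_set A x \<inter> frac_set A y"
    using A a(1) b(1) s(1) by (metis IntI frac_setI is_subringD(5,7))
  with int have "w * s ^ (i + j) \<in> A" by auto
  then show "w \<in> frac_set A s" by (rule frac_setI[of _ _ _ _ "i + j"]) (use s in simp)
qed

section \<open>Coboundaries and congruence modulo coboundaries\<close>

context witt
begin

lemmas W_simps = W.add.assoc W.add.commute W.add.left_commute W.diff_diff_add W.diff_diff_eq2
  W.add_diff_eq W.diff_add_eq W.diff_eq_eq W.eq_diff_eq

lemma weq_iff_diff: "weq n a b \<longleftrightarrow> weq n (wsub p a b) (wzero :: nat \<Rightarrow> 'r)"
proof
  assume "weq n a b"
  from weq_wsub[OF this weq_refl, of p b] show "weq n (wsub p a b) wzero" by simp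
next
  assume "weq n (wsub p a b) wzero"
  from weq_wadd[OF this weq_refl, of p b] show "weq n a b" by simp
qed

lemma Bd_left: "is_subring C \<Longrightarrow> w \<in> WS B \<Longrightarrow> w \<in> Bd p n B (C :: 'r set)"
  unfolding Bd_def by (intro CollectI bexI[of _ w] bexI[of _ wzero]) (auto simp: WS_closed)

lemma Bd_right: "is_subring B \<Longrightarrow> w \<in> WS C \<Longrightarrow> w \<in> Bd p n (B :: 'r set) C"
  unfolding Bd_def by (intro CollectI bexI[of _ w] bexI[of _ wzero]) (auto simp: WS_closed)

context
  fixes B C :: "'r set"
  assumes B: "is_subring B" and C: "is_subring C"
begin

lemma Bd_zero [simp]: "wzero \<in> Bd p n B C"
  by (rule Bd_left) (auto simp: C B WS_closed)

lemma Bd_add: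
  assumes "w \<in> Bd p n B C" "w' \<in> Bd p n B C"
  shows "wadd p w w' \<in> Bd p n B C"
proof -
  obtain u v where uv: "u \<in> WS B" "v \<in> WS C" "weq n w (wadd p u v)" using assms(1) unfolding Bd_def by auto
  obtain u' v' where uv': "u' \<in> WS B" "v' \<in> WS C" "weq n w' (wadd p u' v')" using assms(2) unfolding Bd_def by auto
  have "weq n (wadd p w w') (wadd p (wadd p u u') (wadd p v v'))"
    using weq_wadd[OF uv(3) uv'(3), of p] by (simp add: W_simps)
  then show ?thesis unfolding Bd_def using uv uv' B C by (blast intro: WS_closed)
qed

lemma Bd_neg:
  assumes "w \<in> Bd p n B C"
  shows "wneg p w \<in> Bd p n B C"
proof -
  obtain u v where uv: "u \<in> WS B" "v \<in> WS C" "weq n w (wadd p u v)" using assms(1) unfolding Bd_def by auto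
  have "weq n (wneg p w) (wadd p (wneg p u) (wneg p v))"
    using weq_wneg[OF uv(3), of p] by (simp only: W.minus_add_distrib)
  then show ?thesis unfolding Bd_def using uv B C by (blast intro: WS_closed)
qed

lemma Bd_sub: "w \<in> Bd p n B C \<Longrightarrow> w' \<in> Bd p n B C \<Longrightarrow> wsub p w w' \<in> Bd p n B C"
  unfolding wsub_def by (intro Bd_add Bd_neg)

lemma Bd_mul:
  assumes "a \<in> WS B" "a \<in> WS C" "w \<in> Bd p n B C"
  shows "wmul p a w \<in> Bd p n B C"
proof -
  obtain u v where uv: "u \<in> WS B" "v \<in> WS C" "weq n w (wadd p u v)" using assms(3) unfolding Bd_def by auto
  have "weq n (wmul p a w) (wadd p (wmul p a u) (wmul p a v))"
    using weq_wmul[OF weq_refl uv(3), of p a] by (simp only: W.distrib_left)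
  then show ?thesis unfolding Bd_def using uv B C assms by (blast intro: WS_closed)
qed

lemma Bd_wV:
  assumes "w \<in> Bd p n B C"
  shows "wV w \<in> Bd p (Suc n) B C"
proof -
  obtain u v where uv: "u \<in> WS B" "v \<in> WS C" "weq n w (wadd p u v)" using assms unfolding Bd_def by auto
  have "weq (Suc n) (wV w) (wadd p (wV u) (wV v))"
    using weq_wV[OF uv(3)] by (simp add: wV_add)
  then show ?thesis unfolding Bd_def using uv B C by (blast intro: WS_closed)
qed

definition cg :: "nat \<Rightarrow> (nat \<Rightarrow> 'r) \<Rightarrow> (nat \<Rightarrow> 'r) \<Rightarrow> bool" where
  "cg n a b \<longleftrightarrow> wsub p a b \<in> Bd p n B C"

lemma cg_weq: "weq n a b \<Longrightarrow> cg n a b"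
  unfolding cg_def by (rule Bd_weq[of _ _ wzero]) (auto simp flip: weq_iff_diff)

lemma cg_trans: "cg n a b \<Longrightarrow> cg n b c \<Longrightarrow> cg n a c"
  unfolding cg_def by (drule (1) Bd_add) (simp add: W_simps)

lemma cg_wV: "cg n a b \<Longrightarrow> cg (Suc n) (wV a) (wV b)"
  unfolding cg_def by (drule Bd_wV) (simp add: wV_sub)

lemma cg_neg: "cg n a b \<Longrightarrow> cg n (wneg p a) (wneg p b)"
  unfolding cg_def by (drule Bd_neg) (simp add: W_simps)

lemma cg_add: "cg n a b \<Longrightarrow> cg n a' b' \<Longrightarrow> cg n (wadd p a a') (wadd p b b')"
  unfolding cg_def by (drule (1) Bd_add) (simp add: W_simps)

lemma cg_zero: "cg n a wzero \<longleftrightarrow> a \<in> Bd p n B C"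
  unfolding cg_def by simp

lemma cg_Bd: "cg n a b \<Longrightarrow> b \<in> Bd p n B C \<Longrightarrow> a \<in> Bd p n B C"
  unfolding cg_def by (drule (1) Bd_add) simp

end

section \<open>Carries in sums of Teichmueller representatives\<close>

definition carry :: "'r \<Rightarrow> 'r \<Rightarrow> nat \<Rightarrow> 'r" where
  "carry P Q i = wadd p (teich P) (teich Q) (Suc i)"

lemma teich_add: "wadd p (teich P) (teich Q) = wadd p (teich (P + Q)) (wV (carry P Q))"
  using witt_decompose[of "wadd p (teich P) (teich Q)"] by (simp add: carry_def[abs_def])

lemma ghost_1: "ghost q 1 T = T 0 ^ q + of_nat q * T 1"
  by (simp add: ghost_def)

lemma ghost_2: "ghost q 2 T = T 0 ^ (q ^ 2) + of_nat q * T 1 ^ q + of_nat (q ^ 2) * T 2"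
  by (simp add: ghost_def numeral_2_eq_2)

text \<open>Carry formulas are found by dividing a ghost identity by a power of p. That is
  legitimate over the torsion-free polynomial ring; the formula \<open>F\<close> obtained there
  specializes to \<open>F'\<close> over a ring in which p may vanish.\<close>

lemma carry_universal:
  assumes "\<And>\<alpha> \<beta> :: witt_poly. wadd p (teich \<alpha>) (teich \<beta>) (Suc i) = F \<alpha> \<beta>"
    and "\<And>(v :: nat + nat \<Rightarrow> 'r) \<alpha> \<beta>. poly_eval v (F \<alpha> \<beta>) = F' (poly_eval v \<alpha>) (poly_eval v \<beta>)"
  shows "carry P Q i = F' P Q"
proof -
  have t: "(\<lambda>j. poly_eval v (teich a j)) = teich (poly_eval v a)" for v :: "nat + nat \<Rightarrow> 'r" and a
    by (rule ext) (simp add: teich_def)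
  have "(\<lambda>j::nat. carry P Q i) = (\<lambda>j. F' P Q)"
    by (rule witt_identity[of "\<lambda>a b c j. wadd p (teich (a 0)) (teich (b 0)) (Suc i)" "\<lambda>a b c j. F (a 0) (b 0)"
          "\<lambda>a b c j. carry (a 0) (b 0) i" "\<lambda>a b c j. F' (a 0) (b 0)" "\<lambda>_. P" "\<lambda>_. Q" "\<lambda>_. Q"])
      (simp add: assms(1), simp add: carry_def t, simp add: assms(2))
  from fun_cong[OF this] show ?thesis .
qed

lemma carry_0_2:
  assumes "p = 2"
  shows "carry P Q 0 = - P * Q"
proof (rule carry_universal)
  fix \<alpha> \<beta> :: witt_poly
  interpret Pi: witt p "TYPE(witt_poly)" by unfold_locales (rule prime_p)
  let ?T = "wadd p (teich \<alpha>) (teich \<beta>)"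
  have "ghost p 1 ?T = \<alpha> ^ p + \<beta> ^ p" by (simp add: prime_p)
  then have "(\<alpha> + \<beta>) ^ 2 + 2 * ?T 1 = \<alpha> ^ 2 + \<beta> ^ 2"
    unfolding ghost_1 Pi.wadd_0 teich_simps by (simp add: assms)
  then have "of_nat 2 * (?T 1 - (- \<alpha> * \<beta>)) = 0" by (simp add: power2_eq_square algebra_simps)
  from of_nat_mult_eq_0_poly[OF this] show "?T (Suc 0) = - \<alpha> * \<beta>"
    by (simp add: eq_neg_iff_add_eq_0)
qed simp

text \<open>Read off from the ghost component of index 2. The value equals - P Q (P + Q)^2, the form
  in which \<open>cg_3\<close> uses it.\<close>

lemma carry_1_2:
  assumes "p = 2"
  shows "carry P Q 1 = - (P ^ 3 * Q + 2 * P ^ 2 * Q ^ 2 + P * Q ^ 3)"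
proof (rule carry_universal)
  fix \<alpha> \<beta> :: witt_poly
  interpret Pi: witt p "TYPE(witt_poly)" by unfold_locales (rule prime_p)
  let ?T = "wadd p (teich \<alpha>) (teich \<beta>)"
  have "?T 1 = - \<alpha> * \<beta>" using Pi.carry_0_2[OF assms] by (simp add: Pi.carry_def)
  moreover have "?T 0 = \<alpha> + \<beta>" by (simp only: Pi.wadd_0 teich_simps)
  moreover have "ghost p 2 ?T = \<alpha> ^ p ^ 2 + \<beta> ^ p ^ 2" by (simp add: prime_p)
  ultimately have "(\<alpha> + \<beta>) ^ 4 + 2 * (- \<alpha> * \<beta>) ^ 2 + 4 * ?T 2 = \<alpha> ^ 4 + \<beta> ^ 4"
    by (simp add: ghost_2 assms)
  then have "of_nat 4 * (?T 2 - (- (\<alpha> ^ 3 * \<beta> + 2 * \<alpha> ^ 2 * \<beta> ^ 2 + \<alpha> * \<beta> ^ 3))) = 0"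
    by (simp add: power2_eq_square power3_eq_cube power4_eq_xxxx algebra_simps)
  from of_nat_mult_eq_0_poly[OF this]
  show "?T (Suc 1) = - (\<alpha> ^ 3 * \<beta> + 2 * \<alpha> ^ 2 * \<beta> ^ 2 + \<alpha> * \<beta> ^ 3)"
    by (simp add: numeral_2_eq_2)
qed simp

lemma carry_0_3:
  assumes "p = 3"
  shows "carry P Q 0 = - P * Q * (P + Q)"
proof (rule carry_universal)
  fix \<alpha> \<beta> :: witt_poly
  interpret Pi: witt p "TYPE(witt_poly)" by unfold_locales (rule prime_p)
  let ?T = "wadd p (teich \<alpha>) (teich \<beta>)"
  have "ghost p 1 ?T = \<alpha> ^ p + \<beta> ^ p" by (simp add: prime_p)
  then have "(\<alpha> + \<beta>) ^ 3 + 3 * ?T 1 = \<alpha> ^ 3 + \<beta> ^ 3"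
    unfolding ghost_1 Pi.wadd_0 teich_simps by (simp add: assms)
  then have "of_nat 3 * (?T 1 - (- \<alpha> * \<beta> * (\<alpha> + \<beta>))) = 0" by (simp add: power3_eq_cube algebra_simps)
  from of_nat_mult_eq_0_poly[OF this] show "?T (Suc 0) = - \<alpha> * \<beta> * (\<alpha> + \<beta>)"
    by (simp add: eq_neg_iff_add_eq_0)
qed simp

end

section \<open>Change of the regular sequence\<close>

locale wittchar = witt p ty for p :: nat and ty :: "'r::field itself" +
  assumes char_p: "of_nat p = (0 :: 'r)"
begin

lemma frobenius_add: "(a + b) ^ p = a ^ p + (b :: 'r) ^ p"
  using prime_dvd_binomial_power[OF prime_p, of a b] by (simp add: char_p)

lemma wF_hom:
  fixes a b :: "nat \<Rightarrow> 'r"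
  shows "wF p (wadd p a b) = wadd p (wF p a) (wF p b)"
    "wF p (wmul p a b) = wmul p (wF p a) (wF p b)"
    "wF p (wneg p a) = wneg p (wF p a)"
    "wF p (wsub p a b) = wsub p (wF p a) (wF p b)"
proof -
  note h = witt_hom[of "\<lambda>x :: 'r. x ^ p", OF frobenius_add power_mult_distrib power_one]
  show "wF p (wadd p a b) = wadd p (wF p a) (wF p b)"
    "wF p (wmul p a b) = wmul p (wF p a) (wF p b)"
    "wF p (wneg p a) = wneg p (wF p a)"
    "wF p (wsub p a b) = wsub p (wF p a) (wF p b)"
    by (rule ext, simp only: wF_def[abs_def] h)+
qed

lemma wF_wV [simp]: "wF p (wV a) = wV (wF p (a :: nat \<Rightarrow> 'r))"
  by (rule ext) (simp add: wF_def wV_def split: nat.split)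

lemma wF_teich [simp]: "wF p (teich t) = teich ((t :: 'r) ^ p)"
  by (rule ext) (simp add: wF_def teich_def)

lemma Bd_wF:
  fixes B C :: "'r set"
  assumes B: "is_subring B" and C: "is_subring C" and "w \<in> Bd p n B C"
  shows "wF p w \<in> Bd p n B C"
proof -
  obtain u v where uv: "u \<in> WS B" "v \<in> WS C" "weq n w (wadd p u v)" using assms unfolding Bd_def by auto
  have "weq n (wF p w) (wadd p (wF p u) (wF p v))"
    using weq_wF[OF uv(3), of p] by (simp add: wF_hom)
  then show ?thesis unfolding Bd_def using uv B C by (blast intro: WS_closed)
qed

text \<open>The double complex of the covers $D(x), D(y)$ and $D(x_1), D(x_2)$: \<open>w\<close> and \<open>v\<close> are
  coboundaries, in the two directions, of the same family $a_{ij} \in W(A[(x_i x_j')^{-1}])$.\<close>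

definition transfer :: "nat \<Rightarrow> 'r set \<Rightarrow> 'r \<Rightarrow> 'r \<Rightarrow> 'r \<Rightarrow> 'r \<Rightarrow> (nat \<Rightarrow> 'r) \<Rightarrow> (nat \<Rightarrow> 'r) \<Rightarrow> bool" where
  "transfer n A x y x1 x2 w v \<longleftrightarrow>
    (\<exists>a11\<in>WS (frac_set A (x * x1)). \<exists>a12\<in>WS (frac_set A (x * x2)).
     \<exists>a21\<in>WS (frac_set A (y * x1)). \<exists>a22\<in>WS (frac_set A (y * x2)).
       weq n w (wsub p a11 a21) \<and> weq n w (wsub p a12 a22) \<and>
       weq n v (wsub p a11 a12) \<and> weq n v (wsub p a21 a22))"

lemma transferE:
  assumes "transfer n A x y x1 x2 w v"
  obtains a11 a12 a21 a22 where
    "a11 \<in> WS (frac_set A (x * x1))" "a12 \<in> WS (frac_set A (x * x2))"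
    "a21 \<in> WS (frac_set A (y * x1))" "a22 \<in> WS (frac_set A (y * x2))"
    "weq n w (wsub p a11 a21)" "weq n w (wsub p a12 a22)"
    "weq n v (wsub p a11 a12)" "weq n v (wsub p a21 a22)"
  using assms unfolding transfer_def by blast

lemma transferI:
  assumes "a11 \<in> WS (frac_set A (x * x1))" "a12 \<in> WS (frac_set A (x * x2))"
    "a21 \<in> WS (frac_set A (y * x1))" "a22 \<in> WS (frac_set A (y * x2))"
    "weq n w (wsub p a11 a21)" "weq n w (wsub p a12 a22)"
    "weq n v (wsub p a11 a12)" "weq n v (wsub p a21 a22)"
  shows "transfer n A x y x1 x2 w v"
  unfolding transfer_def using assms by blast

lemma transfer_sym: "transfer n A x y x1 x2 w v \<Longrightarrow> transfer n A x1 x2 x y v w"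
  by (erule transferE, rule transferI) (assumption | simp add: mult.commute)+

lemma transfer_mono: "transfer n A x y x1 x2 w v \<Longrightarrow> m \<le> n \<Longrightarrow> transfer m A x y x1 x2 w v"
  by (erule transferE, rule transferI) (assumption | erule (1) weq_mono)+

end

text \<open>The inclusions \<open>int_xy\<close> and \<open>int_x12\<close> are what regularity of
  the two sequences provides: a fraction defined on both sets of a cover belongs to A.\<close>

locale two_covers = wittchar p ty for p :: nat and ty :: "'r::field itself" +
  fixes A :: "'r set" and x y x1 x2 :: 'r
  assumes A: "is_subring A" and xA: "x \<in> A" "x \<noteq> 0" and yA: "y \<in> A" "y \<noteq> 0"
    and x1A: "x1 \<in> A" "x1 \<noteq> 0" and x2A: "x2 \<in> A" "x2 \<noteq> 0"
    and int_xy: "frac_set A x \<inter> frac_set A y \<subseteq> A"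
    and int_x12: "frac_set A x1 \<inter> frac_set A x2 \<subseteq> A"
begin

lemma subrings: "is_subring (frac_set A (x * x1))" "is_subring (frac_set A (x * x2))"
  "is_subring (frac_set A (y * x1))" "is_subring (frac_set A (y * x2))"
  "is_subring (frac_set A x)" "is_subring (frac_set A y)" "is_subring (frac_set A x1)" "is_subring (frac_set A x2)"
  "is_subring (frac_set A (x * y))" "is_subring (frac_set A (x1 * x2))"
  using A xA yA x1A x2A by (auto intro!: frac_set_is_subring simp: is_subringD)

lemma swap: "two_covers p A x1 x2 x y"
  by unfold_locales (use A xA yA x1A x2A int_xy int_x12 in auto)

lemma transfer_wsub:
  assumes "transfer n A x y x1 x2 w v" "transfer n A x y x1 x2 w' v'"
  shows "transfer n A x y x1 x2 (wsub p w w') (wsub p v v')"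
proof -
  have eq: "wsub p (wsub p a b) (wsub p c d) = wsub p (wsub p a c) (wsub p b d)" for a b c d :: "nat \<Rightarrow> 'r"
    by (simp add: W_simps)
  from assms(1) obtain a11 a12 a21 a22 where a:
    "a11 \<in> WS (frac_set A (x * x1))" "a12 \<in> WS (frac_set A (x * x2))"
    "a21 \<in> WS (frac_set A (y * x1))" "a22 \<in> WS (frac_set A (y * x2))"
    "weq n w (wsub p a11 a21)" "weq n w (wsub p a12 a22)"
    "weq n v (wsub p a11 a12)" "weq n v (wsub p a21 a22)" by (rule transferE)
  from assms(2) obtain b11 b12 b21 b22 where b:
    "b11 \<in> WS (frac_set A (x * x1))" "b12 \<in> WS (frac_set A (x * x2))"
    "b21 \<in> WS (frac_set A (y * x1))" "b22 \<in> WS (frac_set A (y * x2))"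
    "weq n w' (wsub p b11 b21)" "weq n w' (wsub p b12 b22)"
    "weq n v' (wsub p b11 b12)" "weq n v' (wsub p b21 b22)" by (rule transferE)
  show ?thesis
    by (rule transferI[of "wsub p a11 b11" _ _ _ "wsub p a12 b12" _ "wsub p a21 b21" _ "wsub p a22 b22"])
      (use a b subrings in \<open>auto simp: eq[of a11 b11] eq[of a12 b12] eq[of a21 b21] eq[of a22 b22] intro!: WS_closed weq_wsub\<close>)
qed

text \<open>Covers multiplication by scalars, F and V at once; \<open>m\<close> may differ from
  \<open>n\<close> because V lengthens vectors.\<close>

lemma transfer_map:
  assumes "transfer n A x y x1 x2 w v"
    and "\<And>s a. s \<in> A \<Longrightarrow> s \<noteq> 0 \<Longrightarrow> a \<in> WS (frac_set A s) \<Longrightarrow> h a \<in> WS (frac_set A s)"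
    and "\<And>a b. weq n a b \<Longrightarrow> weq m (h a) (h b)" "\<And>a b. h (wsub p a b) = wsub p (h a) (h b)"
  shows "transfer m A x y x1 x2 (h w) (h v)"
proof -
  from assms(1) obtain a11 a12 a21 a22 where a:
    "a11 \<in> WS (frac_set A (x * x1))" "a12 \<in> WS (frac_set A (x * x2))"
    "a21 \<in> WS (frac_set A (y * x1))" "a22 \<in> WS (frac_set A (y * x2))"
    "weq n w (wsub p a11 a21)" "weq n w (wsub p a12 a22)"
    "weq n v (wsub p a11 a12)" "weq n v (wsub p a21 a22)" by (rule transferE)
  show ?thesis
    by (rule transferI[of "h a11" _ _ _ "h a12" _ "h a21" _ "h a22"])
      (use a A xA yA x1A x2A in \<open>auto simp: is_subringD simp flip: assms(4) intro!: assms(2,3)\<close>)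
qed

lemma transfer_wmul:
  assumes "transfer n A x y x1 x2 w v" "c \<in> WS A"
  shows "transfer n A x y x1 x2 (wmul p c w) (wmul p c v)"
proof (rule transfer_map[OF assms(1)])
  show "wmul p c a \<in> WS (frac_set A s)" if "s \<in> A" "s \<noteq> 0" "a \<in> WS (frac_set A s)" for s a
    using that WS_mono[OF frac_set_subset assms(2)] by (intro WS_closed frac_set_is_subring A)
qed (simp_all add: weq_wmul W.right_diff_distrib)

lemma transfer_wF:
  "transfer n A x y x1 x2 w v \<Longrightarrow> transfer n A x y x1 x2 (wF p w) (wF p v)"
  by (erule transfer_map) (auto simp: wF_hom intro: weq_wF WS_closed frac_set_is_subring A)

lemma transfer_wV:
  "transfer n A x y x1 x2 w v \<Longrightarrow> transfer (Suc n) A x y x1 x2 (wV w) (wV v)"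
  by (erule transfer_map) (auto simp: wV_sub intro: weq_wV WS_closed frac_set_is_subring A)

lemma transfer_wV_funpow:
  "transfer n A x y x1 x2 w v \<Longrightarrow> transfer (k + n) A x y x1 x2 ((wV ^^ k) w) ((wV ^^ k) v)"
  by (induction k) (auto dest: transfer_wV)

text \<open>Two vectors agree in length n only, and their later components may have different
  denominators; these are replaced by 0.\<close>

definition trunc :: "nat \<Rightarrow> (nat \<Rightarrow> 'r) \<Rightarrow> nat \<Rightarrow> 'r" where
  "trunc n w i = (if i < n then w i else 0)"

lemma weq_trunc: "weq n w (trunc n w)" "weq n (trunc n w) w"
  by (auto simp: weq_def trunc_def)

lemma trunc_Int:
  assumes "B \<inter> C \<subseteq> D" "w \<in> WS B" "w' \<in> WS C" "weq n w w'" "is_subring D"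
  shows "trunc n w \<in> WS D"
  unfolding WS_def trunc_def using assms is_subringD(2)[OF assms(5)]
  by (auto simp: WS_def weq_def) (metis IntI subsetD)

text \<open>Dividing the relations for [x1] and [x2] by these elements gives the a_ij. The
  differences a_11 - a_12 and a_21 - a_22 agree in length n, so their components lie in
  A[1/(x x1 x2)] and in A[1/(y x1 x2)], hence in A[1/(x1 x2)].\<close>

lemma transfer_exists:
  assumes w: "w \<in> WS (frac_set A (x * y))"
    and x1w: "wmul p (teich x1) w \<in> Bd p n (frac_set A x) (frac_set A y)"
    and x2w: "wmul p (teich x2) w \<in> Bd p n (frac_set A x) (frac_set A y)"
  obtains v where "v \<in> WS (frac_set A (x1 * x2))" "transfer n A x y x1 x2 w v"
proof -
  have aux: "\<exists>a\<in>WS (frac_set A (x * s)). \<exists>b\<in>WS (frac_set A (y * s)). weq n w (wsub p a b)"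
    if s: "s \<in> A" "s \<noteq> 0" and sw: "wmul p (teich s) w \<in> Bd p n (frac_set A x) (frac_set A y)" for s
  proof -
    obtain u v where uv: "u \<in> WS (frac_set A x)" "v \<in> WS (frac_set A y)" "weq n (wmul p (teich s) w) (wadd p u v)"
      using sw by (auto simp: Bd_def)
    let ?i = "teich (1 / s)"
    have "wmul p ?i (wmul p (teich s) w) = w"
      using s by (simp flip: W.mult.assoc teich_mult)
    moreover have "wadd p (wmul p ?i u) (wmul p ?i v) = wsub p (wmul p ?i u) (wneg p (wmul p ?i v))" by simp
    ultimately have "weq n w (wsub p (wmul p ?i u) (wneg p (wmul p ?i v)))"
      using weq_wmul[OF weq_refl uv(3), of p ?i] by (simp only: W.distrib_left)
    moreover have sub: "is_subring (frac_set A (x * s))" "is_subring (frac_set A (y * s))"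
      using A s xA yA by (auto intro!: frac_set_is_subring simp: is_subringD)
    have inv: "1 / s \<in> frac_set A (x * s)" "1 / s \<in> frac_set A (y * s)"
      using frac_set_inverse[OF A, of s] frac_set_mult[OF A s(1)] xA yA by (metis mult.commute subsetD)+
    have "u \<in> WS (frac_set A (x * s))" "v \<in> WS (frac_set A (y * s))"
      using WS_mono[OF frac_set_mult[OF A xA(1) s]] WS_mono[OF frac_set_mult[OF A yA(1) s]] uv by blast+
    with sub inv have "wmul p ?i u \<in> WS (frac_set A (x * s))" "wneg p (wmul p ?i v) \<in> WS (frac_set A (y * s))"
      by (auto intro!: WS_closed)
    ultimately show ?thesis by blast
  qed
  obtain a11 a21 where a1: "a11 \<in> WS (frac_set A (x * x1))" "a21 \<in> WS (frac_set A (y * x1))" "weq n w (wsub p a11 a21)"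
    using aux[OF x1A x1w] by blast
  obtain a12 a22 where a2: "a12 \<in> WS (frac_set A (x * x2))" "a22 \<in> WS (frac_set A (y * x2))" "weq n w (wsub p a12 a22)"
    using aux[OF x2A x2w] by blast
  let ?v = "wsub p a11 a12" let ?v' = "wsub p a21 a22"
  have eq: "weq n ?v ?v'"
  proof -
    have "weq n (wsub p (wsub p a11 a21) (wsub p a12 a22)) wzero"
      using weq_trans[OF weq_sym[OF a1(3)] a2(3)] by (simp flip: weq_iff_diff)
    moreover have "wsub p (wsub p a11 a21) (wsub p a12 a22) = wsub p ?v ?v'" by (simp add: W_simps)
    ultimately show ?thesis by (subst weq_iff_diff) simp
  qed
  have x12: "x1 * x2 \<in> A" "x1 * x2 \<noteq> 0" using x1A x2A A by (auto simp: is_subringD)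
  have sub: "is_subring (frac_set A (x * (x1 * x2)))" "is_subring (frac_set A (y * (x1 * x2)))"
    using A x12 xA yA by (auto intro!: frac_set_is_subring simp: is_subringD)
  have m: "frac_set A (s * x1) \<subseteq> frac_set A (s * (x1 * x2))" "frac_set A (s * x2) \<subseteq> frac_set A (s * (x1 * x2))"
    if "s \<in> A" for s
    using frac_set_mult[OF A, of "s * x1" x2] frac_set_mult[OF A, of "s * x2" x1] that x1A x2A A
    by (auto simp: is_subringD mult_ac)
  have v: "?v \<in> WS (frac_set A (x * (x1 * x2)))" "?v' \<in> WS (frac_set A (y * (x1 * x2)))"
    using WS_mono[OF m(1)] WS_mono[OF m(2)] a1 a2 xA yA sub by (auto intro!: WS_closed)
  let ?t = "trunc n ?v"
  have "?t \<in> WS (frac_set A (x1 * x2))"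
    by (rule trunc_Int[OF frac_set_Int[OF A x12 xA yA int_xy] v eq subrings(10)])
  moreover have "transfer n A x y x1 x2 w ?t"
    by (rule transferI[OF a1(1) a2(1) a1(2) a2(2) a1(3) a2(3)]) (use weq_trunc eq weq_trans in blast)+
  ultimately show thesis by (rule that)
qed

text \<open>If w = u + u', then a_1j - u = a_2j + u' is defined over A[1/(x x_j)] and over
  A[1/(y x_j)], hence over A[1/x_j]. Subtracting the cases j = 1 and j = 2 displays v as a
  coboundary.\<close>

lemma transfer_Bd:
  assumes T: "transfer n A x y x1 x2 w v" and w: "w \<in> Bd p n (frac_set A x) (frac_set A y)"
  shows "v \<in> Bd p n (frac_set A x1) (frac_set A x2)"
proof -
  from T obtain a11 a12 a21 a22 where a:
    "a11 \<in> WS (frac_set A (x * x1))" "a12 \<in> WS (frac_set A (x * x2))"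
    "a21 \<in> WS (frac_set A (y * x1))" "a22 \<in> WS (frac_set A (y * x2))"
    "weq n w (wsub p a11 a21)" "weq n w (wsub p a12 a22)"
    "weq n v (wsub p a11 a12)" "weq n v (wsub p a21 a22)" by (rule transferE)
  obtain u u' where u: "u \<in> WS (frac_set A x)" "u' \<in> WS (frac_set A y)" "weq n w (wadd p u u')"
    using w by (auto simp: Bd_def)
  have aux: "trunc n (wsub p a u) \<in> WS (frac_set A s)"
    if a: "a \<in> WS (frac_set A (x * s))" "b \<in> WS (frac_set A (y * s))" "weq n w (wsub p a b)"
      and s: "s \<in> A" "s \<noteq> 0" for a b s
  proof (rule trunc_Int[OF frac_set_Int[OF A s xA yA int_xy]])
    have sub: "is_subring (frac_set A (x * s))" "is_subring (frac_set A (y * s))"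
      using A s xA yA by (auto intro!: frac_set_is_subring simp: is_subringD)
    have "u \<in> WS (frac_set A (x * s))" "u' \<in> WS (frac_set A (y * s))"
      using WS_mono[OF frac_set_mult[OF A xA(1) s]] WS_mono[OF frac_set_mult[OF A yA(1) s]] u by blast+
    then show "wsub p a u \<in> WS (frac_set A (x * s))" "wadd p b u' \<in> WS (frac_set A (y * s))"
      using sub a by (auto intro!: WS_closed)
    have "weq n (wsub p (wsub p a b) (wadd p u u')) wzero"
      using weq_trans[OF weq_sym[OF a(3)] u(3)] by (simp flip: weq_iff_diff)
    moreover have "wsub p (wsub p a b) (wadd p u u') = wsub p (wsub p a u) (wadd p b u')" by (simp add: W_simps)
    ultimately show "weq n (wsub p a u) (wadd p b u')" by (subst weq_iff_diff) simp
    show "is_subring (frac_set A s)" using A s by (rule frac_set_is_subring)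
  qed
  let ?c1 = "trunc n (wsub p a11 u)" let ?c2 = "trunc n (wsub p a12 u)"
  have c: "?c1 \<in> WS (frac_set A x1)" "?c2 \<in> WS (frac_set A x2)"
    using aux a x1A x2A by blast+
  have "weq n v (wadd p ?c1 (wneg p ?c2))"
  proof -
    have "wsub p a11 a12 = wsub p (wsub p a11 u) (wsub p a12 u)" by (simp add: W_simps)
    then have "weq n v (wsub p (wsub p a11 u) (wsub p a12 u))" using a(7) by simp
    also have "weq n \<dots> (wsub p ?c1 ?c2)" by (intro weq_wsub weq_trunc)
    finally show ?thesis by (simp add: W.add_uminus_conv_diff)
  qed
  then show ?thesis unfolding Bd_def using c subrings by (blast intro: WS_closed)
qed

end

section \<open>Classes of Teichmueller representatives\<close>

context wittchar begin

text \<open>Since $V(a)[t] = V(a[t^p])$, the ideal $V(W(A))$ kills the class of $[t]$ as soon as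
  the class of $F[t]$ vanishes in length $n$.\<close>

lemma annihilator_teich:
  fixes B C :: "'r set"
  assumes A: "is_subring A" "A \<subseteq> B" "A \<subseteq> C" and B: "is_subring B" and C: "is_subring C"
    and xyz: "x \<in> A" "y \<in> A" "z \<in> A"
    and t: "wmul p (teich x) (teich t) \<in> Bd p (Suc n) B C" "wmul p (teich y) (teich t) \<in> Bd p (Suc n) B C"
      "wmul p (teich z) (teich t) \<in> Bd p (Suc n) B C"
    and F: "teich (t ^ p) \<in> Bd p n B C"
    and a: "a \<in> WS A" "a 0 = x * \<alpha> + y * \<beta> + z * \<gamma>" "\<alpha> \<in> A" "\<beta> \<in> A" "\<gamma> \<in> A"
  shows "wmul p a (teich t) \<in> Bd p (Suc n) B C"
proof -
  let ?X = "\<lambda>u v. wmul p (teich u) (teich (v :: 'r))"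
  \<comment> \<open>A Witt vector with the same component 0 as \<open>a\<close>, built from
    multiples of [x], [y], [z]; so \<open>a\<close> minus it lies in the image of V.\<close>
  let ?s = "wadd p (wadd p (?X \<alpha> x) (?X \<beta> y)) (?X \<gamma> z)"
  have s: "?s \<in> WS A" using A(1) a xyz by (auto intro!: WS_closed)
  let ?d = "wsub p a ?s" let ?d' = "\<lambda>i. ?d (Suc i)"
  have d: "?d \<in> WS A" using A(1) a s by (auto intro!: WS_closed)
  then have d': "?d' \<in> WS A" by (auto simp: WS_def)
  have "?d 0 = 0" using a by (simp add: wmul_teich mult_ac)
  moreover have "teich 0 = (wzero :: nat \<Rightarrow> 'r)" by (rule ext) (simp add: teich_def)
  ultimately have dV: "?d = wV ?d'" using witt_decompose[of ?d] by simp
  have "wmul p (wV b) (teich t) = wV (wmul p b (teich (t ^ p)))" for b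
  proof
    fix i
    have "wmul p (wV b) (teich t) = wmul p (teich t) (wV b)" for b by (rule W.mult.commute)
    moreover have "wmul p b (teich (t ^ p)) = wmul p (teich (t ^ p)) b" by (rule W.mult.commute)
    ultimately show "wmul p (wV b) (teich t) i = wV (wmul p b (teich (t ^ p))) i"
      by (cases i) (simp_all add: wmul_teich flip: power_mult)
  qed
  then have "wmul p ?d (teich t) = wV (wmul p ?d' (teich (t ^ p)))" by (subst dV) simp
  moreover have "wmul p ?d' (teich (t ^ p)) \<in> Bd p n B C"
    by (rule Bd_mul[OF B C _ _ F]) (rule WS_mono[OF _ d'], rule A)+
  ultimately have 1: "wmul p ?d (teich t) \<in> Bd p (Suc n) B C" using Bd_wV[OF B C] by simp
  have 2: "wmul p ?s (teich t) \<in> Bd p (Suc n) B C"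
    unfolding W.distrib_right W.mult.assoc
    by (intro Bd_add[OF B C] Bd_mul[OF B C] t) (use a A in \<open>auto intro!: WS_closed B C\<close>)
  have "a = wadd p ?d ?s" by simp
  with Bd_add[OF B C 1 2] show ?thesis by (metis W.distrib_right)
qed

lemma cg_teich_add:
  fixes B C :: "'r set"
  assumes B: "is_subring B" and C: "is_subring C" and P: "P \<in> B" and Q: "Q \<in> C"
  shows "cg B C n (teich (P + Q)) (wneg p (wV (carry P Q)))"
proof -
  have "wsub p (teich (P + Q)) (wneg p (wV (carry P Q))) = wadd p (teich P) (teich Q)"
    by (simp add: teich_add)
  moreover have "teich P \<in> WS B" "teich Q \<in> WS C" using B C P Q by (auto intro: WS_closed)
  ultimately show ?thesis
    unfolding cg_def[OF B C] Bd_def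
    by (intro CollectI bexI[of _ "teich P"] bexI[of _ "teich Q"]) (simp_all del: W.diff_minus_eq_add)
qed

lemma cg_1:
  fixes B C :: "'r set"
  assumes B: "is_subring B" and C: "is_subring C" and P: "P \<in> B" and Q: "Q \<in> C"
  shows "cg B C 1 (teich (P + Q + s)) (teich s)"
proof -
  have "weq 1 (wsub p (teich (P + Q + s)) (teich s)) (wadd p (teich P) (teich Q))"
    by (simp add: weq_def)
  moreover have "teich P \<in> WS B" "teich Q \<in> WS C" using B C P Q by (auto intro: WS_closed)
  ultimately show ?thesis
    unfolding cg_def[OF B C] Bd_def by blast
qed

text \<open>After one shift only component 0 of the carry is visible in length 2, and in length 1
  addition is the ordinary one; \<open>s\<close> is the part of the negated carry that is left over
  by the splitting.\<close>

lemma cg_2: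
  fixes B C :: "'r set"
  assumes B: "is_subring B" and C: "is_subring C" and P: "P \<in> B" "Q \<in> C"
    and c: "- carry P Q 0 = P1 + Q1 + s" and P1: "P1 \<in> B" "Q1 \<in> C"
  shows "cg B C 2 (teich (P + Q)) (wV (teich s))"
proof -
  have "weq 1 (wneg p (carry P Q)) (teich (P1 + Q1 + s))" by (simp add: weq_def c)
  then have "weq 2 (wneg p (wV (carry P Q))) (wV (teich (P1 + Q1 + s)))"
    using weq_wV by (fastforce simp: numeral_2_eq_2 simp flip: wV_neg)
  moreover have "cg B C 2 (wV (teich (P1 + Q1 + s))) (wV (teich s))"
    using cg_wV[OF B C cg_1[OF B C P1]] by (simp add: numeral_2_eq_2)
  ultimately show ?thesis
    using cg_trans[OF B C] cg_weq[OF B C] cg_teich_add[OF B C P] by blast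
qed

text \<open>In length 3 two components of the carry count, - P Q and - P Q (P + Q)^2. The second is
  assumed to be a coboundary; the first splits as P1 + Q1 and causes a carry - P1 Q1 of its own, of
  which \<open>s\<close> is left. Signs disappear in characteristic 2.\<close>

lemma cg_3:
  fixes B C :: "'r set"
  assumes p2: "p = 2" and B: "is_subring B" and C: "is_subring C" and P: "P \<in> B" "Q \<in> C"
    and c0: "P * Q = P1 + Q1" and P1: "P1 \<in> B" "Q1 \<in> C"
    and c1: "P * Q * (P + Q) ^ 2 = P2 + Q2" and P2: "P2 \<in> B" "Q2 \<in> C"
    and c2: "P1 * Q1 = P3 + Q3 + s" and P3: "P3 \<in> B" "Q3 \<in> C"
  shows "cg B C 3 (teich (P + Q)) (wV (wV (teich s)))"
proof -
  have two: "2 = (0::'r)" using char_p p2 by simp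
  have neg: "- (a::'r) = a" for a
    using two by (simp add: neg_eq_iff_add_eq_0 mult_2[symmetric])
  let ?c = "carry P Q"
  have c_0: "?c 0 = P1 + Q1" using carry_0_2[OF p2, of P Q] c0 neg by simp
  have "?c 1 = P2 + Q2"
    using carry_1_2[OF p2, of P Q] unfolding neg by (simp add: two flip: c1)
      (simp add: two power2_eq_square power3_eq_cube algebra_simps)
  then have "weq 2 ?c (wadd p (teich (P1 + Q1)) (wV (teich (P2 + Q2))))"
    using weq_wadd[OF weq_refl weq_wV[of 1 "\<lambda>i. ?c (Suc i)" "teich (P2 + Q2)"], of p "teich (?c 0)"] 
    by (subst witt_decompose) (simp add: c_0 weq_def[of "Suc 0"] numeral_2_eq_2)
  moreover have "cg B C 2 (wadd p (teich (P1 + Q1)) (wV (teich (P2 + Q2)))) (wadd p (wV (teich s)) (wV (teich 0)))"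
  proof (rule cg_add[OF B C])
    show "cg B C 2 (teich (P1 + Q1)) (wV (teich s))"
      by (rule cg_2[OF B C P1 _ P3]) (simp only: carry_0_2[OF p2] c2 neg)
    show "cg B C 2 (wV (teich (P2 + Q2))) (wV (teich 0))"
      using cg_wV[OF B C cg_1[OF B C P2, of 0]] by (simp add: numeral_2_eq_2)
  qed
  moreover have "teich 0 = (wzero :: nat \<Rightarrow> 'r)" by (rule ext) (simp add: teich_def)
  ultimately have "cg B C 2 ?c (wadd p (wV (teich s)) (wV wzero))"
    using cg_trans[OF B C] cg_weq[OF B C] by metis
  then have "cg B C 2 ?c (wV (teich s))" by simp
  from cg_wV[OF B C cg_neg[OF B C this]] have "cg B C 3 (wneg p (wV ?c)) (wV (wV (wneg p (teich s))))"
    by (simp only: numeral_3_eq_3 numeral_2_eq_2 wV_neg)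
  \<comment> \<open>Negation of Witt vectors is not the identity for p = 2, but after two shifts
    only component 0 counts in length 3, where it is.\<close>
  moreover have "weq 1 (wneg p (teich s)) (teich s)" by (simp add: weq_def neg)
  then have "weq 3 (wV (wV (wneg p (teich s)))) (wV (wV (teich s)))"
    using weq_wV[OF weq_wV] by (simp only: numeral_3_eq_3 One_nat_def)
  ultimately show ?thesis
    using cg_trans[OF B C] cg_weq[OF B C] cg_teich_add[OF B C P] by blast
qed

end

section \<open>Double points over a power series ring in two variables\<close>

text \<open>\<open>a $ j $ i\<close> is the coefficient of x^i y^j, since y is the outer variable;
  the order is taken with respect to total degree.\<close>

definition ord_ge :: "nat \<Rightarrow> 'k::comm_ring_1 fps fps \<Rightarrow> bool" where
  "ord_ge d a \<longleftrightarrow> (\<forall>i j. i + j < d \<longrightarrow> a $ j $ i = 0)"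

lemma ord_geD: "ord_ge d a \<Longrightarrow> i + j < d \<Longrightarrow> a $ j $ i = 0"
  by (simp add: ord_ge_def)

lemma ord_ge_0 [simp]: "ord_ge 0 a"
  by (simp add: ord_ge_def)

lemma ord_ge_mono: "ord_ge d a \<Longrightarrow> e \<le> d \<Longrightarrow> ord_ge e a"
  by (auto simp: ord_ge_def)

lemma ord_ge_add: "ord_ge d a \<Longrightarrow> ord_ge d b \<Longrightarrow> ord_ge d (a + b)"
  by (simp add: ord_ge_def)

lemma ord_ge_diff: "ord_ge d a \<Longrightarrow> ord_ge d b \<Longrightarrow> ord_ge d (a - b)"
  by (simp add: ord_ge_def)

lemma ord_ge_uminus: "ord_ge d a \<Longrightarrow> ord_ge d (- a)"
  by (simp add: ord_ge_def)

lemma ord_ge_eq_0: "(\<And>d. ord_ge d a) \<Longrightarrow> a = 0"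
  by (auto simp: ord_ge_def fps_eq_iff)

lemma fps2_mult_nth: "(a * b) $ n $ m = (\<Sum>j\<le>n. \<Sum>i\<le>m. a $ j $ i * b $ (n - j) $ (m - i))"
  by (simp add: fps_mult_nth fps_sum_nth atLeast0AtMost)

lemma ord_ge_mult:
  assumes "ord_ge d a" "ord_ge e b"
  shows "ord_ge (d + e) (a * b)"
  unfolding ord_ge_def
proof (intro allI impI)
  fix m n assume mn: "m + n < d + e"
  have "a $ j $ i * b $ (n - j) $ (m - i) = 0" if "j \<le> n" "i \<le> m" for i j
  proof (cases "i + j < d")
    case False
    then have "(m - i) + (n - j) < e" using mn that by linarith
    then show ?thesis using assms by (simp add: ord_geD)
  qed (use assms in \<open>simp add: ord_geD\<close>)
  then show "(a * b) $ n $ m = 0" by (simp add: fps2_mult_nth)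
qed

lemma ord_ge_mult_left: "ord_ge e b \<Longrightarrow> ord_ge e (a * b)"
  using ord_ge_mult[of 0 a e b] by simp

definition ord_is :: "nat \<Rightarrow> 'k::comm_ring_1 fps fps \<Rightarrow> bool" where
  "ord_is d a \<longleftrightarrow> ord_ge d a \<and> \<not> ord_ge (Suc d) a"

lemma ord_is_exists:
  assumes "a \<noteq> 0"
  obtains d where "ord_is d a"
proof -
  obtain e where e: "\<not> ord_ge e a" using assms ord_ge_eq_0 by blast
  let ?d = "LEAST e. \<not> ord_ge e a"
  have d: "\<not> ord_ge ?d a" using e by (rule LeastI)
  then obtain d where "?d = Suc d" by (cases ?d) auto
  moreover have "ord_ge d a" using not_less_Least[of d "\<lambda>e. \<not> ord_ge e a"] \<open>?d = Suc d\<close> by auto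
  ultimately show thesis using d that by (auto simp: ord_is_def)
qed

text \<open>Singles out, among the terms of lowest total degree, the one with the least power of x:
  a leading term for a monomial order, so that leading terms multiply.\<close>

lemma ord_is_lead:
  assumes "ord_is d a"
  obtains i where "i \<le> d" "a $ (d - i) $ i \<noteq> 0" "\<forall>i'<i. a $ (d - i') $ i' = 0"
proof -
  let ?P = "\<lambda>i. i \<le> d \<and> a $ (d - i) $ i \<noteq> 0"
  obtain i j where ij: "i + j < Suc d" "a $ j $ i \<noteq> 0" using assms by (auto simp: ord_is_def ord_ge_def)
  have "\<not> i + j < d" using assms ij by (auto simp: ord_is_def ord_ge_def)
  then have "j = d - i" "i \<le> d" using ij by auto
  then have ex: "?P i" using ij by auto
  let ?i = "LEAST i. ?P i"
  have "?P ?i" using ex by (rule LeastI)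
  moreover have "a $ (d - i') $ i' = 0" if "i' < ?i" for i'
    using not_less_Least[OF that] that calculation by auto
  ultimately show thesis by (intro that[of ?i]) auto
qed

text \<open>At the product of the two leading monomials no other pair of terms contributes: either
  one degree is too small, or within the lowest degrees one exponent of x is below the least
  one.\<close>

lemma ord_is_mult:
  fixes a b :: "'k::idom fps fps"
  assumes a: "ord_is d a" and b: "ord_is e b"
  shows "ord_is (d + e) (a * b)"
proof -
  obtain i where i: "i \<le> d" "a $ (d - i) $ i \<noteq> 0" "\<forall>i'<i. a $ (d - i') $ i' = 0"
    using a by (rule ord_is_lead)
  obtain j where j: "j \<le> e" "b $ (e - j) $ j \<noteq> 0" "\<forall>j'<j. b $ (e - j') $ j' = 0"
    using b by (rule ord_is_lead)
  let ?n = "(d - i) + (e - j)" let ?m = "i + j"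
  have z: "a $ l $ k * b $ (?n - l) $ (?m - k) = 0" if lk: "l \<le> ?n" "k \<le> ?m" "(l, k) \<noteq> (d - i, i)" for k l
  proof -
    consider "k + l < d" | "k + l > d" | "k + l = d" by linarith
    then show ?thesis
    proof cases
      case 1
      then show ?thesis using a by (auto simp: ord_is_def ord_geD)
    next
      case 2
      then have "(?m - k) + (?n - l) < e" using lk i j by linarith
      then show ?thesis using b by (auto simp: ord_is_def ord_geD)
    next
      case 3
      then have l: "l = d - k" by auto
      show ?thesis
      proof (cases "k < i")
        case True
        then show ?thesis using i l by auto
      next
        case False
        then have "k > i" using lk l by auto
        then have "?m - k < j" "?n - l = e - (?m - k)" using lk i j l 3 by linarith+
        then show ?thesis using j(3) by auto
      qed
    qed
  qed
  have "(\<Sum>k\<le>?m. a $ l $ k * b $ (?n - l) $ (?m - k)) = (if l = d - i then a $ (d - i) $ i * b $ (e - j) $ j else 0)"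
    if "l \<le> ?n" for l
  proof (cases "l = d - i")
    case True
    have "(\<Sum>k\<le>?m. a $ l $ k * b $ (?n - l) $ (?m - k)) = (\<Sum>k\<in>{i}. a $ l $ k * b $ (?n - l) $ (?m - k))"
    proof (rule sum.mono_neutral_right)
      show "\<forall>k\<in>{..?m} - {i}. a $ l $ k * b $ (?n - l) $ (?m - k) = 0"
        using z[of l] that True by auto
    qed auto
    then show ?thesis using True by simp
  next
    case False
    then show ?thesis using z that by (auto intro!: sum.neutral)
  qed
  then have "(a * b) $ ?n $ ?m = a $ (d - i) $ i * b $ (e - j) $ j"
    by (simp add: fps2_mult_nth)
  then have "(a * b) $ ?n $ ?m \<noteq> 0" using i j by simp
  moreover have "?m + ?n = d + e" using i j by simp
  ultimately have "\<not> ord_ge (Suc (d + e)) (a * b)" by (metis lessI ord_geD)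
  then show ?thesis using a b ord_ge_mult by (auto simp: ord_is_def)
qed

text \<open>In total degree the three terms of $a^2 - Bab + Cb^2$ have orders of different sizes, since
  $C$ has odd order 3 and $B$ has order at least 2.\<close>

lemma quadratic_no_root:
  fixes a b B C :: "'k::idom fps fps"
  assumes B: "ord_ge 2 B" and C: "ord_is 3 C" and eq: "a ^ 2 - B * a * b + C * b ^ 2 = 0"
  shows "b = 0"
proof (rule ccontr)
  assume "b \<noteq> 0"
  then obtain \<beta> where \<beta>: "ord_is \<beta> b" by (rule ord_is_exists)
  have b2: "ord_is (3 + (\<beta> + \<beta>)) (C * b ^ 2)"
    unfolding power2_eq_square using C \<beta> by (intro ord_is_mult)
  have "a \<noteq> 0"
  proof
    assume "a = 0"
    then have "C * b ^ 2 = 0" using eq by simp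
    from b2[unfolded this] show False by (simp add: ord_is_def ord_ge_def)
  qed
  then obtain \<alpha> where \<alpha>: "ord_is \<alpha> a" by (rule ord_is_exists)
  have a2: "ord_is (\<alpha> + \<alpha>) (a ^ 2)"
    unfolding power2_eq_square using \<alpha> by (intro ord_is_mult)
  have ab: "ord_ge (2 + \<alpha> + \<beta>) (B * a * b)"
    using B \<alpha> \<beta> by (intro ord_ge_mult) (auto simp: ord_is_def)
  show False
  \<comment> \<open>The orders are 2 \<alpha> for a^2, at least \<alpha> + \<beta> + 2 for B a b,
    and 2 \<beta> + 3 for C b^2. If \<alpha> \<le> \<beta> + 1, the first is strictly the smallest,
    otherwise the last.\<close>
  proof (cases "\<alpha> \<le> \<beta> + 1")
    case True
    have "a ^ 2 = B * a * b - C * b ^ 2" using eq by (simp add: algebra_simps)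
    moreover have "ord_ge (Suc (\<alpha> + \<alpha>)) (B * a * b)" "ord_ge (Suc (\<alpha> + \<alpha>)) (C * b ^ 2)"
      using ab b2 True by (auto simp: ord_is_def elim!: ord_ge_mono)
    ultimately show False using a2 ord_ge_diff by (auto simp: ord_is_def)
  next
    case False
    have "C * b ^ 2 = B * a * b - a ^ 2" using eq by (simp add: algebra_simps)
    moreover have "ord_ge (Suc (3 + (\<beta> + \<beta>))) (B * a * b)" "ord_ge (Suc (3 + (\<beta> + \<beta>))) (a ^ 2)"
      using ab a2 False by (auto simp: ord_is_def elim!: ord_ge_mono)
    ultimately show False using b2 ord_ge_diff[of "Suc (3 + (\<beta> + \<beta>))" "B * a * b" "a ^ 2"] by (auto simp: ord_is_def)
  qed
qed

section \<open>Weierstrass division by z^2 + B z + C\<close>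

context
  fixes B C :: "'k::comm_ring_1 fps fps"
  assumes B: "ord_ge 1 B" and C: "ord_ge 1 C"
begin

definition dbl :: "'k fps fps fps" where
  "dbl = fps_X ^ 2 + fps_const B * fps_X + fps_const C"

lemma dbl_mult_nth: "(q * dbl) $ 0 = C * q $ 0" "(q * dbl) $ 1 = B * q $ 0 + C * q $ 1"
  "(q * dbl) $ Suc (Suc n) = q $ n + B * q $ Suc n + C * q $ Suc (Suc n)"
proof -
  have "q * dbl = fps_X ^ 2 * q + fps_const B * (fps_X * q) + fps_const C * q"
    by (simp add: dbl_def algebra_simps)
  then show "(q * dbl) $ 0 = C * q $ 0" "(q * dbl) $ 1 = B * q $ 0 + C * q $ 1"
    "(q * dbl) $ Suc (Suc n) = q $ n + B * q $ Suc n + C * q $ Suc (Suc n)"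
    by (simp_all add: fps_X_power_mult_nth)
qed

text \<open>The coefficient of z^(n+2) in the division identity reads q_n = g_(n+2) - B q_(n+1) - C
  q_(n+2). It expresses q_n by later coefficients, so it is solved by iteration starting at 0; each
  round gains one order, since B and C have order at least 1.\<close>

fun weierstrass_approx :: "'k fps fps fps \<Rightarrow> nat \<Rightarrow> nat \<Rightarrow> 'k fps fps" where
  "weierstrass_approx g 0 n = 0"
| "weierstrass_approx g (Suc d) n =
    g $ (n + 2) - B * weierstrass_approx g d (n + 1) - C * weierstrass_approx g d (n + 2)"

lemma weierstrass_approx_step:
  "ord_ge d (weierstrass_approx g (Suc d) n - weierstrass_approx g d n)"
proof (induction d arbitrary: n)
  case (Suc d)
  let ?Q = "weierstrass_approx g"
  have "?Q (Suc (Suc d)) n - ?Q (Suc d) n =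
    - (B * (?Q (Suc d) (n + 1) - ?Q d (n + 1)) + C * (?Q (Suc d) (n + 2) - ?Q d (n + 2)))"
    by (simp add: algebra_simps)
  then show ?case
    using ord_ge_mult[OF B Suc[of "n + 1"]] ord_ge_mult[OF C Suc[of "n + 2"]]
    by (simp only: ord_ge_uminus ord_ge_add plus_1_eq_Suc)
qed simp

lemma weierstrass_approx_le:
  "d \<le> e \<Longrightarrow> ord_ge d (weierstrass_approx g e n - weierstrass_approx g d n)"
proof (induction e rule: dec_induct)
  case base
  then show ?case by (simp add: ord_ge_def)
next
  case (step e)
  have "weierstrass_approx g (Suc e) n - weierstrass_approx g d n =
    (weierstrass_approx g (Suc e) n - weierstrass_approx g e n) + (weierstrass_approx g e n - weierstrass_approx g d n)"
    by simp
  then show ?case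
    using ord_ge_add[OF ord_ge_mono[OF weierstrass_approx_step step.hyps(1)] step.IH] by (simp only:)
qed

lemma weierstrass_division: "\<exists>q a b. g = q * dbl + fps_const a + fps_const b * fps_X"
proof -
  let ?Q = "weierstrass_approx g"
  \<comment> \<open>The coefficient of x^i y^j is stationary from round i + j + 1 on, by
    \<open>weierstrass_approx_le\<close>.\<close>
  define q where "q = Abs_fps (\<lambda>n. Abs_fps (\<lambda>j. Abs_fps (\<lambda>i. ?Q (Suc (i + j)) n $ j $ i)))"
  have q: "ord_ge d (q $ n - ?Q d n)" for d n
    unfolding ord_ge_def
  proof (intro allI impI)
    fix i j assume "i + j < d"
    then have "ord_ge (Suc (i + j)) (?Q d n - ?Q (Suc (i + j)) n)"
      by (intro weierstrass_approx_le) simp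
    then show "(q $ n - ?Q d n) $ j $ i = 0"
      by (auto simp: q_def dest: ord_geD[where i = i and j = j] simp del: weierstrass_approx.simps)
  qed
  have rec: "q $ n + B * q $ Suc n + C * q $ Suc (Suc n) = g $ Suc (Suc n)" for n
  proof -
    have "ord_ge d (q $ n + B * q $ Suc n + C * q $ Suc (Suc n) - g $ Suc (Suc n))" for d
    proof -
      have "q $ n + B * q $ Suc n + C * q $ Suc (Suc n) - g $ Suc (Suc n) =
        (q $ n - ?Q (Suc d) n) + (B * (q $ Suc n - ?Q d (Suc n)) + C * (q $ Suc (Suc n) - ?Q d (Suc (Suc n))))"
        by (simp add: algebra_simps)
      moreover have "ord_ge d (q $ n - ?Q (Suc d) n)" using q[of "Suc d" n] by (rule ord_ge_mono) simp
      moreover have "ord_ge d (B * (q $ Suc n - ?Q d (Suc n)) + C * (q $ Suc (Suc n) - ?Q d (Suc (Suc n))))"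
        by (intro ord_ge_add ord_ge_mult_left q)
      ultimately show ?thesis by (simp only: ord_ge_add)
    qed
    from ord_ge_eq_0[OF this] show ?thesis by simp
  qed
  let ?r = "g - q * dbl"
  have z: "?r $ Suc (Suc n) = 0" for n using rec[of n] by (simp add: dbl_mult_nth)
  have "?r = fps_const (?r $ 0) + fps_const (?r $ 1) * fps_X"
  proof (rule fps_ext)
    fix n
    show "?r $ n = (fps_const (?r $ 0) + fps_const (?r $ 1) * fps_X) $ n"
    proof (cases n)
      case (Suc m) then show ?thesis using z by (cases m) (simp_all del: fps_sub_nth)
    qed simp
  qed
  then have "g = q * dbl + fps_const (?r $ 0) + fps_const (?r $ 1) * fps_X"
    by (simp only: add.assoc flip: diff_eq_eq) (simp add: algebra_simps)
  then show ?thesis by blast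
qed

text \<open>The homogeneous recursion gives every coefficient of q arbitrarily large order, so q = 0
  and the remainder vanishes with it.\<close>

lemma weierstrass_unique:
  assumes "q * dbl + fps_const a + fps_const b * fps_X = 0"
  shows "a = 0" "b = 0"
proof -
  have rec: "q $ n = - (B * q $ Suc n + C * q $ Suc (Suc n))" for n
  proof -
    have "(q * dbl + fps_const a + fps_const b * fps_X) $ Suc (Suc n) = 0" using assms by simp
    then have "q $ n + B * q $ Suc n + C * q $ Suc (Suc n) = 0" by (simp add: dbl_mult_nth)
    then show ?thesis by (simp only: add.assoc eq_neg_iff_add_eq_0)
  qed
  have "ord_ge d (q $ n)" for d n
  proof (induction d arbitrary: n)
    case (Suc d)
    show ?case using ord_ge_mult[OF B Suc[of "Suc n"]] ord_ge_mult[OF C Suc[of "Suc (Suc n)"]]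
      by (subst rec) (simp only: ord_ge_uminus ord_ge_add plus_1_eq_Suc)
  qed simp
  then have q: "q = 0" using ord_ge_eq_0 by (metis fps_ext fps_zero_nth)
  from assms have "fps_const a + fps_const b * fps_X = 0" by (simp add: q)
  then have "(fps_const a + fps_const b * fps_X) $ 0 = 0" "(fps_const a + fps_const b * fps_X) $ 1 = 0" by simp_all
  then show "a = 0" "b = 0" by simp_all
qed

end

section \<open>Coefficients and monomial ideals in k[[x,y]]\<close>

abbreviation SX :: "'k::comm_ring_1 fps fps" where "SX \<equiv> fps_const fps_X"
abbreviation SY :: "'k::comm_ring_1 fps fps" where "SY \<equiv> fps_X"

lemma SX_power_mult_nth: "(SX ^ N * a) $ j $ i = (if i < N then 0 else a $ j $ (i - N))"
proof -
  have "SX ^ N = (fps_const (fps_X ^ N) :: 'a fps fps)" by (simp add: fps_const_power)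
  then show ?thesis by (simp only: fps_mult_left_const_nth fps_X_power_mult_nth)
qed

lemma SY_power_mult_nth: "(SY ^ N * a) $ j $ i = (if j < N then 0 else a $ (j - N) $ i)"
  by (simp add: fps_X_power_mult_nth)

lemma SX_power_dvd:
  assumes "a * SY ^ M = b * SX ^ N"
  obtains c where "a = SX ^ N * c"
proof
  show "a = SX ^ N * Abs_fps (\<lambda>j. Abs_fps (\<lambda>i. a $ j $ (i + N)))"
  proof (intro fps_ext)
    fix j i
    show "a $ j $ i = (SX ^ N * Abs_fps (\<lambda>j. Abs_fps (\<lambda>i. a $ j $ (i + N)))) $ j $ i"
    proof (cases "i < N")
      case True
      have "a $ j $ i = (SY ^ M * a) $ (j + M) $ i" by (simp add: SY_power_mult_nth)
      also have "\<dots> = (SX ^ N * b) $ (j + M) $ i" using assms by (simp add: mult.commute)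
      also have "\<dots> = 0" using True by (simp only: SX_power_mult_nth if_True)
      finally show ?thesis using True by (simp only: SX_power_mult_nth if_True)
    next
      case False
      then show ?thesis by (simp only: SX_power_mult_nth if_False fps_nth_Abs_fps) simp
    qed
  qed
qed

text \<open>The colon ideal of (x^(K+1), y^(L+m)) by x^K y^L is (x, y^m): the coefficient of q at
  y^j with j < m reappears on the left at x^K y^(j+L), where the right side has no term.\<close>

lemma monomial_ideal_colon:
  assumes eq: "q * SX ^ K * SY ^ L = u * SY ^ (L + m) + v * SX ^ (Suc K)"
  obtains \<alpha> \<beta> where "q = SX * \<alpha> + SY ^ m * \<beta>"
proof
  have z: "q $ j $ 0 = 0" if "j < m" for j
  proof -
    have "q $ j $ 0 = (SX ^ K * (SY ^ L * q)) $ (j + L) $ K"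
      by (simp only: SX_power_mult_nth SY_power_mult_nth) simp
    also have "SX ^ K * (SY ^ L * q) = SY ^ (L + m) * u + SX ^ (Suc K) * v"
      using eq by (simp add: mult_ac)
    also have "\<dots> $ (j + L) $ K = 0"
      using that by (simp only: fps_add_nth SX_power_mult_nth SY_power_mult_nth) simp
    finally show ?thesis .
  qed
  let ?\<alpha> = "Abs_fps (\<lambda>j. if j < m then fps_shift 1 (q $ j) else 0)" let ?\<beta> = "fps_shift m q"
  show "q = SX * ?\<alpha> + SY ^ m * ?\<beta>"
  proof (intro fps_ext)
    fix j i
    have X: "(SX * ?\<alpha>) $ j $ i = (if i < 1 then 0 else ?\<alpha> $ j $ (i - 1))"
      using SX_power_mult_nth[of 1 ?\<alpha> j i] by simp
    show "q $ j $ i = (SX * ?\<alpha> + SY ^ m * ?\<beta>) $ j $ i"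
      using z[of j] by (simp only: fps_add_nth X SY_power_mult_nth) (cases i; auto)
  qed
qed

lemma unit_fps2:
  fixes a :: "'k::field fps fps"
  assumes "a $ 0 $ 0 \<noteq> 0"
  obtains b where "a * b = 1"
proof -
  have "(a $ 0) * inverse (a $ 0) = 1" using assms by (intro inverse_mult_eq_1')
  from fps_right_inverse[OF this] show thesis by (rule that)
qed

lemma split_const_fps2:
  obtains \<alpha> \<beta> where "a = fps_const (fps_const (a $ 0 $ 0)) + SX * \<alpha> + SY * \<beta>"
proof
  let ?\<alpha> = "fps_const (fps_shift 1 (a $ 0))" let ?\<beta> = "fps_shift 1 a"
  show "a = fps_const (fps_const (a $ 0 $ 0)) + SX * ?\<alpha> + SY * ?\<beta>"
  proof (intro fps_ext)
    fix j i
    have X: "(SX * ?\<alpha>) $ j $ i = (if i < 1 then 0 else ?\<alpha> $ j $ (i - 1))"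
      using SX_power_mult_nth[of 1 ?\<alpha> j i] by simp
    have Y: "(SY * ?\<beta>) $ j $ i = (if j < 1 then 0 else ?\<beta> $ (j - 1) $ i)"
      using SY_power_mult_nth[of 1 ?\<beta> j i] by simp
    show "a $ j $ i = (fps_const (fps_const (a $ 0 $ 0)) + SX * ?\<alpha> + SY * ?\<beta>) $ j $ i"
      by (simp only: fps_add_nth X Y) (cases i; cases j; auto)
  qed
qed

section \<open>The double point inside an algebraically closed field\<close>

type_synonym 'k quot_closure = "'k fps fps fract alg_closure"

definition emb :: "'k::field fps fps \<Rightarrow> 'k quot_closure" where
  "emb s = to_ac (to_fract s)"

lemma emb_simps [simp]:
  "emb 0 = 0" "emb 1 = 1" "emb (a + b) = emb a + emb b" "emb (a - b) = emb a - emb b"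
  "emb (- a) = - emb a" "emb (a * b) = emb a * emb b" "emb a = emb b \<longleftrightarrow> a = b" "emb a = 0 \<longleftrightarrow> a = 0"
  by (simp_all add: emb_def)

lemma emb_power [simp]: "emb (a ^ k) = emb a ^ k"
  by (induction k) auto

lemma emb_of_nat [simp]: "emb (of_nat k) = of_nat k"
  by (induction k) auto

locale double_point =
  fixes B C :: "'k::field fps fps" and \<zeta> :: "'k quot_closure"
  assumes B: "ord_ge 2 B" and C: "ord_is 3 C" and root: "\<zeta> ^ 2 + emb B * \<zeta> + emb C = 0"
begin

lemma ord_1: "ord_ge 1 B" "ord_ge 1 C"
  using B C by (auto simp: ord_is_def elim: ord_ge_mono)

lemma const_0: "B $ 0 $ 0 = 0" "C $ 0 $ 0 = 0"
  using ord_1 by (auto simp: ord_ge_def)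

lemma zeta_sq: "\<zeta> * \<zeta> = - (emb B * \<zeta>) - emb C"
  using root by (simp only: eq_iff_diff_eq_0[of "\<zeta> * \<zeta>"] power2_eq_square) (simp add: algebra_simps)

text \<open>Given a + b \<zeta> = 0, the equation of \<zeta> multiplied by b^2 becomes a^2 - B a b +
  C b^2 = 0, to which \<open>quadratic_no_root\<close> applies.\<close>

lemma indep:
  assumes "emb a + emb b * \<zeta> = 0"
  shows "a = 0" "b = 0"
proof -
  have z: "emb b * \<zeta> = - emb a" using assms by (simp add: add_eq_0_iff)
  have "emb b ^ 2 * (\<zeta> ^ 2 + emb B * \<zeta> + emb C) = (emb b * \<zeta>) ^ 2 + emb B * emb b * (emb b * \<zeta>) + emb C * emb b ^ 2"
    by (simp add: power2_eq_square algebra_simps)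
  then have "(- emb a) ^ 2 + emb B * emb b * (- emb a) + emb C * emb b ^ 2 = 0"
    unfolding root z by simp
  then have "emb (a ^ 2 - B * a * b + C * b ^ 2) = 0"
    by (simp add: mult_ac)
  then have "a ^ 2 - B * a * b + C * b ^ 2 = 0" by (simp only: emb_simps(8))
  then show b: "b = 0" by (rule quadratic_no_root[OF B C])
  show "a = 0" using z b by simp
qed

lemma indep_eq:
  assumes "emb a + emb b * \<zeta> = emb a' + emb b' * \<zeta>"
  shows "a = a'" "b = b'"
  using indep[of "a - a'" "b - b'"] assms by (simp_all add: algebra_simps)

text \<open>The model of A: a free k[[x,y]]-module on 1 and \<zeta>, and the range of
  \<open>dphi\<close>, whose kernel is generated by f.\<close>

definition dpA :: "'k quot_closure set" where
  "dpA = {emb a + emb b * \<zeta> | a b. True}"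

lemma dpAI: "emb a + emb b * \<zeta> \<in> dpA"
  unfolding dpA_def by blast

lemma dpAE:
  assumes "s \<in> dpA" obtains a b where "s = emb a + emb b * \<zeta>"
  using assms unfolding dpA_def by blast

lemma emb_dpA [simp]: "emb a \<in> dpA"
  using dpAI[of a 0] by simp

lemma zeta_dpA [simp]: "\<zeta> \<in> dpA"
  using dpAI[of 0 1] by simp

lemma mult_formula:
  "(emb a + emb b * \<zeta>) * (emb a' + emb b' * \<zeta>) =
    emb (a * a' - b * b' * C) + emb (a * b' + a' * b - b * b' * B) * \<zeta>"
proof -
  have "(emb a + emb b * \<zeta>) * (emb a' + emb b' * \<zeta>) =
     emb a * emb a' + (emb a * emb b' + emb a' * emb b) * \<zeta> + emb b * emb b' * (\<zeta> * \<zeta>)"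
    by (simp add: algebra_simps)
  then show ?thesis by (simp add: zeta_sq algebra_simps)
qed

lemma dpA_subring: "is_subring dpA"
  unfolding is_subring_def
proof (intro conjI ballI)
  show "1 \<in> dpA" using emb_dpA[of 1] by simp
  fix s t assume "s \<in> dpA" "t \<in> dpA"
  then obtain a b a' b' where st: "s = emb a + emb b * \<zeta>" "t = emb a' + emb b' * \<zeta>" by (elim dpAE)
  have "s - t = emb (a - a') + emb (b - b') * \<zeta>" by (simp add: st algebra_simps)
  then show "s - t \<in> dpA" using dpAI by metis
  show "s * t \<in> dpA" unfolding st mult_formula by (rule dpAI)
qed

definition xL :: "'k quot_closure" where "xL = emb SX"
definition yL :: "'k quot_closure" where "yL = emb SY"

lemma XY: "xL \<in> dpA" "yL \<in> dpA" "xL \<noteq> 0" "yL \<noteq> 0"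
  by (simp_all add: xL_def yL_def)

text \<open>Since 1 and \<zeta> are independent, coefficients can be compared, which reduces the
  claim to divisibility by x^n in k[[x,y]].\<close>

lemma int_XY: "frac_set dpA xL \<inter> frac_set dpA yL \<subseteq> dpA"
proof
  fix w assume w: "w \<in> frac_set dpA xL \<inter> frac_set dpA yL"
  obtain a b n where u: "w = (emb a + emb b * \<zeta>) / xL ^ n" using w by (auto simp: frac_set_def elim!: dpAE)
  obtain a' b' m where v: "w = (emb a' + emb b' * \<zeta>) / yL ^ m" using w by (auto simp: frac_set_def elim!: dpAE)
  have "(emb a + emb b * \<zeta>) * yL ^ m = (emb a' + emb b' * \<zeta>) * xL ^ n"
    using u v XY by (simp add: field_simps)
  then have "emb (a * SY ^ m) + emb (b * SY ^ m) * \<zeta> = emb (a' * SX ^ n) + emb (b' * SX ^ n) * \<zeta>"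
    by (simp add: xL_def yL_def algebra_simps del: fps_const_power fps_const_mult)
  from indep_eq[OF this] obtain c d where "a = SX ^ n * c" "b = SX ^ n * d"
    using SX_power_dvd by metis
  then have "w = emb c + emb d * \<zeta>" unfolding u using XY(3)
    by (simp add: xL_def add_divide_distrib del: fps_const_power)
  then show "w \<in> dpA" using dpAI by simp
qed

section \<open>Coboundaries in length one and the socle of H^2\<close>

definition bdset :: "'k quot_closure set" where
  "bdset = {u + v | u v. u \<in> frac_set dpA xL \<and> v \<in> frac_set dpA yL}"

lemma bdI: "u \<in> frac_set dpA xL \<Longrightarrow> v \<in> frac_set dpA yL \<Longrightarrow> u + v \<in> bdset"
  unfolding bdset_def by blast

lemma frac_subrings: "is_subring (frac_set dpA xL)" "is_subring (frac_set dpA yL)"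
  using XY dpA_subring by (auto intro: frac_set_is_subring)

lemma bd_left: "u \<in> frac_set dpA xL \<Longrightarrow> u \<in> bdset"
  using bdI[of u 0] frac_subrings by (simp add: is_subringD)

lemma bd_diff: "u \<in> bdset \<Longrightarrow> v \<in> bdset \<Longrightarrow> u - v \<in> bdset"
proof -
  assume "u \<in> bdset" "v \<in> bdset"
  then obtain a b c d where *: "u = a + b" "v = c + d" "a \<in> frac_set dpA xL" "b \<in> frac_set dpA yL"
    "c \<in> frac_set dpA xL" "d \<in> frac_set dpA yL" by (auto simp: bdset_def)
  have "u - v = (a - c) + (b - d)" using * by simp
  then show ?thesis
    by (simp only:) (rule bdI; rule is_subringD(4); (rule frac_subrings)?; simp add: *)
qed

lemma bd_0: "0 \<in> bdset"
  using frac_subrings(1) by (intro bd_left) (simp add: is_subringD)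

lemma bd_add: "u \<in> bdset \<Longrightarrow> v \<in> bdset \<Longrightarrow> u + v \<in> bdset"
  using bd_diff[OF _ bd_diff[OF bd_0], of u v] by simp

lemma bd_mult: "s \<in> dpA \<Longrightarrow> u \<in> bdset \<Longrightarrow> s * u \<in> bdset"
proof -
  assume s: "s \<in> dpA" and "u \<in> bdset"
  then obtain a b where *: "u = a + b" "a \<in> frac_set dpA xL" "b \<in> frac_set dpA yL" by (auto simp: bdset_def)
  have "s * u = s * a + s * b" using * by (simp add: distrib_left)
  moreover have "s \<in> frac_set dpA xL" "s \<in> frac_set dpA yL" using s frac_set_subset by auto
  ultimately show ?thesis using * frac_subrings bdI by (simp add: is_subringD)
qed

text \<open>After clearing denominators, comparison of the coefficients of 1 and \<zeta> reduces
  this to \<open>monomial_ideal_colon\<close>.\<close>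

lemma colon:
  assumes q: "q \<in> dpA" and bdset: "q / (xL * yL ^ m) \<in> bdset"
  obtains \<alpha> \<beta> where "\<alpha> \<in> dpA" "\<beta> \<in> dpA" "q = xL * \<alpha> + yL ^ m * \<beta>"
proof -
  obtain q0 q1 where q': "q = emb q0 + emb q1 * \<zeta>" using q by (rule dpAE)
  from bdset obtain a i b j where ab: "a \<in> dpA" "b \<in> dpA" "q / (xL * yL ^ m) = a / xL ^ i + b / yL ^ j"
    by (auto simp: bdset_def frac_set_def)
  have eq: "q * xL ^ i * yL ^ j = (a * xL) * yL ^ (j + m) + (b * yL ^ m) * xL ^ Suc i"
  proof -
    define u v where "u = a / xL ^ i" and "v = b / yL ^ j"
    then have uv: "a = u * xL ^ i" "b = v * yL ^ j" by (simp_all add: XY(3,4))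
    have "q = (u + v) * (xL * yL ^ m)"
      using ab(3) by (simp add: nonzero_divide_eq_eq XY(3,4) flip: u_def v_def)
    then show ?thesis unfolding uv by (simp add: power_add algebra_simps)
  qed
  obtain a0 a1 where a': "a * xL = emb a0 + emb a1 * \<zeta>" using ab XY dpA_subring by (metis dpAE is_subringD(5))
  obtain b0 b1 where b': "b * yL ^ m = emb b0 + emb b1 * \<zeta>" using ab XY dpA_subring by (metis dpAE is_subringD(5,7))
  have "emb (q0 * SX ^ i * SY ^ j) + emb (q1 * SX ^ i * SY ^ j) * \<zeta> =
    emb (a0 * SY ^ (j + m) + b0 * SX ^ Suc i) + emb (a1 * SY ^ (j + m) + b1 * SX ^ Suc i) * \<zeta>"
    using eq unfolding a' b' q' by (simp add: xL_def yL_def algebra_simps del: fps_const_power fps_const_mult)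
  from indep_eq[OF this] obtain \<alpha>0 \<beta>0 \<alpha>1 \<beta>1 where "q0 = SX * \<alpha>0 + SY ^ m * \<beta>0" "q1 = SX * \<alpha>1 + SY ^ m * \<beta>1"
    using monomial_ideal_colon by metis
  then have "q = xL * (emb \<alpha>0 + emb \<alpha>1 * \<zeta>) + yL ^ m * (emb \<beta>0 + emb \<beta>1 * \<zeta>)"
    unfolding q' by (simp add: xL_def yL_def algebra_simps del: fps_const_power fps_const_mult)
  then show thesis using that dpAI by blast
qed

abbreviation kc :: "'k \<Rightarrow> 'k quot_closure" where "kc c \<equiv> emb (fps_const (fps_const c))"

lemma split_const:
  assumes "s = emb a + emb b * \<zeta>"
  obtains \<alpha> \<beta> where "\<alpha> \<in> dpA" "\<beta> \<in> dpA" "s = kc (a $ 0 $ 0) + kc (b $ 0 $ 0) * \<zeta> + xL * \<alpha> + yL * \<beta>"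
proof -
  obtain \<alpha> \<beta> where a: "a = fps_const (fps_const (a $ 0 $ 0)) + SX * \<alpha> + SY * \<beta>" by (rule split_const_fps2)
  obtain \<alpha>' \<beta>' where b: "b = fps_const (fps_const (b $ 0 $ 0)) + SX * \<alpha>' + SY * \<beta>'" by (rule split_const_fps2)
  have "s = kc (a $ 0 $ 0) + kc (b $ 0 $ 0) * \<zeta> + xL * (emb \<alpha> + emb \<alpha>' * \<zeta>) + yL * (emb \<beta> + emb \<beta>' * \<zeta>)"
    unfolding assms xL_def yL_def by (subst a, subst b) (simp add: algebra_simps)
  then show thesis using that dpAI by blast
qed

lemma zeta_sq_XY:
  obtains \<alpha> \<beta> where "\<alpha> \<in> dpA" "\<beta> \<in> dpA" "\<zeta> * \<zeta> = xL * \<alpha> + yL * \<beta>"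
proof -
  have "\<zeta> * \<zeta> = emb (- C) + emb (- B) * \<zeta>" by (simp add: zeta_sq)
  from split_const[OF this] obtain \<alpha> \<beta> where "\<alpha> \<in> dpA" "\<beta> \<in> dpA"
    "\<zeta> * \<zeta> = kc ((- C) $ 0 $ 0) + kc ((- B) $ 0 $ 0) * \<zeta> + xL * \<alpha> + yL * \<beta>" .
  then show thesis using that const_0 by simp
qed

lemma over_XY_bd: "\<alpha> \<in> dpA \<Longrightarrow> \<beta> \<in> dpA \<Longrightarrow> (xL * \<alpha> + yL * \<beta>) / (xL * yL) \<in> bdset"
proof -
  assume *: "\<alpha> \<in> dpA" "\<beta> \<in> dpA"
  have "(xL * \<alpha> + yL * \<beta>) / (xL * yL) = \<beta> / xL ^ 1 + \<alpha> / yL ^ 1"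
    by (simp add: add_divide_distrib XY(3,4))
  then show ?thesis using bdI[OF frac_setI[OF *(2) refl] frac_setI[OF *(1) refl], of 1 1] by simp
qed

text \<open>Conceptually, A is Gorenstein and H^2 has a one-dimensional socle. Concretely, vanishing
  under x and y leaves a numerator over xy that matters only modulo (x, y), hence c0 + c1 \<zeta>
  with constants, and vanishing under \<zeta> forces c0 = 0.\<close>

lemma socle:
  assumes c: "c \<in> frac_set dpA (xL * yL)" and Xc: "xL * c \<in> bdset" and Yc: "yL * c \<in> bdset" and zc: "\<zeta> * c \<in> bdset"
  obtains \<alpha> where "\<alpha> \<in> dpA" "c - \<alpha> * (\<zeta> / (xL * yL)) \<in> bdset"
proof -
  obtain P q m where P: "P \<in> frac_set dpA xL" "q \<in> dpA" "xL * c = P + q / yL ^ m"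
    using Xc by (auto simp: bdset_def frac_set_def[of dpA yL])
  \<comment> \<open>One more factor y in numerator and denominator, so that y c still has a
    denominator x y^m as in \<open>colon\<close>, also for m = 0.\<close>
  let ?q = "q * yL"
  have q: "?q \<in> dpA" using P XY dpA_subring by (simp add: is_subringD)
  have PX: "P / xL \<in> frac_set dpA xL"
    using is_subringD(5)[OF frac_subrings(1) P(1) frac_set_inverse[OF dpA_subring, of xL]] by simp
  have "c = xL * c / xL" by (simp add: XY(3))
  also have "\<dots> = P / xL + ?q / (xL * yL ^ Suc m)"
    unfolding P(3) by (simp add: add_divide_distrib XY(3,4))
  finally have c1: "c = P / xL + ?q / (xL * yL ^ Suc m)" .
  have "?q / (xL * yL ^ m) = yL * c - yL * (P / xL)"
    unfolding c1 by (simp add: distrib_left XY(3,4))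
  also have "\<dots> \<in> bdset" using Yc bd_mult[OF _ bd_left[OF PX]] XY by (intro bd_diff) auto
  finally obtain \<alpha> \<beta> where ab: "\<alpha> \<in> dpA" "\<beta> \<in> dpA" "?q = xL * \<alpha> + yL ^ m * \<beta>" by (rule colon[OF q])
  have "c - \<beta> / (xL * yL) = P / xL + \<alpha> / yL ^ Suc m"
    unfolding c1 ab(3) by (simp add: add_divide_distrib XY(3,4))
  then have c2: "c - \<beta> / (xL * yL) \<in> bdset" 
    by (simp only:) (rule bdI[OF PX frac_setI[OF ab(1) refl]])
  obtain b0 b1 where "\<beta> = emb b0 + emb b1 * \<zeta>" using ab by (elim dpAE)
  from split_const[OF this] obtain \<alpha>' \<beta>' c0 c1 where b: "\<alpha>' \<in> dpA" "\<beta>' \<in> dpA" "\<beta> = kc c0 + kc c1 * \<zeta> + xL * \<alpha>' + yL * \<beta>'" by metis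
  have "c - (kc c0 + kc c1 * \<zeta>) / (xL * yL) = (c - \<beta> / (xL * yL)) + (xL * \<alpha>' + yL * \<beta>') / (xL * yL)"
    unfolding b(3) by (simp add: add_divide_distrib)
  then have c3: "c - (kc c0 + kc c1 * \<zeta>) / (xL * yL) \<in> bdset" 
    by (simp only:) (intro bd_add c2 over_XY_bd b)
  obtain s t where st: "s \<in> dpA" "t \<in> dpA" "\<zeta> * \<zeta> = xL * s + yL * t" by (rule zeta_sq_XY)
  \<comment> \<open>Multiplication by \<zeta> turns c1 \<zeta> into c1 \<zeta>^2, whose quotient by
    xy is a coboundary because \<zeta>^2 lies in (x, y); what remains is c0 \<zeta>/(xy).\<close>
  have "kc c0 * \<zeta> / (xL * yL ^ 1) = \<zeta> * c - \<zeta> * (c - (kc c0 + kc c1 * \<zeta>) / (xL * yL)) - kc c1 * ((xL * s + yL * t) / (xL * yL))"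
    unfolding st(3)[symmetric] power_one_right divide_inverse by (simp only: algebra_simps)
  also have "\<dots> \<in> bdset"
    by (intro bd_diff bd_mult[OF zeta_dpA c3] zc bd_mult[OF emb_dpA over_XY_bd[OF st(1,2)]])
  finally obtain \<gamma> \<delta> where gd: "\<gamma> \<in> dpA" "\<delta> \<in> dpA" "kc c0 * \<zeta> = xL * \<gamma> + yL ^ 1 * \<delta>"
    by (rule colon[OF is_subringD(5)[OF dpA_subring emb_dpA zeta_dpA]])
  obtain g0 g1 d0 d1 where "\<gamma> = emb g0 + emb g1 * \<zeta>" "\<delta> = emb d0 + emb d1 * \<zeta>" using gd by (elim dpAE)
  with gd(3) have "emb 0 + emb (fps_const (fps_const c0)) * \<zeta> = emb (SX * g0 + SY * d0) + emb (SX * g1 + SY * d1) * \<zeta>"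
    by (simp add: xL_def yL_def algebra_simps del: fps_const_power fps_const_mult)
  \<comment> \<open>For an element of x A + y A the coefficient of \<zeta> has constant term
    0.\<close>
  from indep_eq(2)[OF this] have "fps_const (fps_const c0) $ 0 $ 0 = (SX * g1 + SY * d1) $ 0 $ 0" by simp
  then have "c0 = 0" by simp
  with c3 have "c - kc c1 * (\<zeta> / (xL * yL)) \<in> bdset" by simp
  with emb_dpA show thesis by (rule that)
qed

section \<open>The maximal ideal (x, y, z)\<close>

definition dpM :: "'k quot_closure set" where
  "dpM = {xL * \<alpha> + yL * \<beta> + \<zeta> * \<gamma> | \<alpha> \<beta> \<gamma>. \<alpha> \<in> dpA \<and> \<beta> \<in> dpA \<and> \<gamma> \<in> dpA}"

text \<open>Outside the ideal the constant term of a is non-zero, and so is that of the norm a^2 - B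
  a b + C b^2; the conjugate divided by the norm is the inverse.\<close>

lemma unit_or_dpM:
  assumes s: "s \<in> dpA" "s \<notin> dpM"
  obtains t where "t \<in> dpA" "s * t = 1"
proof -
  obtain a b where ab: "s = emb a + emb b * \<zeta>" using s by (elim dpAE)
  have a0: "a $ 0 $ 0 \<noteq> 0"
  proof
    assume a0: "a $ 0 $ 0 = 0"
    from split_const[OF ab] obtain \<alpha> \<beta> where "\<alpha> \<in> dpA" "\<beta> \<in> dpA" "s = kc (a $ 0 $ 0) + kc (b $ 0 $ 0) * \<zeta> + xL * \<alpha> + yL * \<beta>" .
    then have "s = xL * \<alpha> + yL * \<beta> + \<zeta> * kc (b $ 0 $ 0)" using a0 by (simp add: algebra_simps)
    then have "s \<in> dpM" using \<open>\<alpha> \<in> dpA\<close> \<open>\<beta> \<in> dpA\<close> unfolding dpM_def by (blast intro: emb_dpA)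
    then show False using s by simp
  qed
  let ?N = "a * a - B * a * b + b * b * C"
  have "?N $ 0 $ 0 \<noteq> 0" using a0 const_0 by simp
  then obtain c where c: "?N * c = 1" by (rule unit_fps2)
  \<comment> \<open>The second factor is the conjugate, in which the other root - B - \<zeta>
    replaces \<zeta>.\<close>
  have "(emb a + emb b * \<zeta>) * (emb (a - b * B) + emb (- b) * \<zeta>) = emb ?N"
    unfolding mult_formula by (simp add: algebra_simps)
  then have "s * ((emb (a - b * B) + emb (- b) * \<zeta>) * emb c) = emb (?N * c)"
    unfolding ab by (simp only: emb_simps mult.assoc[symmetric])
  moreover have "(emb (a - b * B) + emb (- b) * \<zeta>) * emb c \<in> dpA"
    by (rule is_subringD(5)[OF dpA_subring dpAI emb_dpA])
  ultimately show thesis using that c by simp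
qed

lemma one_notin_dpM: "1 \<notin> dpM"
proof
  assume "1 \<in> dpM"
  then obtain \<alpha> \<beta> \<gamma> where m: "\<alpha> \<in> dpA" "\<beta> \<in> dpA" "\<gamma> \<in> dpA" "1 = xL * \<alpha> + yL * \<beta> + \<zeta> * \<gamma>" by (auto simp: dpM_def)
  then obtain a0 a1 b0 b1 g0 g1 where e: "\<alpha> = emb a0 + emb a1 * \<zeta>" "\<beta> = emb b0 + emb b1 * \<zeta>" "\<gamma> = emb g0 + emb g1 * \<zeta>"
    by (elim dpAE)
  have "\<zeta> * \<gamma> = emb (- g1 * C) + emb (g0 - g1 * B) * \<zeta>"
    using mult_formula[of 0 1 g0 g1] unfolding e by simp
  with m(4) have "1 = xL * \<alpha> + yL * \<beta> + (emb (- g1 * C) + emb (g0 - g1 * B) * \<zeta>)" by simp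
  then have "emb 1 + emb 0 * \<zeta> = emb (SX * a0 + SY * b0 - g1 * C) + emb (SX * a1 + SY * b1 + g0 - g1 * B) * \<zeta>"
    unfolding e(1,2) by (simp add: xL_def yL_def algebra_simps del: fps_const_power fps_const_mult)
  from indep_eq(1)[OF this] have "(1 :: 'k fps fps) $ 0 $ 0 = (SX * a0 + SY * b0 - g1 * C) $ 0 $ 0" by simp
  then show False using const_0 by simp
qed

lemma dpM_subset: "dpM \<subseteq> dpA"
  using dpA_subring XY by (auto simp: dpM_def intro!: is_subringD)

lemma dpM_add: "s \<in> dpM \<Longrightarrow> t \<in> dpM \<Longrightarrow> s + t \<in> dpM"
proof -
  assume "s \<in> dpM" "t \<in> dpM"
  then obtain a b c a' b' c' where *: "s = xL * a + yL * b + \<zeta> * c" "t = xL * a' + yL * b' + \<zeta> * c'"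
    "a \<in> dpA" "b \<in> dpA" "c \<in> dpA" "a' \<in> dpA" "b' \<in> dpA" "c' \<in> dpA" by (auto simp: dpM_def)
  have "s + t = xL * (a + a') + yL * (b + b') + \<zeta> * (c + c')" using * by (simp add: algebra_simps)
  then show ?thesis using * dpA_subring unfolding dpM_def by (blast intro: is_subringD)
qed

lemma dpM_mult: "s \<in> dpM \<Longrightarrow> t \<in> dpA \<Longrightarrow> s * t \<in> dpM"
proof -
  assume "s \<in> dpM" and t: "t \<in> dpA"
  then obtain a b c where *: "s = xL * a + yL * b + \<zeta> * c" "a \<in> dpA" "b \<in> dpA" "c \<in> dpA" by (auto simp: dpM_def)
  have "s * t = xL * (a * t) + yL * (b * t) + \<zeta> * (c * t)" using * by (simp add: algebra_simps)
  then show ?thesis using * t dpA_subring unfolding dpM_def by (blast intro: is_subringD)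
qed

lemma XYz_dpM: "xL \<in> dpM" "yL \<in> dpM" "\<zeta> \<in> dpM"
proof -
  have "xL = xL * 1 + yL * 0 + \<zeta> * 0" "yL = xL * 0 + yL * 1 + \<zeta> * 0" "\<zeta> = xL * 0 + yL * 0 + \<zeta> * 1" by simp_all
  then show "xL \<in> dpM" "yL \<in> dpM" "\<zeta> \<in> dpM" 
    using is_subringD(1,2)[OF dpA_subring] unfolding dpM_def by blast+
qed

section \<open>The quotient map from k[[x,y,z]]\<close>

abbreviation dpf :: "'k fps3" where "dpf \<equiv> dbl B C"

text \<open>Substitution of \<zeta> for z. It goes through the remainder of Weierstrass division
  because an infinite series in \<zeta> has no meaning in the field.\<close>

definition dphi :: "'k fps3 \<Rightarrow> 'k quot_closure" where
  "dphi g = (SOME s. \<exists>q a b. g = q * dpf + fps_const a + fps_const b * fps_X \<and> s = emb a + emb b * \<zeta>)"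

lemma dphi_eq:
  assumes "g = q * dpf + fps_const a + fps_const b * fps_X"
  shows "dphi g = emb a + emb b * \<zeta>"
proof -
  have "\<exists>s q a b. g = q * dpf + fps_const a + fps_const b * fps_X \<and> s = emb a + emb b * \<zeta>" using assms by blast
  from someI_ex[OF this] obtain q' a' b' where g': "g = q' * dpf + fps_const a' + fps_const b' * fps_X" 
    and d: "dphi g = emb a' + emb b' * \<zeta>"
    unfolding dphi_def by blast
  have "(q - q') * dpf + fps_const (a - a') + fps_const (b - b') * fps_X = g - g"
    by (subst (1) assms, subst g') (simp add: algebra_simps flip: fps_const_sub)
  then have "(q - q') * dpf + fps_const (a - a') + fps_const (b - b') * fps_X = 0" by simp
  from weierstrass_unique[OF ord_1 this] show ?thesis using d by simp
qed

lemma dphi_repr: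
  obtains q a b where "g = q * dpf + fps_const a + fps_const b * fps_X" "dphi g = emb a + emb b * \<zeta>"
  using weierstrass_division[OF ord_1, of g] dphi_eq by blast

lemma dphi_const: "dphi (fps_const a) = emb a"
  using dphi_eq[of "fps_const a" 0 a 0] by simp

lemma dphi_add: "dphi (g + h) = dphi g + dphi h"
proof -
  obtain q a b where g: "g = q * dpf + fps_const a + fps_const b * fps_X" "dphi g = emb a + emb b * \<zeta>" by (rule dphi_repr)
  obtain q' a' b' where h: "h = q' * dpf + fps_const a' + fps_const b' * fps_X" "dphi h = emb a' + emb b' * \<zeta>" by (rule dphi_repr)
  have "g + h = (q + q') * dpf + fps_const (a + a') + fps_const (b + b') * fps_X"
    unfolding g(1) h(1) by (simp add: algebra_simps flip: fps_const_add)
  from dphi_eq[OF this] show ?thesis by (simp add: g(2) h(2) algebra_simps)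
qed

lemma dphi_mult: "dphi (g * h) = dphi g * dphi h"
proof -
  obtain q a b where g: "g = q * dpf + fps_const a + fps_const b * fps_X" "dphi g = emb a + emb b * \<zeta>" by (rule dphi_repr)
  obtain q' a' b' where h: "h = q' * dpf + fps_const a' + fps_const b' * fps_X" "dphi h = emb a' + emb b' * \<zeta>" by (rule dphi_repr)
  let ?g = "fps_const a + fps_const b * fps_X" let ?h = "fps_const a' + fps_const b' * fps_X"
  have gh: "?g * ?h = fps_const (b * b') * dpf + fps_const (a * a' - b * b' * C) + fps_const (a * b' + a' * b - b * b' * B) * fps_X"
    by (simp add: dbl_def[OF ord_1] power2_eq_square algebra_simps flip: fps_const_add fps_const_mult fps_const_sub)
  have "g * h = (q * h + q' * ?g) * dpf + ?g * ?h"
    unfolding g(1) h(1) by (simp add: algebra_simps)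
  also have "\<dots> = (q * h + q' * ?g + fps_const (b * b')) * dpf + fps_const (a * a' - b * b' * C) + fps_const (a * b' + a' * b - b * b' * B) * fps_X"
    unfolding gh by (simp add: algebra_simps)
  finally show ?thesis unfolding g(2) h(2) mult_formula by (rule dphi_eq)
qed

lemma dphi_kernel: "dphi g = 0 \<longleftrightarrow> (\<exists>q. g = q * dpf)"
proof
  assume 0: "dphi g = 0"
  obtain q a b where g: "g = q * dpf + fps_const a + fps_const b * fps_X" "dphi g = emb a + emb b * \<zeta>" by (rule dphi_repr)
  have "a = 0" "b = 0" using indep[of a b] 0 g(2) by auto
  then show "\<exists>q. g = q * dpf" using g(1) by auto
next
  assume "\<exists>q. g = q * dpf"
  then obtain q where "g = q * dpf + fps_const 0 + fps_const 0 * fps_X" by auto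
  from dphi_eq[OF this] show "dphi g = 0" by simp
qed

lemma dphi_range: "range dphi = dpA"
proof
  show "range dphi \<subseteq> dpA" using dphi_repr dpAI by (metis image_subsetI)
  show "dpA \<subseteq> range dphi"
  proof
    fix s assume "s \<in> dpA"
    then obtain a b where "s = emb a + emb b * \<zeta>" by (rule dpAE)
    then have "s = dphi (0 * dpf + fps_const a + fps_const b * fps_X)" using dphi_eq[OF refl, of 0 a b] by simp
    then show "s \<in> range dphi" by blast
  qed
qed

end

section \<open>Frobenius on the class of $z/(xy)$\<close>

text \<open>In \<open>laurent\<close>, \<open>xi\<close> and \<open>yi\<close> are the inverses of $x$ and $y$; the variables are named such that
  ordered rewriting moves a variable next to its inverse.\<close>

locale laurent = wittchar p ty for p :: nat and ty :: "'r::field itself" +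
  fixes Fx Fy :: "'r set" and xa xi ya yi za :: 'r
  assumes Fx: "is_subring Fx" and Fy: "is_subring Fy"
    and memx: "xa \<in> Fx" "xi \<in> Fx" "ya \<in> Fx" "za \<in> Fx"
    and memy: "xa \<in> Fy" "yi \<in> Fy" "ya \<in> Fy" "za \<in> Fy"
    and xx: "xa * xi = 1" and yy: "ya * yi = 1"
begin

lemma numeral_mem: "is_subring F \<Longrightarrow> numeral k \<in> F"
  using is_subring_of_nat[of F "numeral k"] by simp

lemmas Fx_intros = is_subringD[OF Fx] numeral_mem[OF Fx] memx
lemmas Fy_intros = is_subringD[OF Fy] numeral_mem[OF Fy] memy

lemma cancel: "xa * (xi * w) = w" "ya * (yi * w) = w"
  by (simp_all add: xx yy flip: mult.assoc)

definition t :: 'r where "t = za * xi * yi"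

text \<open>N is the first length in which F[t] can be non-zero. The factor is kept as an integer,
  whose invertibility is checked modulo p.\<close>

definition frob :: "nat \<Rightarrow> int \<Rightarrow> bool" where
  "frob N k \<longleftrightarrow> cg Fx Fy N (teich (t ^ p)) ((wV ^^ (N - 1)) (teich (of_int k * t)))"

lemma frob_1I:
  assumes "t ^ p = P + Q + of_int k * t" "P \<in> Fx" "Q \<in> Fy"
  shows "frob 1 k"
  using cg_1[OF Fx Fy assms(2,3), of "of_int k * t"] by (simp add: frob_def assms(1))

lemma frob_2I_2:
  assumes "p = 2" "t ^ 2 = P + Q" "P \<in> Fx" "Q \<in> Fy" "P * Q = P1 + Q1 + of_int k * t" "P1 \<in> Fx" "Q1 \<in> Fy"
  shows "frob 2 k"
  using cg_2[OF Fx Fy assms(3,4) _ assms(6,7), of "of_int k * t"] carry_0_2[OF assms(1), of P Q] assms(2,5)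
  unfolding frob_def by (simp add: assms(1))

lemma frob_2I_3:
  assumes "p = 3" "t ^ 3 = P + Q" "P \<in> Fx" "Q \<in> Fy" "P * Q * (P + Q) = P1 + Q1 + of_int k * t" "P1 \<in> Fx" "Q1 \<in> Fy"
  shows "frob 2 k"
  using cg_2[OF Fx Fy assms(3,4) _ assms(6,7), of "of_int k * t"] carry_0_3[OF assms(1), of P Q] assms(2,5)
  unfolding frob_def by (simp add: assms(1))

lemma frob_3I:
  assumes "p = 2" "t ^ 2 = P + Q" "P \<in> Fx" "Q \<in> Fy" "P * Q = P1 + Q1" "P1 \<in> Fx" "Q1 \<in> Fy"
    "P * Q * (P + Q) ^ 2 = P2 + Q2" "P2 \<in> Fx" "Q2 \<in> Fy"
    "P1 * Q1 = P3 + Q3 + of_int k * t" "P3 \<in> Fx" "Q3 \<in> Fy"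
  shows "frob 3 k"
  using cg_3[OF assms(1) Fx Fy assms(3,4,5,6,7,8,9,10,11,12,13)] assms(2)
  unfolding frob_def by (simp add: assms(1) eval_nat_numeral)

section \<open>Explicit splittings for the individual equations\<close>

lemma two_eq_0: "p = 2 \<Longrightarrow> 2 = (0 :: 'r)"
  using char_p by simp

text \<open>The pattern of all these lemmas: t^p is expanded by means of z^2 = - B z - C; terms with
  only powers of x in the denominator form P, those with only powers of y form Q, and a multiple of
  z/(xy) is left. In longer lengths the carries are treated alike.\<close>

lemma frob_E6_2_1:
  assumes p: "p = 2" and zz: "za * za = - ((xa * ya + ya^2) * za) - (xa^3)"
  shows "frob 1 (-1)"
proof -
  \<comment> \<open>The same reduction inside a right-nested product, the shape produced by ordered
    rewriting.\<close>
  have zz2: "za * (za * w) = (- ((xa * ya + ya^2) * za) - (xa^3)) * w" for w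
    by (subst zz[symmetric]) (rule mult.assoc[symmetric])
  show ?thesis
    by (rule frob_1I[of "- (za * xi^2)" "- (xa * yi^2)" "-1"])
      ((intro Fx_intros Fy_intros)?; simp add: t_def zz zz2 cancel xx yy numeral_eq_Suc algebra_simps p)+
qed

lemma frob_E6_2_0:
  assumes p: "p = 2" and zz: "za * za = - ((ya^2) * za) - (xa^3)"
  shows "frob 1 (0)"
proof -
  have zz2: "za * (za * w) = (- ((ya^2) * za) - (xa^3)) * w" for w
    by (subst zz[symmetric]) (rule mult.assoc[symmetric])
  show ?thesis
    by (rule frob_1I[of "- (za * xi^2)" "- (xa * yi^2)" "0"])
      ((intro Fx_intros Fy_intros)?; simp add: t_def zz zz2 cancel xx yy numeral_eq_Suc algebra_simps p)+
qed

lemma frob_E7_2_3: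
  assumes p: "p = 2" and zz: "za * za = - ((xa * ya) * za) - (xa^3 + xa * ya^3)"
  shows "frob 1 (-1)"
proof -
  have zz2: "za * (za * w) = (- ((xa * ya) * za) - (xa^3 + xa * ya^3)) * w" for w
    by (subst zz[symmetric]) (rule mult.assoc[symmetric])
  show ?thesis
    by (rule frob_1I[of "- (ya * xi)" "- (xa * yi^2)" "-1"])
      ((intro Fx_intros Fy_intros)?; simp add: t_def zz zz2 cancel xx yy numeral_eq_Suc algebra_simps p)+
qed

lemma frob_E7_2_2:
  assumes p: "p = 2" and zz: "za * za = - ((ya^3) * za) - (xa^3 + xa * ya^3)"
  shows "frob 2 (1)"
proof -
  have zz2: "za * (za * w) = (- ((ya^3) * za) - (xa^3 + xa * ya^3)) * w" for w
    by (subst zz[symmetric]) (rule mult.assoc[symmetric])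
  \<comment> \<open>Here P Q = 1/y + z/(xy), so t appears in the first carry already.\<close>
  show ?thesis
    by (rule frob_2I_2[OF p, of "- (ya * xi) - ya * za * xi^2" "- (xa * yi^2)" "0" "yi" "1"])
      ((intro Fx_intros Fy_intros)?; simp add: t_def zz zz2 cancel xx yy numeral_eq_Suc algebra_simps)+
qed

lemma frob_E7_2_1:
  assumes p: "p = 2" and zz: "za * za = - ((xa^2 * ya) * za) - (xa^3 + xa * ya^3)"
  shows "frob 3 (1)"
proof -
  have zz2: "za * (za * w) = (- ((xa^2 * ya) * za) - (xa^3 + xa * ya^3)) * w" for w
    by (subst zz[symmetric]) (rule mult.assoc[symmetric])
  have two: "a + a = 0" "a + (a + b) = b" "- a = a" for a b :: 'r
    using two_eq_0[OF p] by (simp_all add: neg_eq_iff_add_eq_0 flip: mult_2 add.assoc)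
  \<comment> \<open>P Q = z/x + 1/y splits, and the product of its two parts is z/(xy) itself,
    whence k = 1. The two longer witnesses split P Q (P + Q)^2.\<close>
  show ?thesis
    by (rule frob_3I[OF p, of "- (ya * xi)" "- (xa * yi^2) - za * yi" "za * xi" "yi" "ya * xi^2 + ya^2 * za * xi^3" "xa^4 * yi + xa^3 * za + xa^3 * yi^3 + xa^2 * ya^2 + xa^2 * yi^5 + xa + xa * za * yi^4 + ya * za" "0" "0" "1"])
      ((intro Fx_intros Fy_intros)?; simp add: t_def zz zz2 cancel xx yy numeral_eq_Suc algebra_simps two)+
qed

lemma frob_E7_2_0:
  assumes p: "p = 2" and zz: "za * za = - (xa^3 + xa * ya^3)"
  shows "frob 3 (0)"
proof -
  have zz2: "za * (za * w) = (- (xa^3 + xa * ya^3)) * w" for w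
    by (subst zz[symmetric]) (rule mult.assoc[symmetric])
  have two: "a + a = 0" "a + (a + b) = b" "- a = a" for a b :: 'r
    using two_eq_0[OF p] by (simp_all add: neg_eq_iff_add_eq_0 flip: mult_2 add.assoc)
  show ?thesis
    by (rule frob_3I[OF p, of "- (ya * xi)" "- (xa * yi^2)" "0" "yi" "ya * xi^2" "xa^2 * yi^5" "0" "0" "0"])
      ((intro Fx_intros Fy_intros)?; simp add: t_def zz zz2 cancel xx yy numeral_eq_Suc algebra_simps two)+
qed

lemma frob_E8_2_4:
  assumes p: "p = 2" and zz: "za * za = - ((xa * ya) * za) - (xa^3 + ya^5)"
  shows "frob 1 (-1)"
proof -
  have zz2: "za * (za * w) = (- ((xa * ya) * za) - (xa^3 + ya^5)) * w" for w
    by (subst zz[symmetric]) (rule mult.assoc[symmetric])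
  show ?thesis
    by (rule frob_1I[of "- (ya^3 * xi^2)" "- (xa * yi^2)" "-1"])
      ((intro Fx_intros Fy_intros)?; simp add: t_def zz zz2 cancel xx yy numeral_eq_Suc algebra_simps p)+
qed

lemma frob_E8_2_3:
  assumes p: "p = 2" and zz: "za * za = - ((ya^3) * za) - (xa^3 + ya^5)"
  shows "frob 2 (1)"
proof -
  have zz2: "za * (za * w) = (- ((ya^3) * za) - (xa^3 + ya^5)) * w" for w
    by (subst zz[symmetric]) (rule mult.assoc[symmetric])
  show ?thesis
    by (rule frob_2I_2[OF p, of "- (ya^3 * xi^2) - ya * za * xi^2" "- (xa * yi^2)" "ya * xi" "0" "1"])
      ((intro Fx_intros Fy_intros)?; simp add: t_def zz zz2 cancel xx yy numeral_eq_Suc algebra_simps)+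
qed

lemma frob_E8_2_2:
  assumes p: "p = 2" and zz: "za * za = - ((xa * ya^2) * za) - (xa^3 + ya^5)"
  shows "frob 3 (1)"
proof -
  have zz2: "za * (za * w) = (- ((xa * ya^2) * za) - (xa^3 + ya^5)) * w" for w
    by (subst zz[symmetric]) (rule mult.assoc[symmetric])
  have two: "a + a = 0" "a + (a + b) = b" "- a = a" for a b :: 'r
    using two_eq_0[OF p] by (simp_all add: neg_eq_iff_add_eq_0 flip: mult_2 add.assoc)
  \<comment> \<open>P Q = y/x + z/y^2 splits, and the product of its two parts is again
    z/(xy).\<close>
  show ?thesis
    by (rule frob_3I[OF p, of "- (za * xi) - ya^3 * xi^2" "- (xa * yi^2)" "ya * xi" "za * yi^2" "ya^5 * xi + ya^6 * xi^3 + ya^4 * za * xi^4 + ya^7 * xi^5" "xa^2 + xa^2 * za * yi^6 + xa * za * yi^2 + xa * yi^3 + ya^2 * za + ya" "0" "0" "1"])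
      ((intro Fx_intros Fy_intros)?; simp add: t_def zz zz2 cancel xx yy numeral_eq_Suc algebra_simps two)+
qed

lemma frob_E8_2_1:
  assumes p: "p = 2" and zz: "za * za = - ((xa * ya^3) * za) - (xa^3 + ya^5)"
  shows "frob 3 (0)"
proof -
  have zz2: "za * (za * w) = (- ((xa * ya^3) * za) - (xa^3 + ya^5)) * w" for w
    by (subst zz[symmetric]) (rule mult.assoc[symmetric])
  have two: "a + a = 0" "a + (a + b) = b" "- a = a" for a b :: 'r
    using two_eq_0[OF p] by (simp_all add: neg_eq_iff_add_eq_0 flip: mult_2 add.assoc)
  \<comment> \<open>Compared with r = 2 the term with z has one more factor y: P Q = y/x + z/y, and
    the second carry z/x has no y in the denominator. So nothing is left and k = 0.\<close>
  show ?thesis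
    by (rule frob_3I[OF p, of "- (ya * za * xi) - ya^3 * xi^2" "- (xa * yi^2)" "ya * xi" "za * yi" "ya^9 * xi + ya^8 * xi^3 + ya^5 * za * xi^4 + ya^7 * xi^5" "xa^2 * ya^4 + xa^2 * za * yi^5 + xa * ya * za + xa * yi^3 + ya^7 * za + ya^3" "za * xi" "0" "0"])
      ((intro Fx_intros Fy_intros)?; simp add: t_def zz zz2 cancel xx yy numeral_eq_Suc algebra_simps two)+
qed

lemma frob_E8_2_0:
  assumes p: "p = 2" and zz: "za * za = - (xa^3 + ya^5)"
  shows "frob 3 (0)"
proof -
  have zz2: "za * (za * w) = (- (xa^3 + ya^5)) * w" for w
    by (subst zz[symmetric]) (rule mult.assoc[symmetric])
  have two: "a + a = 0" "a + (a + b) = b" "- a = a" for a b :: 'r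
    using two_eq_0[OF p] by (simp_all add: neg_eq_iff_add_eq_0 flip: mult_2 add.assoc)
  show ?thesis
    by (rule frob_3I[OF p, of "- (ya^3 * xi^2)" "- (xa * yi^2)" "ya * xi" "0" "ya^7 * xi^5" "xa * yi^3" "0" "0" "0"])
      ((intro Fx_intros Fy_intros)?; simp add: t_def zz zz2 cancel xx yy numeral_eq_Suc algebra_simps two)+
qed

lemma frob_E6_3_1:
  assumes p: "p = 3" and zz: "za * za = - (xa^3 + xa^2 * ya^2 + ya^4)"
  shows "frob 1 (-1)"
proof -
  have zz2: "za * (za * w) = (- (xa^3 + xa^2 * ya^2 + ya^4)) * w" for w
    by (subst zz[symmetric]) (rule mult.assoc[symmetric])
  show ?thesis
    by (rule frob_1I[of "- (ya * za * xi^3)" "- (za * yi^3)" "-1"])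
      ((intro Fx_intros Fy_intros)?; simp add: t_def zz zz2 cancel xx yy numeral_eq_Suc algebra_simps p)+
qed

lemma frob_E6_3_0:
  assumes p: "p = 3" and zz: "za * za = - (xa^3 + ya^4)"
  shows "frob 1 (0)"
proof -
  have zz2: "za * (za * w) = (- (xa^3 + ya^4)) * w" for w
    by (subst zz[symmetric]) (rule mult.assoc[symmetric])
  show ?thesis
    by (rule frob_1I[of "- (ya * za * xi^3)" "- (za * yi^3)" "0"])
      ((intro Fx_intros Fy_intros)?; simp add: t_def zz zz2 cancel xx yy numeral_eq_Suc algebra_simps p)+
qed

lemma frob_E7_3_1:
  assumes p: "p = 3" and zz: "za * za = - (xa^3 + xa^2 * ya^2 + xa * ya^3)"
  shows "frob 1 (-1)"
proof -
  have zz2: "za * (za * w) = (- (xa^3 + xa^2 * ya^2 + xa * ya^3)) * w" for w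
    by (subst zz[symmetric]) (rule mult.assoc[symmetric])
  show ?thesis
    by (rule frob_1I[of "- (za * xi^2)" "- (za * yi^3)" "-1"])
      ((intro Fx_intros Fy_intros)?; simp add: t_def zz zz2 cancel xx yy numeral_eq_Suc algebra_simps p)+
qed

lemma frob_E7_3_0:
  assumes p: "p = 3" and zz: "za * za = - (xa^3 + xa * ya^3)"
  shows "frob 1 (0)"
proof -
  have zz2: "za * (za * w) = (- (xa^3 + xa * ya^3)) * w" for w
    by (subst zz[symmetric]) (rule mult.assoc[symmetric])
  show ?thesis
    by (rule frob_1I[of "- (za * xi^2)" "- (za * yi^3)" "0"])
      ((intro Fx_intros Fy_intros)?; simp add: t_def zz zz2 cancel xx yy numeral_eq_Suc algebra_simps p)+
qed

lemma frob_E8_3_2: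
  assumes p: "p = 3" and zz: "za * za = - (xa^3 + xa^2 * ya^2 + ya^5)"
  shows "frob 1 (-1)"
proof -
  have zz2: "za * (za * w) = (- (xa^3 + xa^2 * ya^2 + ya^5)) * w" for w
    by (subst zz[symmetric]) (rule mult.assoc[symmetric])
  show ?thesis
    by (rule frob_1I[of "- (ya^2 * za * xi^3)" "- (za * yi^3)" "-1"])
      ((intro Fx_intros Fy_intros)?; simp add: t_def zz zz2 cancel xx yy numeral_eq_Suc algebra_simps p)+
qed

lemma frob_E8_3_1:
  assumes p: "p = 3" and zz: "za * za = - (xa^3 + xa^2 * ya^3 + ya^5)"
  shows "frob 2 (4)"
proof -
  have zz2: "za * (za * w) = (- (xa^3 + xa^2 * ya^3 + ya^5)) * w" for w
    by (subst zz[symmetric]) (rule mult.assoc[symmetric])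
  \<comment> \<open>P Q (P + Q) is z (z^2)^2 (x^2 + y^2)/(x^6 y^6). The cross terms 2 x^3 y^5 and 2
    x^5 y^3 of (z^2)^2 both lead to x^5 y^5, which gives k = 4. The identity holds over the
    integers.\<close>
  show ?thesis
    by (rule frob_2I_3[OF p, of "- (za * xi) - ya^2 * za * xi^3" "- (za * yi^3)" "3 * ya^2 * za * xi^2 + 2 * ya * za * xi^3 + 3 * ya^4 * za * xi^4 + ya^6 * za * xi^6" "xa^2 * za * yi^6 + 2 * xa * za * yi^3 + za + za * yi^4" "4"])
      ((intro Fx_intros Fy_intros)?; simp add: t_def zz zz2 cancel xx yy numeral_eq_Suc algebra_simps)+
qed

lemma frob_E8_3_0:
  assumes p: "p = 3" and zz: "za * za = - (xa^3 + ya^5)"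
  shows "frob 2 (0)"
proof -
  have zz2: "za * (za * w) = (- (xa^3 + ya^5)) * w" for w
    by (subst zz[symmetric]) (rule mult.assoc[symmetric])
  show ?thesis
    by (rule frob_2I_3[OF p, of "- (ya^2 * za * xi^3)" "- (za * yi^3)" "2 * ya * za * xi^3 + ya^6 * za * xi^6" "za * yi^4" "0"])
      ((intro Fx_intros Fy_intros)?; simp add: t_def zz zz2 cancel xx yy numeral_eq_Suc algebra_simps)+
qed

lemma frob_E8_5_1:
  assumes p: "p = 5" and zz: "za * za = - (xa^3 + xa * ya^4 + ya^5)"
  shows "frob 1 (2)"
proof -
  have zz2: "za * (za * w) = (- (xa^3 + xa * ya^4 + ya^5)) * w" for w
    by (subst zz[symmetric]) (rule mult.assoc[symmetric])
  \<comment> \<open>In t^5 = z (z^2)^2/(x^5 y^5) the cross term 2 x^4 y^4 gives k = 2.\<close>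
  show ?thesis
    by (rule frob_1I[of "2 * za * xi^2 + ya^3 * za * xi^3 + 2 * ya^4 * za * xi^4 + ya^5 * za * xi^5" "xa * za * yi^5" "2"])
      ((intro Fx_intros Fy_intros)?; simp add: t_def zz zz2 cancel xx yy numeral_eq_Suc algebra_simps p)+
qed

lemma frob_E8_5_0:
  assumes p: "p = 5" and zz: "za * za = - (xa^3 + ya^5)"
  shows "frob 1 (0)"
proof -
  have zz2: "za * (za * w) = (- (xa^3 + ya^5)) * w" for w
    by (subst zz[symmetric]) (rule mult.assoc[symmetric])
  show ?thesis
    by (rule frob_1I[of "2 * za * xi^2 + ya^5 * za * xi^5" "xa * za * yi^5" "0"])
      ((intro Fx_intros Fy_intros)?; simp add: t_def zz zz2 cancel xx yy numeral_eq_Suc algebra_simps p)+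
qed

section \<open>Truncations of the Frobenius class, and multiplication by [z]\<close>

lemma funpow_wV_less: "i < k \<Longrightarrow> (wV ^^ k) w i = (0 :: 'r)"
proof (induction k arbitrary: i)
  case (Suc k)
  then show ?case by (cases i) auto
qed simp

lemma funpow_wV_zero: "(wV ^^ k) wzero = (wzero :: nat \<Rightarrow> 'r)"
  by (induction k) auto

text \<open>The first N - 1 components of a vector in the image of V^(N-1) are zero, so nothing is
  left of it below length N.\<close>

lemma frob_lower:
  assumes "frob N k" "n < N"
  shows "teich (t ^ p) \<in> Bd p n Fx Fy"
proof -
  have "cg Fx Fy n (teich (t ^ p)) ((wV ^^ (N - 1)) (teich (of_int k * t)))"
    using assms Bd_mono[of n N] unfolding frob_def cg_def[OF Fx Fy] by simp
  moreover have "weq n ((wV ^^ (N - 1)) (teich (of_int k * t))) wzero"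
    using assms funpow_wV_less by (auto simp: weq_def)
  then have "(wV ^^ (N - 1)) (teich (of_int k * t)) \<in> Bd p n Fx Fy"
    by (rule Bd_weq) (rule Bd_zero[OF Fx Fy])
  ultimately show ?thesis by (rule cg_Bd[OF Fx Fy])
qed

lemma frob_zero:
  assumes "frob n 0"
  shows "teich (t ^ p) \<in> Bd p n Fx Fy"
proof -
  have "teich 0 = (wzero :: nat \<Rightarrow> 'r)" by (rule ext) (simp add: teich_def)
  then show ?thesis
    using assms unfolding frob_def by (simp add: funpow_wV_zero cg_zero[OF Fx Fy])
qed

text \<open>z t = z^2/(xy) is P + Q with P = y \<beta>/x and Q = x \<alpha>/y, and P Q = \<alpha>
  \<beta> has no denominators. Therefore P Q, P Q (P + Q)^2 and P Q (P + Q), which make up the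
  carries for p = 2 and p = 3, split without remainder.\<close>

lemma teich_za_t:
  assumes zz: "za * za = xa ^ 2 * \<alpha> + ya ^ 2 * \<beta>" and ab: "\<alpha> \<in> Fx" "\<alpha> \<in> Fy" "\<beta> \<in> Fx" "\<beta> \<in> Fy"
    and pn: "p = 2 \<and> n \<le> 3 \<or> p = 3 \<and> n \<le> 2"
  shows "teich (za * t) \<in> Bd p n Fx Fy"
proof -
  let ?P = "ya * xi * \<beta>" let ?Q = "xa * yi * \<alpha>"
  have "za * t = (za * za) * (xi * yi)" by (simp add: t_def mult_ac)
  also have "\<dots> = ?P + ?Q" unfolding zz by (simp add: cancel xx yy power2_eq_square algebra_simps)
  finally have zt: "za * t = ?P + ?Q" .
  have PQ: "?P * ?Q = \<alpha> * \<beta>" by (simp add: cancel xx yy mult_ac)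
  have mem: "?P \<in> Fx" "?Q \<in> Fy" by (intro Fx_intros Fy_intros ab)+
  have 0: "teich 0 = (wzero :: nat \<Rightarrow> 'r)" by (rule ext) (simp add: teich_def)
  show ?thesis
  proof (cases "p = 2")
    case True
    have "cg Fx Fy 3 (teich (?P + ?Q)) (wV (wV (teich 0)))"
    \<comment> \<open>The regular product P Q is placed entirely on the side of P, with Q1 = 0, so
      that the second carry vanishes.\<close>
    proof (rule cg_3[OF True Fx Fy mem, of "\<alpha> * \<beta>" 0 "\<alpha> * \<beta> * (?P ^ 2 + 2 * (\<alpha> * \<beta>))" "\<alpha> * \<beta> * ?Q ^ 2" 0 0])
      show "?P * ?Q * (?P + ?Q) ^ 2 = \<alpha> * \<beta> * (?P ^ 2 + 2 * (\<alpha> * \<beta>)) + \<alpha> * \<beta> * ?Q ^ 2"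
        unfolding power2_sum by (simp only: PQ[symmetric]) (simp only: algebra_simps)
      show "\<alpha> * \<beta> * (?P ^ 2 + 2 * (\<alpha> * \<beta>)) \<in> Fx" by (intro Fx_intros ab mem)
      show "\<alpha> * \<beta> * ?Q ^ 2 \<in> Fy" by (intro Fy_intros ab mem)
    qed (simp_all add: PQ Fx_intros Fy_intros ab)
    then have "teich (za * t) \<in> Bd p 3 Fx Fy" by (simp add: zt 0 cg_zero[OF Fx Fy])
    then show ?thesis using pn True Bd_mono[of n 3] by auto
  next
    case False
    then have p: "p = 3" "n \<le> 2" using pn by auto
    have "cg Fx Fy 2 (teich (?P + ?Q)) (wV (teich 0))"
    proof (rule cg_2[OF Fx Fy mem, of "\<alpha> * \<beta> * ?P" "\<alpha> * \<beta> * ?Q"])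
      have "- carry ?P ?Q 0 = ?P * ?Q * (?P + ?Q)" using carry_0_3[OF p(1), of ?P ?Q] by simp
      also have "\<dots> = \<alpha> * \<beta> * ?P + \<alpha> * \<beta> * ?Q + 0" unfolding PQ by (simp only: distrib_left add_0_right)
      finally show "- carry ?P ?Q 0 = \<alpha> * \<beta> * ?P + \<alpha> * \<beta> * ?Q + 0" .
    qed (intro Fx_intros Fy_intros ab mem)+
    then have "teich (za * t) \<in> Bd p 2 Fx Fy" by (simp add: zt 0 cg_zero[OF Fx Fy])
    then show ?thesis using p Bd_mono[of n 2] by auto
  qed
qed

lemma teich_za_t_1:
  assumes zz: "za * za = xa * \<alpha> + ya * \<beta>" and ab: "\<alpha> \<in> Fy" "\<beta> \<in> Fx"
  shows "teich (za * t) \<in> Bd p 1 Fx Fy"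
proof -
  have "za * t = (za * za) * (xi * yi)" by (simp add: t_def mult_ac)
  also have "\<dots> = xi * \<beta> + yi * \<alpha> + 0" unfolding zz by (simp add: cancel xx yy algebra_simps)
  finally have zt: "za * t = xi * \<beta> + yi * \<alpha> + 0" .
  have "cg Fx Fy 1 (teich (za * t)) (teich 0)"
    unfolding zt by (rule cg_1[OF Fx Fy]) (intro Fx_intros Fy_intros ab)+
  moreover have "teich 0 = (wzero :: nat \<Rightarrow> 'r)" by (rule ext) (simp add: teich_def)
  ultimately show ?thesis by (simp add: cg_zero[OF Fx Fy])
qed

end

section \<open>Localizations and local cohomology inside a field\<close>

locale field_model = wittchar p ty for p :: nat and ty :: "'r::field itself" +
  fixes A :: "('a, 'm) ring_scheme" (structure) and \<iota> :: "'a \<Rightarrow> 'r"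
  assumes cring_A: "cring A"
    and \<iota>_one: "\<iota> \<one> = 1"
    and \<iota>_add: "a \<in> carrier A \<Longrightarrow> b \<in> carrier A \<Longrightarrow> \<iota> (a \<oplus> b) = \<iota> a + \<iota> b"
    and \<iota>_mult: "a \<in> carrier A \<Longrightarrow> b \<in> carrier A \<Longrightarrow> \<iota> (a \<otimes> b) = \<iota> a * \<iota> b"
    and \<iota>_inj: "inj_on \<iota> (carrier A)"
begin

sublocale A: cring A by (rule cring_A)

definition R0 :: "'r set" where "R0 = \<iota> ` carrier A"

lemma \<iota>_R0: "a \<in> carrier A \<Longrightarrow> \<iota> a \<in> R0"
  by (simp add: R0_def)

lemma \<iota>_eq: "a \<in> carrier A \<Longrightarrow> b \<in> carrier A \<Longrightarrow> \<iota> a = \<iota> b \<longleftrightarrow> a = b"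
  using \<iota>_inj by (auto dest: inj_onD)

lemma \<iota>_zero: "\<iota> \<zero> = 0"
proof -
  have "\<iota> \<zero> + \<iota> \<zero> = \<iota> \<zero> + 0" by (subst \<iota>_add[symmetric]) auto
  then show ?thesis by (rule add_left_imp_eq)
qed

lemma \<iota>_pow: "a \<in> carrier A \<Longrightarrow> \<iota> (a [^] (k::nat)) = \<iota> a ^ k"
  by (induction k) (auto simp: \<iota>_one \<iota>_mult)

lemma R0_subring: "is_subring R0"
  unfolding is_subring_def
proof (intro conjI ballI)
  show "1 \<in> R0" using \<iota>_R0[of \<one>] \<iota>_one by simp
  fix u v assume "u \<in> R0" "v \<in> R0"
  then obtain a b where ab: "a \<in> carrier A" "b \<in> carrier A" "u = \<iota> a" "v = \<iota> b" by (auto simp: R0_def)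
  have "u + \<iota> (\<ominus> b) + v = u + \<iota> (\<ominus> b \<oplus> b)" using ab by (simp add: \<iota>_add add.assoc del: A.l_neg)
  then have "u - v = \<iota> (a \<oplus> (\<ominus> b))" using ab \<iota>_zero \<iota>_add[of a "\<ominus> b"] by (simp add: A.l_neg algebra_simps)
  then show "u - v \<in> R0" using ab \<iota>_R0 by simp
  show "u * v \<in> R0" using ab \<iota>_R0[of "a \<otimes> b"] by (simp add: \<iota>_mult)
qed

text \<open>An element of A[1/s] is represented by the field element \<open>c\<close>; the set of
  all its fractions is, by \<open>loc_frac_eq\<close>, the equivalence class used in
  \<open>loc\<close>.\<close>

definition fib :: "'a \<Rightarrow> 'r \<Rightarrow> ('a \<times> nat) set" where
  "fib s c = {(b, j). b \<in> carrier A \<and> \<iota> b / \<iota> s ^ j = c}"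

abbreviation Fr :: "'a \<Rightarrow> 'r set" where "Fr s \<equiv> frac_set R0 (\<iota> s)"

lemma FrE:
  assumes "c \<in> Fr s" obtains a i where "a \<in> carrier A" "c = \<iota> a / \<iota> s ^ i"
  using assms by (auto simp: frac_set_def R0_def)

lemma FrI: "a \<in> carrier A \<Longrightarrow> \<iota> a / \<iota> s ^ i \<in> Fr s"
  by (auto simp: frac_set_def R0_def)

lemma fib_nonempty: "c \<in> Fr s \<Longrightarrow> fib s c \<noteq> {}"
  by (auto simp: fib_def elim!: FrE)

lemma fib_inj: "c \<in> Fr s \<Longrightarrow> fib s c = fib s d \<Longrightarrow> c = d"
  using fib_nonempty[of c s] by (auto simp: fib_def)

context
  fixes s assumes s: "s \<in> carrier A" "\<iota> s \<noteq> 0"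
begin

lemma Fr_subring: "is_subring (Fr s)"
  using R0_subring s \<iota>_R0 by (intro frac_set_is_subring) auto

text \<open>The extra power of s in \<open>loc_rel\<close> can be cancelled because \<iota> embeds A
  into a field.\<close>

lemma loc_rel_iff:
  "((a, i), (b, j)) \<in> loc_rel A s \<longleftrightarrow> a \<in> carrier A \<and> b \<in> carrier A \<and> \<iota> a / \<iota> s ^ i = \<iota> b / \<iota> s ^ j"
proof -
  have "s [^] k \<otimes> (s [^] j \<otimes> a) = s [^] k \<otimes> (s [^] i \<otimes> b) \<longleftrightarrow> \<iota> a / \<iota> s ^ i = \<iota> b / \<iota> s ^ j"
    if "a \<in> carrier A" "b \<in> carrier A" for k :: nat
  proof -
    have "s [^] k \<otimes> (s [^] j \<otimes> a) = s [^] k \<otimes> (s [^] i \<otimes> b) \<longleftrightarrow>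
      \<iota> (s [^] k \<otimes> (s [^] j \<otimes> a)) = \<iota> (s [^] k \<otimes> (s [^] i \<otimes> b))"
      using that s by (subst \<iota>_eq) auto
    also have "\<dots> \<longleftrightarrow> \<iota> s ^ j * \<iota> a = \<iota> s ^ i * \<iota> b"
      using that s by (simp add: \<iota>_mult \<iota>_pow)
    also have "\<dots> \<longleftrightarrow> \<iota> a / \<iota> s ^ i = \<iota> b / \<iota> s ^ j"
      using s by (auto simp: frac_eq_eq mult.commute)
    finally show ?thesis .
  qed
  then show ?thesis by (auto simp: loc_rel_def)
qed

lemma loc_frac_eq: "a \<in> carrier A \<Longrightarrow> loc_frac A s a i = fib s (\<iota> a / \<iota> s ^ i)"
  by (auto simp: loc_frac_def fib_def loc_rel_iff)

lemma carrier_loc: "carrier (loc A s) = fib s ` Fr s"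
proof -
  have "carrier (loc A s) = (\<lambda>(a, i). loc_frac A s a i) ` (carrier A \<times> UNIV)"
    by (auto simp: loc_def quotient_def loc_frac_def)
  also have "\<dots> = fib s ` Fr s"
    by (force simp: loc_frac_eq FrI elim!: FrE)
  finally show ?thesis .
qed

text \<open>The operations of \<open>loc\<close> are unions over all representatives; every
  representative yields the same class, so the union collapses.\<close>

lemma Union_fib:
  assumes "c \<in> Fr s" "d \<in> Fr s'"
    and "\<And>a i b j. a \<in> carrier A \<Longrightarrow> b \<in> carrier A \<Longrightarrow> \<iota> a / \<iota> s ^ i = c \<Longrightarrow> \<iota> b / \<iota> s' ^ j = d \<Longrightarrow> f a i b j = U"
  shows "(\<Union>(a, i)\<in>fib s c. \<Union>(b, j)\<in>fib s' d. f a i b j) = U"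
proof (rule SUP_eq_const[OF fib_nonempty[OF assms(1)]])
  fix u assume u: "u \<in> fib s c"
  show "(case u of (a, i) \<Rightarrow> \<Union>(b, j)\<in>fib s' d. f a i b j) = U"
  proof (cases u)
    case (Pair a i)
    have "(case v of (b, j) \<Rightarrow> f a i b j) = U" if "v \<in> fib s' d" for v
    proof -
      obtain b j where v: "v = (b, j)" by force
      have "f a i b j = U" by (rule assms(3)) (use that u Pair v in \<open>auto simp: fib_def\<close>)
      then show ?thesis by (simp add: v)
    qed
    then show ?thesis unfolding Pair prod.case by (rule SUP_eq_const[OF fib_nonempty[OF assms(2)]])
  qed
qed

lemma loc_mult: "c \<in> Fr s \<Longrightarrow> d \<in> Fr s \<Longrightarrow> fib s c \<otimes>\<^bsub>loc A s\<^esub> fib s d = fib s (c * d)"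
  unfolding loc_def monoid.simps
  by (rule Union_fib) (auto simp: loc_frac_eq \<iota>_mult power_add)

lemma loc_add: "c \<in> Fr s \<Longrightarrow> d \<in> Fr s \<Longrightarrow> fib s c \<oplus>\<^bsub>loc A s\<^esub> fib s d = fib s (c + d)"
  unfolding loc_def ring_record_simps
  by (rule Union_fib) (use s in \<open>auto simp: loc_frac_eq \<iota>_mult \<iota>_add \<iota>_pow power_add add_divide_distrib\<close>)

lemma loc_one: "\<one>\<^bsub>loc A s\<^esub> = fib s 1"
  by (simp add: loc_def loc_frac_eq \<iota>_one)

lemma loc_zero: "\<zero>\<^bsub>loc A s\<^esub> = fib s 0"
  by (simp add: loc_def loc_frac_eq \<iota>_zero)

lemma loc_cring: "cring (loc A s)"
proof -
  note Fr = is_subringD[OF Fr_subring]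
  note simps = carrier_loc loc_mult loc_add loc_one loc_zero Fr
  show ?thesis
  proof (rule cringI)
    show "abelian_group (loc A s)"
    proof (rule abelian_groupI)
      fix u assume "u \<in> carrier (loc A s)"
      then obtain c where c: "c \<in> Fr s" "u = fib s c" by (auto simp: carrier_loc)
      then show "\<exists>v\<in>carrier (loc A s). v \<oplus>\<^bsub>loc A s\<^esub> u = \<zero>\<^bsub>loc A s\<^esub>"
        by (intro bexI[of _ "fib s (- c)"]) (auto simp: simps)
    qed (auto simp: simps add_ac)
    show "comm_monoid (loc A s)"
      by (rule comm_monoidI) (auto simp: simps mult_ac)
  qed (auto simp: simps distrib_right)
qed

interpretation Loc: cring "loc A s" by (rule loc_cring)

lemma loc_finsum:
  assumes "finite K" "\<And>m. m \<in> K \<Longrightarrow> f m = fib s (g m) \<and> g m \<in> Fr s"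
  shows "finsum (loc A s) f K = fib s (sum g K)"
  using assms
proof (induction K rule: finite_induct)
  case (insert m K)
  have "finsum (loc A s) f (insert m K) = f m \<oplus>\<^bsub>loc A s\<^esub> finsum (loc A s) f K"
    using insert by (intro Loc.finsum_insert) (auto simp: carrier_loc)
  moreover have "sum g K \<in> Fr s" using insert by (intro is_subring_sum Fr_subring) auto
  ultimately show ?case using insert by (simp add: loc_add)
qed (simp add: loc_zero)

lemma loc_pow: "c \<in> Fr s \<Longrightarrow> fib s c [^]\<^bsub>loc A s\<^esub> (k::nat) = fib s (c ^ k)"
  by (induction k) (auto simp: loc_one loc_mult is_subringD[OF Fr_subring] mult.commute)

lemma loc_finprod:
  assumes "finite K" "\<And>m. m \<in> K \<Longrightarrow> f m = fib s (g m) \<and> g m \<in> Fr s"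
  shows "finprod (loc A s) f K = fib s (prod g K)"
  using assms
proof (induction K rule: finite_induct)
  case (insert m K)
  have "finprod (loc A s) f (insert m K) = f m \<otimes>\<^bsub>loc A s\<^esub> finprod (loc A s) f K"
    using insert by (intro Loc.finprod_insert) (auto simp: carrier_loc)
  moreover have "prod g K \<in> Fr s" using insert by (intro is_subring_prod Fr_subring) auto
  ultimately show ?case using insert by (simp add: loc_mult)
qed (simp add: loc_one)

lemma loc_uminus: "c \<in> Fr s \<Longrightarrow> \<ominus>\<^bsub>loc A s\<^esub> fib s c = fib s (- c)"
  by (rule Loc.minus_equality) (auto simp: carrier_loc loc_add loc_zero is_subringD[OF Fr_subring])

lemma loc_add_pow_nat: "c \<in> Fr s \<Longrightarrow> add_pow (loc A s) (k :: nat) (fib s c) = fib s (of_nat k * c)"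
proof (induction k)
  case 0
  then show ?case by (simp add: loc_zero)
next
  case (Suc k)
  then have "of_nat k * c \<in> Fr s" using is_subring_of_nat[OF Fr_subring] is_subringD[OF Fr_subring] by auto
  then show ?case using Suc by (simp add: loc_add distrib_right add.commute)
qed

lemma loc_add_pow_int: "c \<in> Fr s \<Longrightarrow> add_pow (loc A s) (k :: int) (fib s c) = fib s (of_int k * c)"
proof -
  assume c: "c \<in> Fr s"
  then have "- (of_int k * c) \<in> Fr s"
    by (intro is_subringD(5,6)[OF Fr_subring] is_subring_of_int[OF Fr_subring])
  with c show ?thesis
    by (cases "k \<ge> 0") (simp_all add: add_pow_int_ge add_pow_int_lt loc_add_pow_nat loc_uminus)
qed

text \<open>The premise is restricted to variables occurring in P because the lists of length n to
  which it is applied have entries below n only.\<close>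

lemma witt_eval_loc:
  assumes "\<And>i. i \<in> poly_vars P \<Longrightarrow> v i = fib s (w i) \<and> w i \<in> Fr s"
  shows "witt_eval (loc A s) v P = fib s (poly_eval w P)"
proof -
  note Fr = is_subringD[OF Fr_subring]
  have prod: "(\<Otimes>\<^bsub>loc A s\<^esub>i\<in>Poly_Mapping.keys m. v i [^]\<^bsub>loc A s\<^esub> Poly_Mapping.lookup m i) = fib s (monom_eval w m)"
    "monom_eval w m \<in> Fr s"
    if "m \<in> Poly_Mapping.keys P" for m
  proof -
    have *: "v i = fib s (w i) \<and> w i \<in> Fr s" if "i \<in> Poly_Mapping.keys m" for i
      using assms[of i] that \<open>m \<in> Poly_Mapping.keys P\<close> unfolding poly_vars_def by blast
    then show "(\<Otimes>\<^bsub>loc A s\<^esub>i\<in>Poly_Mapping.keys m. v i [^]\<^bsub>loc A s\<^esub> Poly_Mapping.lookup m i) = fib s (monom_eval w m)"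
      unfolding monom_eval_def by (intro loc_finprod) (auto simp: loc_pow Fr)
    show "monom_eval w m \<in> Fr s"
      unfolding monom_eval_def using * by (intro is_subring_prod[OF Fr_subring]) (auto simp: Fr)
  qed
  show ?thesis
    unfolding witt_eval_def poly_eval_def
    by (intro loc_finsum) (auto simp: prod loc_add_pow_int Fr is_subring_of_int[OF Fr_subring])
qed

section \<open>Witt vectors of finite length over a localization\<close>

definition enc :: "nat \<Rightarrow> (nat \<Rightarrow> 'r) \<Rightarrow> ('a \<times> nat) set list" where
  "enc n w = map (\<lambda>i. fib s (w i)) [0..<n]"

lemma length_enc [simp]: "length (enc n w) = n"
  by (simp add: enc_def)

lemma nth_enc [simp]: "i < n \<Longrightarrow> enc n w ! i = fib s (w i)"
  by (simp add: enc_def)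

lemma enc_eq_iff: "w \<in> WS (Fr s) \<Longrightarrow> enc n w = enc n w' \<longleftrightarrow> weq n w w'"
  by (auto simp: list_eq_iff_nth_eq weq_def WS_def intro: fib_inj)

lemma carrier_witt_loc: "carrier (witt_ring p n (loc A s)) = enc n ` WS (Fr s)"
proof
  show "carrier (witt_ring p n (loc A s)) \<subseteq> enc n ` WS (Fr s)"
  proof
    fix l assume "l \<in> carrier (witt_ring p n (loc A s))"
    then have l: "length l = n" "set l \<subseteq> fib s ` Fr s" by (auto simp: witt_ring_def carrier_loc)
    define w where "w i = (if i < n then (SOME c. c \<in> Fr s \<and> l ! i = fib s c) else 0)" for i
    have w: "w i \<in> Fr s \<and> l ! i = fib s (w i)" if "i < n" for i
    proof -
      have "l ! i \<in> fib s ` Fr s" using that l nth_mem by blast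
      then have "\<exists>c. c \<in> Fr s \<and> l ! i = fib s c" by blast
      from someI_ex[OF this] show ?thesis using that by (simp add: w_def)
    qed
    have "w \<in> WS (Fr s)" using w is_subringD(2)[OF Fr_subring] by (auto simp: WS_def w_def[of "_"])
    moreover have "l = enc n w" using w l by (auto simp: list_eq_iff_nth_eq)
    ultimately show "l \<in> enc n ` WS (Fr s)" by blast
  qed
  show "enc n ` WS (Fr s) \<subseteq> carrier (witt_ring p n (loc A s))"
    by (auto simp: witt_ring_def carrier_loc enc_def WS_def)
qed

lemma witt_op_enc:
  assumes w: "w \<in> WS (Fr s)" "w' \<in> WS (Fr s)"
    and T: "\<And>i. poly_vars (T i) \<subseteq> Inl ` {..i} \<union> Inr ` {..i}"
  shows "witt_op T n (loc A s) (enc n w) (enc n w') = enc n (\<lambda>i. poly_eval (case_sum w w') (T i))"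
proof -
  have "witt_eval (loc A s) (case_sum (\<lambda>j. enc n w ! j) (\<lambda>j. enc n w' ! j)) (T i) = fib s (poly_eval (case_sum w w') (T i))"
    if "i < n" for i
    by (rule witt_eval_loc) (use T[of i] w that in \<open>auto simp: WS_def\<close>)
  then show ?thesis by (simp add: witt_op_def enc_def)
qed

lemma witt_add_enc:
  "w \<in> WS (Fr s) \<Longrightarrow> w' \<in> WS (Fr s) \<Longrightarrow> enc n w \<oplus>\<^bsub>witt_ring p n (loc A s)\<^esub> enc n w' = enc n (wadd p w w')"
  by (simp add: witt_ring_def witt_op_enc poly_vars_witt_add wadd_def[abs_def])

lemma witt_mult_enc:
  "w \<in> WS (Fr s) \<Longrightarrow> w' \<in> WS (Fr s) \<Longrightarrow> enc n w \<otimes>\<^bsub>witt_ring p n (loc A s)\<^esub> enc n w' = enc n (wmul p w w')"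
  by (simp add: witt_ring_def witt_op_enc poly_vars_witt_mult wmul_def[abs_def])

lemma witt_F_enc: "w \<in> WS (Fr s) \<Longrightarrow> witt_F p (loc A s) (enc n w) = enc n (wF p w)"
  by (simp add: witt_F_def enc_def wF_def loc_pow WS_def)

lemma witt_V_enc: "witt_V (loc A s) (enc n w) = enc (Suc n) (wV w)"
proof -
  have "[0..<Suc n] = 0 # map Suc [0..<n]" by (simp add: map_Suc_upt upt_conv_Cons)
  then show ?thesis by (simp add: witt_V_def enc_def loc_zero del: upt_Suc)
qed

lemma witt_V_funpow_enc: "(witt_V (loc A s) ^^ k) (enc n w) = enc (k + n) ((wV ^^ k) w)"
  by (induction k) (auto simp: witt_V_enc)

lemma witt_R_funpow_enc: "(witt_R ^^ k) (enc (k + n) w) = enc n w"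
proof (induction k)
  case (Suc k)
  have "(witt_R ^^ Suc k) (enc (Suc k + n) w) = (witt_R ^^ k) (butlast (enc (Suc k + n) w))"
    by (simp add: funpow_swap1 witt_R_def)
  also have "butlast (enc (Suc k + n) w) = enc (k + n) w" by (simp add: enc_def butlast_append)
  finally show ?case using Suc by simp
qed simp

end

lemma loc_map_fib:
  assumes "s \<in> carrier A" "\<iota> s \<noteq> 0" "t \<in> carrier A" "\<iota> t \<noteq> 0" "c \<in> Fr s"
  shows "loc_map A s t (fib s c) = fib (s \<otimes> t) c"
proof -
  have st: "s \<otimes> t \<in> carrier A" "\<iota> (s \<otimes> t) \<noteq> 0" using assms by (auto simp: \<iota>_mult)
  have "loc_map A s t (fib s c) = (\<Union>u\<in>fib s c. fib (s \<otimes> t) c)"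
    unfolding loc_map_def
    by (intro SUP_cong refl)
      (use assms st in \<open>auto simp: fib_def loc_frac_eq \<iota>_mult \<iota>_pow power_mult_distrib\<close>)
  then show ?thesis using fib_nonempty[OF assms(5)] by simp
qed

end

section \<open>Local cohomology classes as congruence classes of vectors over the field\<close>

locale lc_model = field_model p ty A \<iota> for p :: nat and ty :: "'r::field itself"
    and A :: "('a, 'm) ring_scheme" (structure) and \<iota> :: "'a \<Rightarrow> 'r" +
  fixes x1 x2 :: 'a
  assumes x1: "x1 \<in> carrier A" "\<iota> x1 \<noteq> 0" and x2: "x2 \<in> carrier A" "\<iota> x2 \<noteq> 0"
begin

abbreviation x12 :: 'a where "x12 \<equiv> x1 \<otimes> x2"

lemma x12: "x12 \<in> carrier A" "\<iota> x12 \<noteq> 0"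
  using x1 x2 by (auto simp: \<iota>_mult)

lemma Fr_x12: "Fr x1 \<subseteq> Fr x12" "Fr x2 \<subseteq> Fr x12"
  using frac_set_mult[OF R0_subring, of "\<iota> x1" "\<iota> x2"] frac_set_mult[OF R0_subring, of "\<iota> x2" "\<iota> x1"] x1 x2 \<iota>_R0
  by (auto simp: \<iota>_mult mult.commute)

lemmas sub = Fr_subring[OF x1] Fr_subring[OF x2] Fr_subring[OF x12]

abbreviation En :: "nat \<Rightarrow> (nat \<Rightarrow> 'r) \<Rightarrow> ('a \<times> nat) set list" where "En \<equiv> enc x12"

abbreviation Bnd :: "nat \<Rightarrow> (nat \<Rightarrow> 'r) set" where "Bnd n \<equiv> Bd p n (Fr x1) (Fr x2)"

definition cls :: "nat \<Rightarrow> (nat \<Rightarrow> 'r) \<Rightarrow> ('a \<times> nat) set list set" where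
  "cls n v = {En n w | w. w \<in> WS (Fr x12) \<and> wsub p w v \<in> Bnd n}"

lemma Bnd_weq: "weq n w w' \<Longrightarrow> w \<in> Bnd n \<longleftrightarrow> w' \<in> Bnd n"
  using Bd_weq weq_sym by metis

lemma En_mem_cls:
  assumes "w \<in> WS (Fr x12)"
  shows "En n w \<in> cls n v \<longleftrightarrow> wsub p w v \<in> Bnd n"
proof
  assume "En n w \<in> cls n v"
  then obtain w' where w': "En n w = En n w'" "wsub p w' v \<in> Bnd n" by (auto simp: cls_def)
  then have "weq n w w'" using enc_eq_iff[OF x12 assms] by blast
  with w' show "wsub p w v \<in> Bnd n" using Bnd_weq[OF weq_wsub[OF _ weq_refl]] by blast
qed (use assms in \<open>auto simp: cls_def\<close>)

lemma cls_eqI: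
  assumes "wsub p v v' \<in> Bnd n"
  shows "cls n v = cls n v'"
proof -
  have "wsub p w v \<in> Bnd n \<longleftrightarrow> wsub p w v' \<in> Bnd n" for w
  proof -
    have "wadd p (wsub p w v) (wsub p v v') = wsub p w v'" "wsub p (wsub p w v') (wsub p v v') = wsub p w v"
      by (simp_all add: W_simps)
    then show ?thesis using Bd_add[OF sub(1,2) _ assms] Bd_sub[OF sub(1,2) _ assms] by metis
  qed
  then show ?thesis by (simp add: cls_def)
qed

lemma En_self: "v \<in> WS (Fr x12) \<Longrightarrow> En n v \<in> cls n v"
  by (simp add: En_mem_cls Bd_zero[OF sub(1,2)])

lemma cls_eq_iff: "v \<in> WS (Fr x12) \<Longrightarrow> cls n v = cls n v' \<longleftrightarrow> wsub p v v' \<in> Bnd n"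
  using cls_eqI En_self En_mem_cls by metis

lemma map_loc_map_enc:
  "w \<in> WS (Fr x1) \<Longrightarrow> map (loc_map A x1 x2) (enc x1 n w) = En n w"
  "w \<in> WS (Fr x2) \<Longrightarrow> map (loc_map A x2 x1) (enc x2 n w) = En n w"
  using x1 x2 by (auto simp: enc_def[OF x1] enc_def[OF x2] enc_def[OF x12] WS_def loc_map_fib A.m_comm)

lemma cech_image_eq: "cech_image A p x1 x2 n = cls n wzero"
proof -
  have "cech_image A p x1 x2 n = En n ` WS (Fr x1) <+>\<^bsub>W_loc A p x1 x2 n\<^esub> En n ` WS (Fr x2)"
    using map_loc_map_enc by (simp add: cech_image_def carrier_witt_loc[OF x1] carrier_witt_loc[OF x2] image_image cong: image_cong)
  also have "\<dots> = {En n (wadd p u v) | u v. u \<in> WS (Fr x1) \<and> v \<in> WS (Fr x2)}"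
    using WS_mono[OF Fr_x12(1)] WS_mono[OF Fr_x12(2)]
    by (fastforce simp: set_add_def' W_loc_def witt_add_enc[OF x12])
  also have "\<dots> = cls n wzero"
  proof (intro equalityI subsetI)
    fix l assume "l \<in> {En n (wadd p u v) | u v. u \<in> WS (Fr x1) \<and> v \<in> WS (Fr x2)}"
    then obtain u v where uv: "l = En n (wadd p u v)" "u \<in> WS (Fr x1)" "v \<in> WS (Fr x2)" by blast
    then have "wadd p u v \<in> WS (Fr x12)"
      using WS_mono[OF Fr_x12(1)] WS_mono[OF Fr_x12(2)] by (intro WS_closed(1)[OF sub(3)]) auto
    moreover have "wadd p u v \<in> Bnd n" unfolding Bd_def using uv weq_refl by blast
    ultimately show "l \<in> cls n wzero" by (simp add: uv En_mem_cls)
  next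
    fix l assume "l \<in> cls n wzero"
    then obtain w where w: "l = En n w" "w \<in> WS (Fr x12)" "w \<in> Bnd n" by (auto simp: cls_def)
    then obtain u v where uv: "u \<in> WS (Fr x1)" "v \<in> WS (Fr x2)" "weq n w (wadd p u v)" by (auto simp: Bd_def)
    then have "l = En n (wadd p u v)" using w enc_eq_iff[OF x12 w(2)] by blast
    then show "l \<in> {En n (wadd p u v) | u v. u \<in> WS (Fr x1) \<and> v \<in> WS (Fr x2)}" using uv by blast
  qed
  finally show ?thesis .
qed

lemma lc_class_En:
  assumes v: "v \<in> WS (Fr x12)"
  shows "lc_class A p x1 x2 n (En n v) = cls n v"
proof -
  have "lc_class A p x1 x2 n (En n v) = {En n (wadd p w v) | w. w \<in> WS (Fr x12) \<and> w \<in> Bnd n}"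
    unfolding lc_class_def cech_image_eq a_r_coset_def' W_loc_def cls_def
    using v by (fastforce simp: witt_add_enc[OF x12])
  also have "\<dots> = cls n v"
  proof (intro equalityI subsetI)
    fix l assume "l \<in> {En n (wadd p w v) | w. w \<in> WS (Fr x12) \<and> w \<in> Bnd n}"
    then obtain w where w: "l = En n (wadd p w v)" "w \<in> WS (Fr x12)" "w \<in> Bnd n" by blast
    then show "l \<in> cls n v" using v WS_closed(1)[OF sub(3)] by (simp add: En_mem_cls)
  next
    fix l assume "l \<in> cls n v"
    then obtain w where w: "l = En n w" "w \<in> WS (Fr x12)" "wsub p w v \<in> Bnd n" by (auto simp: cls_def)
    then have "l = En n (wadd p (wsub p w v) v)" "wsub p w v \<in> WS (Fr x12)"
      using v WS_closed(4)[OF sub(3)] by auto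
    then show "l \<in> {En n (wadd p w v) | w. w \<in> WS (Fr x12) \<and> w \<in> Bnd n}" using w by blast
  qed
  finally show ?thesis .
qed

lemma carrier_lc: "carrier (local_cohomology A p x1 x2 n) = cls n ` WS (Fr x12)"
proof -
  have "carrier (local_cohomology A p x1 x2 n) = lc_class A p x1 x2 n ` carrier (W_loc A p x1 x2 n)"
    by (auto simp: local_cohomology_def A_RCOSETS_def' lc_class_def)
  then show ?thesis
    using lc_class_En by (simp add: W_loc_def carrier_witt_loc[OF x12] image_image cong: image_cong)
qed

lemma zero_lc: "\<zero>\<^bsub>local_cohomology A p x1 x2 n\<^esub> = cls n wzero"
  by (simp add: local_cohomology_def cech_image_eq)

lemma Union_cls:
  assumes v: "v \<in> WS (Fr x12)"
    and f: "\<And>w. w \<in> WS (Fr x12) \<Longrightarrow> wsub p w v \<in> Bnd n \<Longrightarrow> f (En n w) = S"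
  shows "(\<Union>l\<in>cls n v. f l) = S"
proof (rule SUP_eq_const)
  show "cls n v \<noteq> {}" using En_self[OF v] by blast
  show "f l = S" if "l \<in> cls n v" for l using that f by (auto simp: cls_def)
qed

lemma lc_map_cls:
  assumes v: "v \<in> WS (Fr x12)"
    and h: "\<And>w. w \<in> WS (Fr x12) \<Longrightarrow> h (En n w) = En m (H w)"
    and H: "\<And>w. w \<in> WS (Fr x12) \<Longrightarrow> H w \<in> WS (Fr x12)"
      "\<And>w. wsub p w v \<in> Bnd n \<Longrightarrow> wsub p (H w) (H v) \<in> Bnd m"
  shows "lc_map A p x1 x2 m h (cls n v) = cls m (H v)"
  unfolding lc_map_def
proof (rule Union_cls[OF v])
  fix w assume w: "w \<in> WS (Fr x12)" "wsub p w v \<in> Bnd n"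
  have "lc_class A p x1 x2 m (h (En n w)) = cls m (H w)" using w h H lc_class_En by simp
  also have "\<dots> = cls m (H v)" using w H by (intro cls_eqI)
  finally show "lc_class A p x1 x2 m (h (En n w)) = cls m (H v)" .
qed

lemma lc_F_cls: "v \<in> WS (Fr x12) \<Longrightarrow> lc_F A p x1 x2 n (cls n v) = cls n (wF p v)"
  unfolding lc_F_def
  by (rule lc_map_cls)
    (auto simp: witt_F_enc[OF x12] WS_closed(8)[OF sub(3)] Bd_wF[OF sub(1,2)] simp flip: wF_hom)

lemma funpow_wV:
  shows "w \<in> WS (Fr x12) \<Longrightarrow> (wV ^^ k) w \<in> WS (Fr x12)"
    and "wsub p ((wV ^^ k) u) ((wV ^^ k) v) = (wV ^^ k) (wsub p u v)"
    and "u \<in> Bnd n \<Longrightarrow> (wV ^^ k) u \<in> Bnd (k + n)"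
  by (induction k) (auto simp: WS_closed(7)[OF sub(3)] Bd_wV[OF sub(1,2)] simp flip: wV_sub)

lemma lc_V_iter_cls:
  assumes "v \<in> WS (Fr x12)" "n \<ge> 1"
  shows "lc_V_iter A p x1 x2 n (cls 1 v) = cls n ((wV ^^ (n - 1)) v)"
  unfolding lc_V_iter_def
proof (rule lc_map_cls)
  show "(witt_V (loc A x12) ^^ (n - 1)) (En 1 w) = En n ((wV ^^ (n - 1)) w)" for w
    using witt_V_funpow_enc[OF x12, of "n - 1" 1 w] assms(2) by simp
  show "wsub p ((wV ^^ (n - 1)) w) ((wV ^^ (n - 1)) v) \<in> Bnd n" if "wsub p w v \<in> Bnd 1" for w
    using funpow_wV(3)[OF that, of "n - 1"] assms(2) by (simp add: funpow_wV(2))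
qed (use assms funpow_wV(1) in auto)

lemma lc_R_iter_cls:
  assumes "v \<in> WS (Fr x12)" "n \<ge> 1"
  shows "lc_R_iter A p x1 x2 n (cls n v) = cls 1 v"
  unfolding lc_R_iter_def
proof (rule lc_map_cls)
  show "(witt_R ^^ (n - 1)) (En n w) = En 1 w" for w
    using witt_R_funpow_enc[OF x12, of "n - 1" 1 w] assms(2) by simp
  show "wsub p w v \<in> Bnd 1" if "wsub p w v \<in> Bnd n" for w using that assms(2) Bd_mono by blast
qed (use assms in auto)

definition vec :: "'a list \<Rightarrow> nat \<Rightarrow> 'r" where
  "vec a i = (if i < length a then \<iota> (a ! i) else 0)"

lemma vec_WS: "set a \<subseteq> carrier A \<Longrightarrow> vec a \<in> WS R0"
  by (auto simp: vec_def WS_def is_subringD(2)[OF R0_subring] intro!: \<iota>_R0)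

lemma R0_WS: "w \<in> WS R0 \<Longrightarrow> w \<in> WS (Fr s)"
  using frac_set_subset by (rule WS_mono)

lemma smult_cls:
  assumes a: "set a \<subseteq> carrier A" "length a = n" and v: "v \<in> WS (Fr x12)"
  shows "a \<odot>\<^bsub>local_cohomology A p x1 x2 n\<^esub> cls n v = cls n (wmul p (vec a) v)"
proof -
  have map: "map (\<lambda>c. loc_frac A x12 c 0) a = En n (vec a)"
    using a by (auto simp: list_eq_iff_nth_eq nth_enc[OF x12] length_enc[OF x12] loc_frac_eq[OF x12] vec_def subset_iff)
  have vec: "vec a \<in> WS (Fr x12)" using vec_WS[OF a(1)] by (rule R0_WS)
  show ?thesis
    unfolding local_cohomology_def module.simps map
  proof (rule Union_cls[OF v])
    fix w assume w: "w \<in> WS (Fr x12)" "wsub p w v \<in> Bnd n"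
    have "wsub p (wmul p (vec a) w) (wmul p (vec a) v) \<in> Bnd n"
      unfolding W.right_diff_distrib[symmetric]
      using vec_WS[OF a(1)] w(2) by (intro Bd_mul[OF sub(1,2)] R0_WS)
    then show "lc_class A p x1 x2 n (En n (vec a) \<otimes>\<^bsub>W_loc A p x1 x2 n\<^esub> En n w) = cls n (wmul p (vec a) v)"
      using w vec by (simp add: W_loc_def witt_mult_enc[OF x12] lc_class_En WS_closed(2)[OF sub(3)] cls_eqI)
  qed
qed

lemma witt_R_funpow: "length a = Suc k \<Longrightarrow> (witt_R ^^ k) a = [a ! 0]"
proof (induction k arbitrary: a)
  case 0
  then show ?case by (cases a) auto
next
  case (Suc k)
  have "(witt_R ^^ Suc k) a = (witt_R ^^ k) (butlast a)" by (simp add: funpow_swap1 witt_R_def)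
  then show ?case using Suc by (simp add: nth_butlast)
qed

text \<open>The torsion condition without lists: R^(n-1) keeps component 0, so a list truncating
  into I is the beginning of an infinite vector with component 0 in the image of I.\<close>

definition kills :: "nat \<Rightarrow> 'a set \<Rightarrow> (nat \<Rightarrow> 'r) \<Rightarrow> bool" where
  "kills n I v \<longleftrightarrow> (\<forall>a\<in>WS R0. a 0 \<in> \<iota> ` I \<longrightarrow> wmul p a v \<in> Bnd n)"

lemma cls_lc_torsion_iff:
  assumes v: "v \<in> WS (Fr x12)" and n: "n \<ge> 1" and I: "I \<subseteq> carrier A"
  shows "cls n v \<in> lc_torsion A p x1 x2 n I \<longleftrightarrow> kills n I v"
proof -
  have R: "(witt_R ^^ (n - 1)) a \<in> (\<lambda>c. [c]) ` I \<longleftrightarrow> vec a 0 \<in> \<iota> ` I" if "set a \<subseteq> carrier A" "length a = n" for a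
  proof -
    have "a ! 0 \<in> carrier A" using that n by (metis One_nat_def Suc_le_eq nth_mem subsetD)
    moreover have "vec a 0 = \<iota> (a ! 0)" using that n by (simp add: vec_def)
    ultimately show ?thesis using witt_R_funpow[of a "n - 1"] that n I \<iota>_eq by auto
  qed
  have "cls n v \<in> lc_torsion A p x1 x2 n I \<longleftrightarrow>
    (\<forall>a. set a \<subseteq> carrier A \<longrightarrow> length a = n \<longrightarrow> vec a 0 \<in> \<iota> ` I \<longrightarrow> wmul p (vec a) v \<in> Bnd n)"
  proof -
    have "a \<odot>\<^bsub>local_cohomology A p x1 x2 n\<^esub> cls n v = \<zero>\<^bsub>local_cohomology A p x1 x2 n\<^esub> \<longleftrightarrow> wmul p (vec a) v \<in> Bnd n"
      if "set a \<subseteq> carrier A" "length a = n" for a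
      using smult_cls[OF that v] cls_eq_iff[of "wmul p (vec a) v" n wzero] R0_WS[OF vec_WS[OF that(1)]] v
      by (simp add: zero_lc WS_closed(2)[OF sub(3)])
    then show ?thesis using v R by (auto simp: lc_torsion_def carrier_lc witt_ring_def)
  qed
  also have "\<dots> \<longleftrightarrow> kills n I v"
  proof
    assume *: "\<forall>a. set a \<subseteq> carrier A \<longrightarrow> length a = n \<longrightarrow> vec a 0 \<in> \<iota> ` I \<longrightarrow> wmul p (vec a) v \<in> Bnd n"
    show "kills n I v" unfolding kills_def
    proof (intro ballI impI)
      fix a assume a: "a \<in> WS R0" "a 0 \<in> \<iota> ` I"
      \<comment> \<open>Conversely, the beginning of an infinite vector is turned into a list over A
        by inverting \<iota>.\<close>
      let ?l = "map (\<lambda>i. inv_into (carrier A) \<iota> (a i)) [0..<n]"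
      have inv: "inv_into (carrier A) \<iota> (a i) \<in> carrier A" "\<iota> (inv_into (carrier A) \<iota> (a i)) = a i" for i
        using a(1) by (auto simp: WS_def R0_def intro: inv_into_into f_inv_into_f)
      have eq: "weq n (vec ?l) a" by (simp add: weq_def vec_def inv)
      then have "vec ?l 0 = a 0" using n by (simp add: weq_def)
      then have "wmul p (vec ?l) v \<in> Bnd n" using *[rule_format, of ?l] a(2) inv(1) by auto
      then show "wmul p a v \<in> Bnd n" using Bnd_weq[OF weq_wmul[OF eq weq_refl]] by blast
    qed
  qed (use vec_WS in \<open>auto simp: kills_def\<close>)
  finally show ?thesis .
qed

lemma lc_torsion_1_eq:
  assumes I: "I \<subseteq> carrier A"
  shows "lc_torsion A p x1 x2 1 I = cls 1 ` {v \<in> WS (Fr x12). kills 1 I v}"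
proof -
  have "lc_torsion A p x1 x2 1 I \<subseteq> cls 1 ` WS (Fr x12)" by (auto simp: lc_torsion_def carrier_lc)
  then show ?thesis using cls_lc_torsion_iff[OF _ _ I, of _ 1] by auto
qed

text \<open>Length 1 sees component 0 only, so the action of c is multiplication by
  \<open>teich (\<iota> c)\<close>, and \<open>gen\<close> says that the multiples of v exhaust the
  torsion.\<close>

lemma lc_torsion_generatorI:
  assumes I: "I \<subseteq> carrier A" and v: "v \<in> WS (Fr x12)" "kills 1 I v"
    and gen: "\<And>w. w \<in> WS (Fr x12) \<Longrightarrow> kills 1 I w \<Longrightarrow> \<exists>\<alpha>\<in>R0. wsub p w (wmul p (teich \<alpha>) v) \<in> Bnd 1"
  shows "lc_torsion_generator A p x1 x2 I (cls 1 v)"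
  unfolding lc_torsion_generator_def
proof
  show "cls 1 v \<in> lc_torsion A p x1 x2 1 I" using v by (simp add: cls_lc_torsion_iff[OF v(1) _ I])
  have vec: "weq 1 (vec [c]) (teich (\<iota> c))" for c by (simp add: weq_def vec_def)
  have smult: "[c] \<odot>\<^bsub>local_cohomology A p x1 x2 1\<^esub> cls 1 v = cls 1 (wmul p (teich (\<iota> c)) v)" if "c \<in> carrier A" for c
  proof -
    have "cls 1 (wmul p (vec [c]) v) = cls 1 (wmul p (teich (\<iota> c)) v)"
      using weq_wmul[OF vec weq_refl, of p c v]
      by (intro cls_eqI Bd_weq[OF _ Bd_zero[OF sub(1,2)]]) (simp only: weq_iff_diff[symmetric])
    then show ?thesis using smult_cls[of "[c]" 1 v] that v by simp
  qed
  show "lc_torsion A p x1 x2 1 I = (\<lambda>c. [c] \<odot>\<^bsub>local_cohomology A p x1 x2 1\<^esub> cls 1 v) ` carrier A"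
  proof (intro equalityI subsetI)
    fix C assume "C \<in> lc_torsion A p x1 x2 1 I"
    then obtain w where w: "C = cls 1 w" "w \<in> WS (Fr x12)" "kills 1 I w"
      unfolding lc_torsion_1_eq[OF I] by blast
    then obtain c where c: "c \<in> carrier A" "wsub p w (wmul p (teich (\<iota> c)) v) \<in> Bnd 1" using gen by (auto simp: R0_def)
    then have "C = [c] \<odot>\<^bsub>local_cohomology A p x1 x2 1\<^esub> cls 1 v" using w smult cls_eqI by simp
    with c show "C \<in> (\<lambda>c. [c] \<odot>\<^bsub>local_cohomology A p x1 x2 1\<^esub> cls 1 v) ` carrier A" by blast
  next
    fix C assume "C \<in> (\<lambda>c. [c] \<odot>\<^bsub>local_cohomology A p x1 x2 1\<^esub> cls 1 v) ` carrier A"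
    then obtain c where c: "c \<in> carrier A" "C = cls 1 (wmul p (teich (\<iota> c)) v)" using smult by auto
    have tc: "teich (\<iota> c) \<in> WS R0" using c \<iota>_R0 by (intro WS_closed(5) R0_subring) auto
    have "kills 1 I (wmul p (teich (\<iota> c)) v)"
      unfolding kills_def
    proof (intro ballI impI)
      fix a assume "a \<in> WS R0" "a 0 \<in> \<iota> ` I"
      then have "wmul p (teich (\<iota> c)) (wmul p a v) \<in> Bnd 1"
        using v(2) by (intro Bd_mul[OF sub(1,2) R0_WS[OF tc] R0_WS[OF tc]]) (auto simp: kills_def)
      then show "wmul p a (wmul p (teich (\<iota> c)) v) \<in> Bnd 1" by (simp add: W.mult.left_commute)
    qed
    then show "C \<in> lc_torsion A p x1 x2 1 I"
      unfolding lc_torsion_1_eq[OF I] c(2) using v(1)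
      by (intro imageI CollectI conjI WS_closed(2)[OF sub(3)] R0_WS[OF tc])
  qed
qed

end

section \<open>Regular pairs and the embedding of a double point\<close>

context field_model begin

lemma Idl_singleton: "x \<in> carrier A \<Longrightarrow> a \<in> Idl {x} \<longleftrightarrow> (\<exists>c\<in>carrier A. a = c \<otimes> x)"
  by (auto simp: cgenideal_def simp flip: A.cgenideal_eq_genideal)

text \<open>If y were 0, regularity of y modulo x would put 1 into (x), although (x, y) is
  proper.\<close>

lemma regular_pair_nonzero:
  assumes "regular_pair A x y"
  shows "x \<in> carrier A" "y \<in> carrier A" "\<iota> x \<noteq> 0" "\<iota> y \<noteq> 0"
proof -
  show xy: "x \<in> carrier A" "y \<in> carrier A" using assms by (auto simp: regular_pair_def)
  show "\<iota> x \<noteq> 0"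
  proof
    assume "\<iota> x = 0"
    then have "x = \<zero>" using \<iota>_eq[of x \<zero>] \<iota>_zero xy by simp
    then have "\<one> = \<zero>" using assms by (simp add: regular_pair_def)
    then show False using \<iota>_one \<iota>_zero by simp
  qed
  show "\<iota> y \<noteq> 0"
  proof
    assume "\<iota> y = 0"
    then have "y = \<zero>" using \<iota>_eq[of y \<zero>] \<iota>_zero xy by simp
    then have "y \<otimes> \<one> = \<zero> \<otimes> x" using xy by simp
    then have "y \<otimes> \<one> \<in> Idl {x}" using xy(1) Idl_singleton[OF xy(1)] A.zero_closed by blast
    then have "\<one> \<in> Idl {x}" using assms by (simp add: regular_pair_def)
    moreover have "Idl {x} \<subseteq> Idl {x, y}" using xy by (intro A.subset_Idl_subset) (auto intro: A.genideal_self[THEN subsetD])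
    ultimately have "Idl {x, y} = carrier A" using xy by (intro ideal.one_imp_carrier A.genideal_ideal) auto
    then show False using assms by (simp add: regular_pair_def)
  qed
qed

text \<open>A depth two argument: if a y^j = b x^i with i > 0, regularity of y modulo x shows that x
  divides a, and one factor x cancels; induction on i removes the denominator.\<close>

lemma regular_pair_Int:
  assumes r: "regular_pair A x y"
  shows "Fr x \<inter> Fr y \<subseteq> R0"
proof
  note xy = regular_pair_nonzero[OF r]
  have reg: "\<exists>c\<in>carrier A. a = c \<otimes> x" if "a \<in> carrier A" "b \<in> carrier A" "a \<otimes> y [^] (j::nat) = b \<otimes> x" for a b j
    using that
  proof (induction j arbitrary: a b)
    case (Suc j)
    have "y \<otimes> (a \<otimes> y [^] j) = b \<otimes> x" using Suc.prems xy by (simp add: A.m_ac)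
    then have "y \<otimes> (a \<otimes> y [^] j) \<in> Idl {x}" using Suc.prems xy Idl_singleton by auto
    then have "a \<otimes> y [^] j \<in> Idl {x}" using r Suc.prems xy by (auto simp: regular_pair_def)
    then obtain c where "c \<in> carrier A" "a \<otimes> y [^] j = c \<otimes> x" using xy Idl_singleton by auto
    then show ?case using Suc.IH Suc.prems by blast
  qed auto
  fix w assume w: "w \<in> Fr x \<inter> Fr y"
  obtain a i where a: "a \<in> carrier A" "w = \<iota> a / \<iota> x ^ i" using FrE[of w x] w by blast
  obtain b j where b: "b \<in> carrier A" "w = \<iota> b / \<iota> y ^ j" using FrE[of w y] w by blast
  note ab = a(1) b(1) a(2) b(2)
  have "\<exists>c\<in>carrier A. \<iota> a / \<iota> x ^ i = \<iota> c" if "a \<in> carrier A" "a \<otimes> y [^] j = b \<otimes> x [^] i" for a i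
    using that
  proof (induction i arbitrary: a)
    case 0
    then show ?case by auto
  next
    case (Suc i)
    have "a \<otimes> y [^] j = (b \<otimes> x [^] i) \<otimes> x" using Suc.prems ab xy by (simp add: A.m_assoc)
    then obtain c where c: "c \<in> carrier A" "a = c \<otimes> x" using reg[of a "b \<otimes> x [^] i" j] Suc.prems ab xy by auto
    have "\<iota> ((c \<otimes> y [^] j) \<otimes> x) = \<iota> ((b \<otimes> x [^] i) \<otimes> x)" using Suc.prems ab xy c by (simp add: A.m_ac)
    then have "\<iota> (c \<otimes> y [^] j) = \<iota> (b \<otimes> x [^] i)" using c ab xy by (simp add: \<iota>_mult)
    then have "c \<otimes> y [^] j = b \<otimes> x [^] i" using c ab xy \<iota>_eq by simp
    from Suc.IH[OF c(1) this] show ?case using c xy by (simp add: \<iota>_mult)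
  qed
  moreover have "\<iota> (a \<otimes> y [^] j) = \<iota> (b \<otimes> x [^] i)"
    using ab xy by (simp add: \<iota>_mult \<iota>_pow frac_eq_eq)
  then have "a \<otimes> y [^] j = b \<otimes> x [^] i" using ab xy \<iota>_eq by simp
  ultimately show "w \<in> R0" using ab by (auto simp: R0_def)
qed

end

context double_point begin

text \<open>The given isomorphism is composed with that of the first isomorphism theorem for
  \<open>dphi\<close>.\<close>

lemma quotient_embedding:
  fixes A :: "('a, 'm) ring_scheme" (structure)
  assumes A: "cring A"
    and iso: "A \<simeq> (ring_of_type_algebra :: 'k fps3 ring) Quot (Idl\<^bsub>ring_of_type_algebra :: 'k fps3 ring\<^esub> {dpf})"
  obtains \<iota> :: "'a \<Rightarrow> 'k quot_closure" where
    "\<iota> \<one> = 1" "\<And>a b. a \<in> carrier A \<Longrightarrow> b \<in> carrier A \<Longrightarrow> \<iota> (a \<oplus> b) = \<iota> a + \<iota> b"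
    "\<And>a b. a \<in> carrier A \<Longrightarrow> b \<in> carrier A \<Longrightarrow> \<iota> (a \<otimes> b) = \<iota> a * \<iota> b"
    "inj_on \<iota> (carrier A)" "\<iota> ` carrier A = dpA"
proof -
  let ?P = "ring_of_type_algebra :: 'k fps3 ring" and ?L = "ring_of_type_algebra :: 'k quot_closure ring"
  have records: "carrier ?P = UNIV" "\<zero>\<^bsub>?L\<^esub> = 0"
    by (simp_all add: ring_of_type_algebra_def)
  have P: "cring ?P" by (rule cring_from_type_algebra)
  have L: "cring ?L" by (rule cring_from_type_algebra)
  interpret P: cring ?P by (rule P)
  interpret H: ring_hom_ring ?P ?L dphi
  proof (rule ring_hom_ringI)
    show "ring ?P" "ring ?L" using P L by (auto simp: cring_def)
    show "dphi \<one>\<^bsub>?P\<^esub> = \<one>\<^bsub>?L\<^esub>"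
      using dphi_const[of 1] by (simp add: ring_of_type_algebra_def)
  qed (simp_all add: ring_of_type_algebra_def dphi_add dphi_mult)
  have "Idl\<^bsub>?P\<^esub> {dpf} = PIdl\<^bsub>?P\<^esub> dpf"
    by (rule P.cgenideal_eq_genideal[symmetric]) (simp add: ring_of_type_algebra_def)
  also have "\<dots> = {g. \<exists>q. g = q * dpf}"
    by (simp add: cgenideal_def ring_of_type_algebra_def)
  also have "\<dots> = {g. dphi g = 0}" by (simp only: dphi_kernel)
  also have "\<dots> = a_kernel ?P ?L dphi"
    by (simp only: a_kernel_def' records UNIV_I simp_thms)
  finally obtain h where h: "h \<in> ring_iso A (?P Quot a_kernel ?P ?L dphi)"
    using iso by (auto simp: is_ring_iso_def)
  let ?g = "\<lambda>S. the_elem (dphi ` S)"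
  have g: "?g \<in> ring_iso (?P Quot a_kernel ?P ?L dphi) (?L\<lparr>carrier := dphi ` carrier ?P\<rparr>)"
    by (rule H.FactRing_iso_set_aux)
  have gh: "?g \<circ> h \<in> ring_iso A (?L\<lparr>carrier := dphi ` carrier ?P\<rparr>)"
    using h g by (rule ring_iso_set_trans)
  show thesis
  proof (rule that[of "?g \<circ> h"])
    show "(?g \<circ> h) \<one> = 1" using ring_iso_memE(4)[OF gh] by (simp add: ring_of_type_algebra_def)
    show "(?g \<circ> h) (a \<oplus> b) = (?g \<circ> h) a + (?g \<circ> h) b" if "a \<in> carrier A" "b \<in> carrier A" for a b
      using ring_iso_memE(3)[OF gh that] by (simp add: ring_of_type_algebra_def)
    show "(?g \<circ> h) (a \<otimes> b) = (?g \<circ> h) a * (?g \<circ> h) b" if "a \<in> carrier A" "b \<in> carrier A" for a b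
      using ring_iso_memE(2)[OF gh that] by (simp add: ring_of_type_algebra_def)
    have "bij_betw (?g \<circ> h) (carrier A) (dphi ` carrier ?P)" using ring_iso_memE(5)[OF gh] by simp
    then show "inj_on (?g \<circ> h) (carrier A)" "(?g \<circ> h) ` carrier A = dpA"
      by (simp_all add: bij_betw_def ring_of_type_algebra_def flip: dphi_range)
  qed
qed

end

locale embedded_double_point = double_point B C \<zeta> + field_model p ty A \<iota>
  for B C :: "'k::field fps fps" and \<zeta> :: "'k quot_closure" and p :: nat and ty :: "'k quot_closure itself"
    and A :: "('a, 'm) ring_scheme" (structure) and \<iota> :: "'a \<Rightarrow> 'k quot_closure" +
  assumes range_\<iota>: "\<iota> ` carrier A = dpA"
begin

lemma R0_dpA: "R0 = dpA"
  by (simp add: R0_def range_\<iota>)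

text \<open>A is local: a maximal ideal contains no unit, so it lies in the ideal (x, y, z), which
  is proper.\<close>

lemma maximal_ideal:
  assumes m: "maximalideal \<mm> A"
  shows "\<mm> = {a \<in> carrier A. \<iota> a \<in> dpM}"
proof -
  interpret m: maximalideal \<mm> A by (rule m)
  let ?m = "{a \<in> carrier A. \<iota> a \<in> dpM}"
  have sub: "\<mm> \<subseteq> ?m"
  proof
    fix a assume a: "a \<in> \<mm>"
    then have aA: "a \<in> carrier A" by (rule m.Icarr)
    show "a \<in> ?m"
    proof (rule ccontr)
      assume "a \<notin> ?m"
      then have "\<iota> a \<in> dpA" "\<iota> a \<notin> dpM" using aA range_\<iota> by auto
      then obtain t where t: "t \<in> dpA" "\<iota> a * t = 1" by (rule unit_or_dpM)
      then obtain b where b: "b \<in> carrier A" "t = \<iota> b" using range_\<iota> by auto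
      have "\<iota> (a \<otimes> b) = \<iota> \<one>" using t b aA by (simp add: \<iota>_mult \<iota>_one)
      then have "a \<otimes> b = \<one>" using \<iota>_eq aA b by simp
      moreover have "a \<otimes> b \<in> \<mm>" using a b by (simp add: m.I_r_closed)
      ultimately have "\<mm> = carrier A" using m.one_imp_carrier by simp
      then show False using m.I_notcarr by simp
    qed
  qed
  have "ideal ?m A"
  proof (rule idealI)
    show "ring A" by (rule A.ring_axioms)
    show "subgroup ?m (add_monoid A)"
    proof (rule A.add.subgroupI)
      show "?m \<noteq> {}" using sub m.zero_closed by blast
      fix a assume a: "a \<in> ?m"
      have "\<iota> a + \<iota> (\<ominus> a) = 0" using a by (simp add: A.r_neg \<iota>_zero flip: \<iota>_add)
      then have "\<iota> (\<ominus> a) = \<iota> a * (- 1)" by (simp add: eq_neg_iff_add_eq_0 add.commute)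
      moreover have "- 1 \<in> dpA" using is_subringD(1,6)[OF dpA_subring] by auto
      ultimately show "\<ominus> a \<in> ?m" using a dpM_mult[of "\<iota> a" "- 1"] by (metis (no_types, lifting) A.a_inv_closed mem_Collect_eq)
    qed (auto simp: \<iota>_add dpM_add)
    show "b \<otimes> a \<in> ?m" "a \<otimes> b \<in> ?m" if "a \<in> ?m" "b \<in> carrier A" for a b
      using that dpM_mult[of "\<iota> a" "\<iota> b"] range_\<iota> by (auto simp: \<iota>_mult mult.commute)
  qed
  then have "?m = \<mm> \<or> ?m = carrier A" using sub by (intro m.I_maximal) auto
  moreover have "\<one> \<notin> ?m" using one_notin_dpM by (simp add: \<iota>_one)
  ultimately show ?thesis by auto
qed

text \<open>One class e has to serve both cases, hence the conditional conclusions. It comes from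
  the vector v that corresponds to [t] under the change of cover, and e' is the class of [k] v.
  Coboundary relations are established for x, y, where the formulas are explicit, and carried over
  by \<open>transfer_Bd\<close>.\<close>

lemma lc_generator:
  assumes m: "maximalideal \<mm> A" and reg: "regular_pair A x1 x2" and xm: "x1 \<in> \<mm>" "x2 \<in> \<mm>" and n: "n \<ge> 1"
    and F: "teich ((\<zeta> / (xL * yL)) ^ p) \<in> Bd p (n - 1) (frac_set dpA xL) (frac_set dpA yL)"
    and Z: "teich (\<zeta> * (\<zeta> / (xL * yL))) \<in> Bd p n (frac_set dpA xL) (frac_set dpA yL)"
  obtains e where "e \<in> lc_torsion A p x1 x2 n \<mm>" "lc_torsion_generator A p x1 x2 \<mm> (lc_R_iter A p x1 x2 n e)"
    "teich ((\<zeta> / (xL * yL)) ^ p) \<in> Bd p n (frac_set dpA xL) (frac_set dpA yL) \<Longrightarrow>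
      lc_F A p x1 x2 n e = \<zero>\<^bsub>local_cohomology A p x1 x2 n\<^esub>"
    "\<And>k k'. k \<in> dpA \<Longrightarrow> k' \<in> dpA \<Longrightarrow> k * k' = 1 \<Longrightarrow>
      cg (frac_set dpA xL) (frac_set dpA yL) n (teich ((\<zeta> / (xL * yL)) ^ p)) ((wV ^^ (n - 1)) (teich (k * (\<zeta> / (xL * yL))))) \<Longrightarrow>
      \<exists>e'. lc_torsion_generator A p x1 x2 \<mm> e' \<and> lc_F A p x1 x2 n e = lc_V_iter A p x1 x2 n e'"
proof -
  note r = regular_pair_nonzero[OF reg]
  interpret M: lc_model p ty A \<iota> x1 x2 by unfold_locales (use r in auto)
  interpret T: two_covers p ty dpA xL yL "\<iota> x1" "\<iota> x2"
    by unfold_locales (use dpA_subring XY int_XY r range_\<iota> regular_pair_Int[OF reg] in \<open>auto simp: R0_dpA\<close>)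
  interpret S: two_covers p ty dpA "\<iota> x1" "\<iota> x2" xL yL by (rule T.swap)
  let ?t = "\<zeta> / (xL * yL)" let ?Fx = "frac_set dpA xL" let ?Fy = "frac_set dpA yL"
  let ?T = "\<lambda>n. transfer n dpA xL yL (\<iota> x1) (\<iota> x2)"
  have m_eq: "\<mm> = {a \<in> carrier A. \<iota> a \<in> dpM}" by (rule maximal_ideal[OF m])
  have \<mm>: "\<mm> \<subseteq> carrier A" "\<iota> ` \<mm> = dpM"
    using dpM_subset range_\<iota> by (auto simp: m_eq)
  have Fr12: "Fr (x1 \<otimes> x2) = frac_set dpA (\<iota> x1 * \<iota> x2)" using r by (simp add: R0_dpA \<iota>_mult)
  note FX = frac_subrings
  have t: "?t \<in> frac_set dpA (xL * yL)" by (rule frac_setI[of \<zeta> _ _ _ 1]) auto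
  have tw: "teich ?t \<in> WS (frac_set dpA (xL * yL))" using t T.subrings by (intro WS_closed) auto
  obtain n' where n': "n = Suc n'" using n by (cases n) auto
  have kill: "wmul p a (teich ?t) \<in> Bd p n ?Fx ?Fy" if a: "a \<in> WS dpA" "a 0 \<in> dpM" for a
  proof -
    obtain \<alpha> \<beta> \<gamma> where abc: "a 0 = xL * \<alpha> + yL * \<beta> + \<zeta> * \<gamma>" "\<alpha> \<in> dpA" "\<beta> \<in> dpA" "\<gamma> \<in> dpA"
      using a by (auto simp: dpM_def)
    have "xL * ?t = \<zeta> / yL ^ 1" "yL * ?t = \<zeta> / xL ^ 1" by (simp_all add: XY(3,4))
    then have "xL * ?t \<in> ?Fy" "yL * ?t \<in> ?Fx" by (auto simp only: intro: frac_setI[OF zeta_dpA refl])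
    then have xy: "teich (xL * ?t) \<in> Bd p (Suc n') ?Fx ?Fy" "teich (yL * ?t) \<in> Bd p (Suc n') ?Fx ?Fy"
      using Bd_right[OF FX(1) WS_closed(5)[OF FX(2)]] Bd_left[OF FX(2) WS_closed(5)[OF FX(1)]] by blast+
    show ?thesis
      unfolding n'
      by (rule annihilator_teich[OF dpA_subring frac_set_subset frac_set_subset FX XY(1,2) zeta_dpA _ _ _ _ a(1) abc])
        (use xy Z F n' in \<open>simp_all flip: teich_mult\<close>)
  qed
  have x12M: "\<iota> x1 \<in> dpM" "\<iota> x2 \<in> dpM" using xm \<mm> by auto
  have teich_dpA: "teich s \<in> WS dpA" if "s \<in> dpA" for s using that dpA_subring by (intro WS_closed)
  have teich_dpM: "teich s \<in> WS dpA" "teich s 0 \<in> dpM" if "s \<in> dpM" for s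
    using that dpM_subset teich_dpA by auto
  obtain v where v: "v \<in> WS (frac_set dpA (\<iota> x1 * \<iota> x2))" "?T n (teich ?t) v"
    by (rule T.transfer_exists[OF tw kill[OF teich_dpM[OF x12M(1)]] kill[OF teich_dpM[OF x12M(2)]]])
  then have v': "v \<in> WS (Fr (x1 \<otimes> x2))" by (simp add: Fr12)
  have Bnd_eq: "M.Bnd n = Bd p n (frac_set dpA (\<iota> x1)) (frac_set dpA (\<iota> x2))" for n by (simp add: R0_dpA)
  have kills_v: "M.kills n \<mm> v"
    unfolding M.kills_def R0_dpA \<mm>(2)
  proof (intro ballI impI)
    fix a assume a: "a \<in> WS dpA" "a 0 \<in> dpM"
    show "wmul p a v \<in> Bd p n (frac_set dpA (\<iota> x1)) (frac_set dpA (\<iota> x2))"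
      by (rule T.transfer_Bd[OF T.transfer_wmul[OF v(2) a(1)] kill[OF a]])
  qed
  have T1: "?T 1 (teich ?t) v" using v(2) n by (rule transfer_mono)
  have gen: "lc_torsion_generator A p x1 x2 \<mm> (M.cls 1 (wmul p (teich k) v))"
    if k: "k \<in> dpA" "k' \<in> dpA" "k * k' = 1" for k k'
  proof (rule M.lc_torsion_generatorI[OF \<mm>(1)])
    show "wmul p (teich k) v \<in> WS (Fr (x1 \<otimes> x2))"
      by (rule WS_closed(2)[OF M.sub(3) M.R0_WS v']) (simp add: R0_dpA teich_dpA k)
    show "M.kills 1 \<mm> (wmul p (teich k) v)"
      unfolding M.kills_def R0_dpA
    proof (intro ballI impI)
      fix a assume a: "a \<in> WS dpA" "a 0 \<in> \<iota> ` \<mm>"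
      have "wmul p a v \<in> M.Bnd n" using kills_v a unfolding M.kills_def R0_dpA by blast
      then have "wmul p a v \<in> M.Bnd 1" by (rule Bd_mono[OF n])
      then have "wmul p (teich k) (wmul p a v) \<in> M.Bnd 1"
        by (rule Bd_mul[OF M.sub(1,2) M.R0_WS M.R0_WS, rotated 2]) (simp_all add: R0_dpA teich_dpA k)
      then show "wmul p a (wmul p (teich k) v) \<in> Bd p 1 (frac_set dpA (\<iota> x1)) (frac_set dpA (\<iota> x2))"
        by (simp add: W.mult.left_commute R0_dpA)
    qed
  next
    \<comment> \<open>A torsion class for x1, x2 is moved back to x, y through the double complex
      with the roles exchanged; there \<open>socle\<close> shows that it is a multiple of the class
      of t.\<close>
    fix w assume w: "w \<in> WS (Fr (x1 \<otimes> x2))" "M.kills 1 \<mm> w"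
    have kw: "wmul p (teich s) w \<in> Bd p 1 (frac_set dpA (\<iota> x1)) (frac_set dpA (\<iota> x2))" if "s \<in> dpM" for s
      using w(2) teich_dpM[OF that] by (auto simp: M.kills_def R0_dpA \<mm>(2))
    obtain c where c: "c \<in> WS (frac_set dpA (xL * yL))" "transfer 1 dpA (\<iota> x1) (\<iota> x2) xL yL w c"
      by (rule S.transfer_exists[OF w(1)[unfolded Fr12] kw[OF XYz_dpM(1)] kw[OF XYz_dpM(2)]])
    have bd: "s * c 0 \<in> bdset" if "s \<in> dpM" for s
    proof -
      have "wmul p (teich s) c \<in> Bd p 1 ?Fx ?Fy"
        by (rule S.transfer_Bd[OF S.transfer_wmul[OF c(2) teich_dpM(1)[OF that]] kw[OF that]])
      then obtain u u' where "u \<in> WS ?Fx" "u' \<in> WS ?Fy" "weq 1 (wmul p (teich s) c) (wadd p u u')" by (auto simp: Bd_def)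
      then show ?thesis unfolding bdset_def by (auto simp: weq_def wmul_teich WS_def)
    qed
    have "c 0 \<in> frac_set dpA (xL * yL)" using c(1) by (simp add: WS_def)
    then obtain \<alpha> where \<alpha>: "\<alpha> \<in> dpA" "c 0 - \<alpha> * ?t \<in> bdset"
      using bd XYz_dpM by (rule_tac socle) blast+
    then obtain P Q where PQ: "P \<in> ?Fx" "Q \<in> ?Fy" "c 0 - \<alpha> * ?t = P + Q" by (auto simp: bdset_def)
    have "wsub p c (wmul p (teich \<alpha>) (teich ?t)) \<in> Bd p 1 ?Fx ?Fy"
      unfolding Bd_def
      by (intro CollectI bexI[of _ "teich P"] bexI[of _ "teich Q"])
        (use PQ FX in \<open>auto simp: weq_def wmul_teich intro: WS_closed\<close>)
    from T.transfer_Bd[OF T.transfer_wsub[OF transfer_sym[OF c(2)] T.transfer_wmul[OF T1 teich_dpA[OF \<alpha>(1)]]] this]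
    have "wsub p w (wmul p (teich \<alpha>) v) \<in> M.Bnd 1" by (simp add: R0_dpA)
    moreover have "wmul p (teich \<alpha>) v = wmul p (teich (\<alpha> * k')) (wmul p (teich k) v)"
      using k by (simp add: mult.assoc mult.commute[of k'] flip: W.mult.assoc teich_mult)
    moreover have "\<alpha> * k' \<in> dpA" using \<alpha> k dpA_subring by (simp add: is_subringD)
    ultimately show "\<exists>\<alpha>\<in>R0. wsub p w (wmul p (teich \<alpha>) (wmul p (teich k) v)) \<in> M.Bnd 1"
      unfolding R0_dpA by metis
  qed
  show thesis
  proof (rule that[of "M.cls n v"])
    show "M.cls n v \<in> lc_torsion A p x1 x2 n \<mm>"
      using M.cls_lc_torsion_iff[OF v' n \<mm>(1)] kills_v by simp
    show "lc_torsion_generator A p x1 x2 \<mm> (lc_R_iter A p x1 x2 n (M.cls n v))"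
      using gen[of 1 1] is_subringD(1)[OF dpA_subring] by (simp add: M.lc_R_iter_cls[OF v' n])
    have TF: "?T n (teich (?t ^ p)) (wF p v)" using T.transfer_wF[OF v(2)] by simp
    show "lc_F A p x1 x2 n (M.cls n v) = \<zero>\<^bsub>local_cohomology A p x1 x2 n\<^esub>"
      if "teich (?t ^ p) \<in> Bd p n ?Fx ?Fy"
      using T.transfer_Bd[OF TF that]
      by (simp add: M.lc_F_cls[OF v'] M.zero_lc) (rule M.cls_eqI, simp add: R0_dpA)
    show "\<exists>e'. lc_torsion_generator A p x1 x2 \<mm> e' \<and> lc_F A p x1 x2 n (M.cls n v) = lc_V_iter A p x1 x2 n e'"
      if k: "k \<in> dpA" "k' \<in> dpA" "k * k' = 1"
        and cg: "cg ?Fx ?Fy n (teich (?t ^ p)) ((wV ^^ (n - 1)) (teich (k * ?t)))" for k k'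
    proof (intro exI conjI)
      show "lc_torsion_generator A p x1 x2 \<mm> (M.cls 1 (wmul p (teich k) v))" by (rule gen[OF k])
      have kv: "wmul p (teich k) v \<in> WS (Fr (x1 \<otimes> x2))"
        by (rule WS_closed(2)[OF M.sub(3) M.R0_WS v']) (simp add: R0_dpA teich_dpA k)
      have "?T n ((wV ^^ (n - 1)) (teich (k * ?t))) ((wV ^^ (n - 1)) (wmul p (teich k) v))"
        using T.transfer_wV_funpow[OF T.transfer_wmul[OF T1 teich_dpA[OF k(1)]], of "n - 1"] n by (simp flip: teich_mult)
      from T.transfer_Bd[OF T.transfer_wsub[OF TF this]] cg
      have "wsub p (wF p v) ((wV ^^ (n - 1)) (wmul p (teich k) v)) \<in> M.Bnd n"
        by (simp add: cg_def[OF FX] R0_dpA)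
      then show "lc_F A p x1 x2 n (M.cls n v) = lc_V_iter A p x1 x2 n (M.cls 1 (wmul p (teich k) v))"
        unfolding M.lc_F_cls[OF v'] M.lc_V_iter_cls[OF kv n] by (rule M.cls_eqI)
    qed
  qed
qed

end

section \<open>The equations of the rational double points\<close>

lemma ord_ge_SX_SY: "ord_ge 1 SX" "ord_ge 1 SY"
  by (auto simp: ord_ge_def)

lemma ord_ge_zero: "ord_ge d 0"
  by (simp add: ord_ge_def)

lemma ord_ge_power: "ord_ge d a \<Longrightarrow> ord_ge (k * d) (a ^ k)"
  by (induction k) (auto intro: ord_ge_mult)

lemma ord_ge_monomial: "d \<le> i + j \<Longrightarrow> ord_ge d (SX ^ i * SY ^ j)"
  using ord_ge_mult[OF ord_ge_power[OF ord_ge_SX_SY(1), of i] ord_ge_power[OF ord_ge_SX_SY(2), of j]]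
  by (auto elim: ord_ge_mono)

text \<open>Monomials are written x^i y^j even for exponent 0, so that the same rules apply to every
  equation. The term x^3 cannot be cancelled by D.\<close>

lemma ord_is_cube: "ord_ge 4 D \<Longrightarrow> ord_is 3 (SX ^ 3 * SY ^ 0 + D :: 'k::idom fps fps)"
proof -
  assume D: "ord_ge 4 D"
  have "ord_ge 3 (SX ^ 3 * SY ^ 0 + D)" using D by (intro ord_ge_add ord_ge_monomial) (auto elim: ord_ge_mono)
  moreover have "(SX ^ 3 * SY ^ 0 + D) $ 0 $ 3 = 1"
    using SX_power_mult_nth[of 3 1 0 3] ord_geD[OF D, of 3 0] by simp
  then have "\<not> ord_ge 4 (SX ^ 3 * SY ^ 0 + D)" using ord_geD[of 4 "SX ^ 3 * SY ^ 0 + D" 3 0] by auto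
  ultimately show ?thesis by (simp add: ord_is_def)
qed

text \<open>The ideal (x^2, y^2), membership in which provides the splitting for
  \<open>teich_za_t\<close>.\<close>

definition sq_ideal :: "'k::comm_ring_1 fps fps \<Rightarrow> bool" where
  "sq_ideal a \<longleftrightarrow> (\<exists>u v. a = SX ^ 2 * u + SY ^ 2 * v)"

lemma sq_ideal_add: "sq_ideal a \<Longrightarrow> sq_ideal b \<Longrightarrow> sq_ideal (a + b)"
proof -
  assume "sq_ideal a" "sq_ideal b"
  then obtain u v u' v' where "a = SX ^ 2 * u + SY ^ 2 * v" "b = SX ^ 2 * u' + SY ^ 2 * v'"
    unfolding sq_ideal_def by blast
  then have "a + b = SX ^ 2 * (u + u') + SY ^ 2 * (v + v')"
    by (simp add: algebra_simps del: fps_const_power)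
  then show ?thesis unfolding sq_ideal_def by blast
qed

lemma sq_ideal_monomial: "2 \<le> i \<or> 2 \<le> j \<Longrightarrow> sq_ideal (SX ^ i * SY ^ j :: 'k::comm_ring_1 fps fps)"
proof -
  have split: "c ^ k = c ^ 2 * c ^ (k - 2)" if "2 \<le> k" for c :: "'k fps fps" and k :: nat
    using that by (simp only: le_add_diff_inverse flip: power_add)
  assume "2 \<le> i \<or> 2 \<le> j"
  then show ?thesis
  proof
    assume i: "2 \<le> i"
    have "SX ^ i * SY ^ j = SX ^ 2 * (SX ^ (i - 2) * SY ^ j) + SY ^ 2 * (0 :: 'k fps fps)"
      by (subst split[OF i]) (simp only: mult.assoc mult_zero_right add_0_right)
    then show ?thesis unfolding sq_ideal_def by blast
  next
    assume j: "2 \<le> j"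
    have "SX ^ i * SY ^ j = SX ^ 2 * 0 + SY ^ 2 * (SX ^ i * SY ^ (j - 2) :: 'k fps fps)"
      by (subst split[OF j]) (simp only: mult.left_commute mult_zero_right add_0_left)
    then show ?thesis unfolding sq_ideal_def by blast
  qed
qed

lemma sq_ideal_0: "sq_ideal 0"
  unfolding sq_ideal_def by (rule exI[of _ 0])+ simp

locale dp_char = double_point B C \<zeta> + wittchar p ty
  for B C :: "'k::field fps fps" and \<zeta> :: "'k quot_closure" and p :: nat and ty :: "'k quot_closure itself"
begin

sublocale lau: laurent p ty "frac_set dpA xL" "frac_set dpA yL" xL "1 / xL" yL "1 / yL" \<zeta>
proof
  show "1 / xL \<in> frac_set dpA xL" "1 / yL \<in> frac_set dpA yL"
    using frac_set_inverse[OF dpA_subring] by auto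
qed (simp_all add: frac_subrings XY frac_set_subset[THEN subsetD])

lemma lau_t: "lau.t = \<zeta> / (xL * yL)"
  by (simp add: lau.t_def)

lemma emb_xy: "emb SX = xL" "emb SY = yL"
  by (simp_all add: xL_def yL_def)

text \<open>For n = 1 it is enough that \<zeta>^2 lies in (x, y). For larger n it has to lie in
  (x^2, y^2), which it inherits from B and C through \<zeta>^2 = - B \<zeta> - C.\<close>

lemma teich_za_t_bd:
  assumes N: "n = 1 \<or> sq_ideal B \<and> sq_ideal C \<and> (p = 2 \<and> n \<le> 3 \<or> p = 3 \<and> n \<le> 2)"
  shows "teich (\<zeta> * lau.t) \<in> Bd p n (frac_set dpA xL) (frac_set dpA yL)"
proof (cases "n = 1")
  case True
  obtain \<alpha> \<beta> where ab: "\<alpha> \<in> dpA" "\<beta> \<in> dpA" "\<zeta> * \<zeta> = xL * \<alpha> + yL * \<beta>" by (rule zeta_sq_XY)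
  show ?thesis
    unfolding True using ab frac_set_subset by (intro lau.teich_za_t_1[OF ab(3)]) auto
next
  case False
  with N obtain b1 b2 c1 c2 where *: "B = SX ^ 2 * b1 + SY ^ 2 * b2" "C = SX ^ 2 * c1 + SY ^ 2 * c2"
    by (auto simp: sq_ideal_def)
  have "\<zeta> * \<zeta> = xL ^ 2 * (- (emb b1 * \<zeta>) - emb c1) + yL ^ 2 * (- (emb b2 * \<zeta>) - emb c2)"
    unfolding zeta_sq * by (simp add: emb_xy algebra_simps del: fps_const_power)
  moreover have "- (emb b * \<zeta>) - emb c \<in> frac_set dpA s" for b c s
    by (intro subsetD[OF frac_set_subset] is_subringD[OF dpA_subring] emb_dpA zeta_dpA)
  ultimately show ?thesis
    using N False by (intro lau.teich_za_t) auto
qed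

end

text \<open>\<open>rdp_data p S r B C N k\<close> records that $f = z^2 + Bz + C$, and that $F[z/(xy)] = k V^{N-1}[z/(xy)]$ in
  $H^2(W_N)$, where $k$ is zero or a unit modulo $p$.\<close>

definition rdp_data ::
    "nat \<Rightarrow> dynkin_E \<Rightarrow> nat \<Rightarrow> 'k::field fps fps \<Rightarrow> 'k fps fps \<Rightarrow> nat \<Rightarrow> int \<Rightarrow> bool" where
  "rdp_data p S r B C N k \<longleftrightarrow>
    rdp_eq p S r = fps_X ^ 2 + fps_const B * fps_X + fps_const C \<and> ord_ge 2 B \<and> ord_is 3 C \<and>
    (N = 1 \<or> sq_ideal B \<and> sq_ideal C) \<and> (k = 0 \<or> (\<exists>k'. k * k' mod int p = 1)) \<and>
    (\<forall>\<zeta> Fx Fy. laurent p Fx Fy (emb SX) (1 / emb SX) (emb SY) (1 / emb SY) \<zeta> \<longrightarrow>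
      \<zeta> * \<zeta> = - (emb B * \<zeta>) - emb C \<longrightarrow>
      laurent.frob p Fx Fy (1 / emb SX) (1 / emb SY) \<zeta> N k)"

lemma rdp_dataI:
  assumes "rdp_eq p S r = fps_X ^ 2 + fps_const B * fps_X + fps_const C" "ord_ge 2 B" "ord_is 3 C"
    and "N = 1 \<or> sq_ideal B \<and> sq_ideal C" "k = 0 \<or> k * k' mod int p = 1"
    and "\<And>\<zeta> Fx Fy. laurent p Fx Fy (emb SX) (1 / emb SX) (emb SY) (1 / emb SY) \<zeta> \<Longrightarrow>
      \<zeta> * \<zeta> = - (emb B * \<zeta>) - emb C \<Longrightarrow>
      laurent.frob p Fx Fy (1 / emb SX) (1 / emb SY) \<zeta> N k"
  shows "rdp_data p S r B C N k"
  using assms unfolding rdp_data_def by blast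

text \<open>\<open>rtop\<close> stands for \<open>r_max p S + 1 - n\<close>, which keeps the case
  arithmetic out of the argument; the conditions \<open>level\<close> relate it to the length N at
  which F[t] was computed.\<close>

lemma proposition_of_rdp_data:
  fixes B C :: "'k::alg_closed_field fps fps" and A :: "('a, 'm) ring_scheme" (structure)
  assumes p: "Factorial_Ring.prime p" "CHAR('k) = p" and n: "n \<ge> 1"
    and data: "rdp_data p S r B C N k"
    and level: "n \<le> N" "r < rtop \<Longrightarrow> n < N \<or> k = 0" "r = rtop \<Longrightarrow> n = N \<and> k \<noteq> 0"
      "n = 1 \<or> p = 2 \<and> n \<le> 3 \<or> p = 3 \<and> n \<le> 2"
    and r: "r \<le> rtop"
    and A: "is_RDP TYPE('k) p S r A"
    and reg: "maximalideal \<mm> A" "regular_pair A x1 x2" "x1 \<in> \<mm>" "x2 \<in> \<mm>"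
  shows "\<exists>e \<in> lc_torsion A p x1 x2 n \<mm>.
           lc_torsion_generator A p x1 x2 \<mm> (lc_R_iter A p x1 x2 n e) \<and>
           (r < rtop \<longrightarrow> lc_F A p x1 x2 n e = \<zero>\<^bsub>local_cohomology A p x1 x2 n\<^esub>) \<and>
           (r = rtop \<longrightarrow> (\<exists>e'. lc_torsion_generator A p x1 x2 \<mm> e' \<and>
                    lc_F A p x1 x2 n e = lc_V_iter A p x1 x2 n e'))"
proof -
  have f: "rdp_eq p S r = fps_X ^ 2 + fps_const B * fps_X + fps_const C" and BC: "ord_ge 2 B" "ord_is 3 C"
    and sq: "N = 1 \<or> sq_ideal B \<and> sq_ideal C" and unit: "k = 0 \<or> (\<exists>k'. k * k' mod int p = 1)"
    using data unfolding rdp_data_def by auto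
  obtain \<zeta> where "poly [:emb C, emb B, 1:] \<zeta> = 0"
    using alg_closed_imp_poly_has_root[of "[:emb C, emb B, 1:]"] by auto
  then have root: "\<zeta> ^ 2 + emb B * \<zeta> + emb C = 0" by (simp add: power2_eq_square algebra_simps)
  have "of_nat p = (0 :: 'k fps fps)"
    using of_nat_CHAR[where ?'a = "'k fps fps"] by (simp only: semiring_char_fps p(2))
  then have char: "of_nat p = (0 :: 'k quot_closure)"
    using emb_of_nat[of p, where ?'a = 'k] by simp
  interpret D: dp_char B C \<zeta> p "TYPE('k quot_closure)"
    by unfold_locales (use BC root p char in auto)
  have dbl: "rdp_eq p S r = dbl B C" by (simp only: f dbl_def[OF D.ord_1])
  from A obtain \<iota> :: "'a \<Rightarrow> 'k quot_closure" where \<iota>: "\<iota> \<one> = 1"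
    "\<And>a b. a \<in> carrier A \<Longrightarrow> b \<in> carrier A \<Longrightarrow> \<iota> (a \<oplus> b) = \<iota> a + \<iota> b"
    "\<And>a b. a \<in> carrier A \<Longrightarrow> b \<in> carrier A \<Longrightarrow> \<iota> (a \<otimes> b) = \<iota> a * \<iota> b"
    "inj_on \<iota> (carrier A)" "\<iota> ` carrier A = D.dpA"
    unfolding is_RDP_def dbl by (auto intro: D.quotient_embedding)
  interpret A: cring A using A by (simp add: is_RDP_def)
  interpret E: embedded_double_point B C \<zeta> p "TYPE('k quot_closure)" A \<iota>
    by unfold_locales (use \<iota> in auto)
  have frob: "D.lau.frob N k"
    using data D.zeta_sq D.lau.laurent_axioms unfolding rdp_data_def D.xL_def D.yL_def by blast
  have zero: "teich (D.lau.t ^ p) \<in> Bd p m (frac_set D.dpA D.xL) (frac_set D.dpA D.yL)"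
    if "m < N \<or> m = N \<and> k = 0" for m
    using D.lau.frob_lower[OF frob] D.lau.frob_zero[of m] frob that by blast
  have F: "teich ((\<zeta> / (D.xL * D.yL)) ^ p) \<in> Bd p (n - 1) (frac_set D.dpA D.xL) (frac_set D.dpA D.yL)"
    unfolding D.lau_t[symmetric] by (rule zero, rule disjI1) (use level(1) n in arith)
  have Z: "teich (\<zeta> * (\<zeta> / (D.xL * D.yL))) \<in> Bd p n (frac_set D.dpA D.xL) (frac_set D.dpA D.yL)"
    using D.teich_za_t_bd[of n] level sq n by (auto simp: D.lau_t)
  show ?thesis
  proof (rule E.lc_generator[OF reg n F Z])
    fix e
    assume e: "e \<in> lc_torsion A p x1 x2 n \<mm>" "lc_torsion_generator A p x1 x2 \<mm> (lc_R_iter A p x1 x2 n e)"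
      and e_0: "teich ((\<zeta> / (D.xL * D.yL)) ^ p) \<in> Bd p n (frac_set D.dpA D.xL) (frac_set D.dpA D.yL) \<Longrightarrow>
        lc_F A p x1 x2 n e = \<zero>\<^bsub>local_cohomology A p x1 x2 n\<^esub>"
      and e_V: "\<And>k k'. k \<in> D.dpA \<Longrightarrow> k' \<in> D.dpA \<Longrightarrow> k * k' = 1 \<Longrightarrow>
        D.cg (frac_set D.dpA D.xL) (frac_set D.dpA D.yL) n (teich ((\<zeta> / (D.xL * D.yL)) ^ p))
          ((wV ^^ (n - 1)) (teich (k * (\<zeta> / (D.xL * D.yL))))) \<Longrightarrow>
        \<exists>e'. lc_torsion_generator A p x1 x2 \<mm> e' \<and> lc_F A p x1 x2 n e = lc_V_iter A p x1 x2 n e'"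
    have "lc_F A p x1 x2 n e = \<zero>\<^bsub>local_cohomology A p x1 x2 n\<^esub>" if "r < rtop"
      unfolding D.lau_t[symmetric] by (rule e_0[folded D.lau_t], rule zero) (use level(1,2) that in auto)
    moreover have "\<exists>e'. lc_torsion_generator A p x1 x2 \<mm> e' \<and> lc_F A p x1 x2 n e = lc_V_iter A p x1 x2 n e'"
      if "r = rtop"
    proof -
      have nN: "n = N" "k \<noteq> 0" using level(3) that by auto
      \<comment> \<open>An inverse of k modulo p becomes a genuine inverse in the field, which has
        characteristic p.\<close>
      with unit obtain k' where "k * k' mod int p = 1" by auto
      then have "k * k' = int p * (k * k' div int p) + 1" by (metis mult_div_mod_eq)
      then have "of_int (k * k') = (of_int (int p * (k * k' div int p) + 1) :: 'k quot_closure)" by (rule arg_cong)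
      then have "of_int k * of_int k' = (1 :: 'k quot_closure)" by (simp add: char)
      then show ?thesis
        using e_V[of "of_int k" "of_int k'"] is_subring_of_int[OF D.dpA_subring] frob
        unfolding D.lau.frob_def nN(1) D.lau_t by blast
    qed
    ultimately show ?thesis using e by blast
  qed
qed

section \<open>The list of equations\<close>

lemmas rdp_eq_simps = rdp_eq_def Let_def ps_x_def ps_y_def ps_z_def ps_const_def algebra_simps eval_nat_numeral
lemmas rdp_eq_flips = fps_const_mult fps_const_add fps_const_power
lemmas ord_intros = ord_is_cube ord_ge_add ord_ge_monomial ord_ge_zero
lemmas sq_intros = sq_ideal_add sq_ideal_monomial sq_ideal_0

text \<open>In all these lemmas \<open>k'\<close> is an inverse of k modulo p, or the dummy 0 if k =
  0. The conditions on orders and on (x^2, y^2) are read off from the exponents.\<close>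

lemma rdp_E6_2_1: "rdp_data 2 E6 1 (SX ^ 0 * SY ^ 2 + SX ^ 1 * SY ^ 1 :: 'k::field fps fps) (SX ^ 3 * SY ^ 0 + 0) 1 (-1)"
  by (rule rdp_dataI[where k' = "- 1"], simp add: rdp_eq_simps flip: rdp_eq_flips, (intro ord_intros; simp)+,
    simp, simp,
    (erule laurent.frob_E6_2_1[OF _ refl], simp add: algebra_simps del: fps_const_power))

lemma rdp_E6_2_0: "rdp_data 2 E6 0 (SX ^ 0 * SY ^ 2 :: 'k::field fps fps) (SX ^ 3 * SY ^ 0 + 0) 1 0"
  by (rule rdp_dataI[where k' = "0"], simp add: rdp_eq_simps flip: rdp_eq_flips, (intro ord_intros; simp)+,
    simp, simp,
    (erule laurent.frob_E6_2_0[OF _ refl], simp add: algebra_simps del: fps_const_power))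

lemma rdp_E7_2_3: "rdp_data 2 E7 3 (SX ^ 1 * SY ^ 1 :: 'k::field fps fps) (SX ^ 3 * SY ^ 0 + (SX ^ 1 * SY ^ 3)) 1 (-1)"
  by (rule rdp_dataI[where k' = "- 1"], simp add: rdp_eq_simps flip: rdp_eq_flips, (intro ord_intros; simp)+,
    simp, simp,
    (erule laurent.frob_E7_2_3[OF _ refl], simp add: algebra_simps del: fps_const_power))

lemma rdp_E7_2_2: "rdp_data 2 E7 2 (SX ^ 0 * SY ^ 3 :: 'k::field fps fps) (SX ^ 3 * SY ^ 0 + (SX ^ 1 * SY ^ 3)) 2 1"
  by (rule rdp_dataI[where k' = "1"], simp add: rdp_eq_simps flip: rdp_eq_flips, (intro ord_intros; simp)+,
    rule disjI2, (intro conjI sq_intros; simp)+, simp,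
    (erule laurent.frob_E7_2_2[OF _ refl], simp add: algebra_simps del: fps_const_power))

lemma rdp_E7_2_1: "rdp_data 2 E7 1 (SX ^ 2 * SY ^ 1 :: 'k::field fps fps) (SX ^ 3 * SY ^ 0 + (SX ^ 1 * SY ^ 3)) 3 1"
  by (rule rdp_dataI[where k' = "1"], simp add: rdp_eq_simps flip: rdp_eq_flips, (intro ord_intros; simp)+,
    rule disjI2, (intro conjI sq_intros; simp)+, simp,
    (erule laurent.frob_E7_2_1[OF _ refl], simp add: algebra_simps del: fps_const_power))

lemma rdp_E7_2_0: "rdp_data 2 E7 0 (0 :: 'k::field fps fps) (SX ^ 3 * SY ^ 0 + (SX ^ 1 * SY ^ 3)) 3 0"
  by (rule rdp_dataI[where k' = "0"], simp add: rdp_eq_simps flip: rdp_eq_flips, (intro ord_intros; simp)+,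
    rule disjI2, (intro conjI sq_intros; simp)+, simp,
    (erule laurent.frob_E7_2_0[OF _ refl], simp add: algebra_simps del: fps_const_power))

lemma rdp_E8_2_4: "rdp_data 2 E8 4 (SX ^ 1 * SY ^ 1 :: 'k::field fps fps) (SX ^ 3 * SY ^ 0 + (SX ^ 0 * SY ^ 5)) 1 (-1)"
  by (rule rdp_dataI[where k' = "- 1"], simp add: rdp_eq_simps flip: rdp_eq_flips, (intro ord_intros; simp)+,
    simp, simp,
    (erule laurent.frob_E8_2_4[OF _ refl], simp add: algebra_simps del: fps_const_power))

lemma rdp_E8_2_3: "rdp_data 2 E8 3 (SX ^ 0 * SY ^ 3 :: 'k::field fps fps) (SX ^ 3 * SY ^ 0 + (SX ^ 0 * SY ^ 5)) 2 1"
  by (rule rdp_dataI[where k' = "1"], simp add: rdp_eq_simps flip: rdp_eq_flips, (intro ord_intros; simp)+,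
    rule disjI2, (intro conjI sq_intros; simp)+, simp,
    (erule laurent.frob_E8_2_3[OF _ refl], simp add: algebra_simps del: fps_const_power))

lemma rdp_E8_2_2: "rdp_data 2 E8 2 (SX ^ 1 * SY ^ 2 :: 'k::field fps fps) (SX ^ 3 * SY ^ 0 + (SX ^ 0 * SY ^ 5)) 3 1"
  by (rule rdp_dataI[where k' = "1"], simp add: rdp_eq_simps flip: rdp_eq_flips, (intro ord_intros; simp)+,
    rule disjI2, (intro conjI sq_intros; simp)+, simp,
    (erule laurent.frob_E8_2_2[OF _ refl], simp add: algebra_simps del: fps_const_power))

lemma rdp_E8_2_1: "rdp_data 2 E8 1 (SX ^ 1 * SY ^ 3 :: 'k::field fps fps) (SX ^ 3 * SY ^ 0 + (SX ^ 0 * SY ^ 5)) 3 0"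
  by (rule rdp_dataI[where k' = "0"], simp add: rdp_eq_simps flip: rdp_eq_flips, (intro ord_intros; simp)+,
    rule disjI2, (intro conjI sq_intros; simp)+, simp,
    (erule laurent.frob_E8_2_1[OF _ refl], simp add: algebra_simps del: fps_const_power))

lemma rdp_E8_2_0: "rdp_data 2 E8 0 (0 :: 'k::field fps fps) (SX ^ 3 * SY ^ 0 + (SX ^ 0 * SY ^ 5)) 3 0"
  by (rule rdp_dataI[where k' = "0"], simp add: rdp_eq_simps flip: rdp_eq_flips, (intro ord_intros; simp)+,
    rule disjI2, (intro conjI sq_intros; simp)+, simp,
    (erule laurent.frob_E8_2_0[OF _ refl], simp add: algebra_simps del: fps_const_power))

lemma rdp_E6_3_1: "rdp_data 3 E6 1 (0 :: 'k::field fps fps) (SX ^ 3 * SY ^ 0 + (SX ^ 0 * SY ^ 4 + SX ^ 2 * SY ^ 2)) 1 (-1)"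
  by (rule rdp_dataI[where k' = "- 1"], simp add: rdp_eq_simps flip: rdp_eq_flips, (intro ord_intros; simp)+,
    simp, simp,
    (erule laurent.frob_E6_3_1[OF _ refl], simp add: algebra_simps del: fps_const_power))

lemma rdp_E6_3_0: "rdp_data 3 E6 0 (0 :: 'k::field fps fps) (SX ^ 3 * SY ^ 0 + (SX ^ 0 * SY ^ 4)) 1 0"
  by (rule rdp_dataI[where k' = "0"], simp add: rdp_eq_simps flip: rdp_eq_flips, (intro ord_intros; simp)+,
    simp, simp,
    (erule laurent.frob_E6_3_0[OF _ refl], simp add: algebra_simps del: fps_const_power))

lemma rdp_E7_3_1: "rdp_data 3 E7 1 (0 :: 'k::field fps fps) (SX ^ 3 * SY ^ 0 + (SX ^ 1 * SY ^ 3 + SX ^ 2 * SY ^ 2)) 1 (-1)"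
  by (rule rdp_dataI[where k' = "- 1"], simp add: rdp_eq_simps flip: rdp_eq_flips, (intro ord_intros; simp)+,
    simp, simp,
    (erule laurent.frob_E7_3_1[OF _ refl], simp add: algebra_simps del: fps_const_power))

lemma rdp_E7_3_0: "rdp_data 3 E7 0 (0 :: 'k::field fps fps) (SX ^ 3 * SY ^ 0 + (SX ^ 1 * SY ^ 3)) 1 0"
  by (rule rdp_dataI[where k' = "0"], simp add: rdp_eq_simps flip: rdp_eq_flips, (intro ord_intros; simp)+,
    simp, simp,
    (erule laurent.frob_E7_3_0[OF _ refl], simp add: algebra_simps del: fps_const_power))

lemma rdp_E8_3_2: "rdp_data 3 E8 2 (0 :: 'k::field fps fps) (SX ^ 3 * SY ^ 0 + (SX ^ 0 * SY ^ 5 + SX ^ 2 * SY ^ 2)) 1 (-1)"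
  by (rule rdp_dataI[where k' = "- 1"], simp add: rdp_eq_simps flip: rdp_eq_flips, (intro ord_intros; simp)+,
    simp, simp,
    (erule laurent.frob_E8_3_2[OF _ refl], simp add: algebra_simps del: fps_const_power))

lemma rdp_E8_3_1: "rdp_data 3 E8 1 (0 :: 'k::field fps fps) (SX ^ 3 * SY ^ 0 + (SX ^ 0 * SY ^ 5 + SX ^ 2 * SY ^ 3)) 2 4"
  by (rule rdp_dataI[where k' = "1"], simp add: rdp_eq_simps flip: rdp_eq_flips, (intro ord_intros; simp)+,
    rule disjI2, (intro conjI sq_intros; simp)+, simp,
    (erule laurent.frob_E8_3_1[OF _ refl], simp add: algebra_simps del: fps_const_power))

lemma rdp_E8_3_0: "rdp_data 3 E8 0 (0 :: 'k::field fps fps) (SX ^ 3 * SY ^ 0 + (SX ^ 0 * SY ^ 5)) 2 0"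
  by (rule rdp_dataI[where k' = "0"], simp add: rdp_eq_simps flip: rdp_eq_flips, (intro ord_intros; simp)+,
    rule disjI2, (intro conjI sq_intros; simp)+, simp,
    (erule laurent.frob_E8_3_0[OF _ refl], simp add: algebra_simps del: fps_const_power))

text \<open>The parameter is b = 2 and enters the equation as b/2, so x y^4 has coefficient 1 once 2
  is invertible.\<close>

lemma rdp_E8_5_1:
  assumes "(2 :: 'k::field) \<noteq> 0"
  shows "rdp_data 5 E8 1 (0 :: 'k::field fps fps) (SX ^ 3 * SY ^ 0 + (SX ^ 0 * SY ^ 5 + SX ^ 1 * SY ^ 4)) 1 2"
  by (rule rdp_dataI[where k' = "3"], simp add: rdp_eq_simps assms flip: rdp_eq_flips, (intro ord_intros; simp)+,
    simp, simp,
    (erule laurent.frob_E8_5_1[OF _ refl], simp add: algebra_simps del: fps_const_power))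

lemma rdp_E8_5_0: "rdp_data 5 E8 0 (0 :: 'k::field fps fps) (SX ^ 3 * SY ^ 0 + (SX ^ 0 * SY ^ 5)) 1 0"
  by (rule rdp_dataI[where k' = "0"], simp add: rdp_eq_simps flip: rdp_eq_flips, (intro ord_intros; simp)+,
    simp, simp,
    (erule laurent.frob_E8_5_0[OF _ refl], simp add: algebra_simps del: fps_const_power))

theorem proposition4p7:
  fixes A :: "('a, 'm) ring_scheme"
    and p n r :: nat
    and S :: dynkin_E
    and \<mm> :: "'a set"
    and x1 x2 :: 'a
  assumes "Factorial_Ring.prime p"
    and "CHAR('k::alg_closed_field) = p"
    and "n \<ge> 1"
    and "(p = 2 \<and> S \<in> {E7, E8} \<and> n \<le> 3) \<or>
         (p = 3 \<and> S = E8 \<and> n \<le> 2) \<or>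
         (p = 2 \<and> S = E6 \<and> n = 1) \<or>
         (p = 3 \<and> S \<in> {E6, E7} \<and> n = 1) \<or>
         (p = 5 \<and> S = E8 \<and> n = 1)"
    and "r \<le> r_max p S + 1 - n"
    and "is_RDP TYPE('k) p S r A"
    and "maximalideal \<mm> A"
    and "regular_pair A x1 x2"
    and "x1 \<in> \<mm>" and "x2 \<in> \<mm>"
  shows "\<exists>e \<in> lc_torsion A p x1 x2 n \<mm>.
           lc_torsion_generator A p x1 x2 \<mm> (lc_R_iter A p x1 x2 n e) \<and>
           (r < r_max p S + 1 - n \<longrightarrow>
              lc_F A p x1 x2 n e = \<zero>\<^bsub>local_cohomology A p x1 x2 n\<^esub>) \<and>
           (r = r_max p S + 1 - n \<longrightarrow>
              (\<exists>e'. lc_torsion_generator A p x1 x2 \<mm> e' \<and>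
                    lc_F A p x1 x2 n e = lc_V_iter A p x1 x2 n e'))"
proof -
  note main = proposition_of_rdp_data[OF assms(1,2,3) _ _ _ _ _ assms(5-10)]
  have bound: "r \<le> r_max p S + 1 - n" by fact
  consider "p = 2" "S = E6" "n = 1" | "p = 2" "S = E7" "n \<le> 3" | "p = 2" "S = E8" "n \<le> 3" | "p = 3" "S = E6" "n = 1" | "p = 3" "S = E7" "n = 1" | "p = 3" "S = E8" "n \<le> 2" | "p = 5" "S = E8" "n = 1"
    using assms(4) by blast
  then show ?thesis
  proof cases
    case 1
    note pS = 1(1,2)
    have "r \<le> 1 + 1 - n" using bound by (simp add: pS r_max_def)
    then consider "r = 1" | "r = 0"
      using assms(3) 1(3) by linarith
    then show ?thesis
    proof cases
      case r: 1
      show ?thesis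
        by (rule main, unfold pS r, rule rdp_E6_2_1) (use assms(3) 1(3) r in \<open>auto simp: r_max_def\<close>)
    next
      case r: 2
      show ?thesis
        by (rule main, unfold pS r, rule rdp_E6_2_0) (use assms(3) 1(3) r in \<open>auto simp: r_max_def\<close>)
    qed
  next
    case 2
    note pS = 2(1,2)
    have "r \<le> 3 + 1 - n" using bound by (simp add: pS r_max_def)
    \<comment> \<open>The bound on r turns into a bound on n for each r, namely n \<le> N for the
      length N in the data of that equation.\<close>
    then consider "r = 3" "n \<le> 1" | "r = 2" "n \<le> 2" | "r = 1" | "r = 0"
      using assms(3) 2(3) by linarith
    then show ?thesis
    proof cases
      case r: 1
      show ?thesis
        by (rule main, unfold pS r, rule rdp_E7_2_3) (use assms(3) 2(3) r in \<open>auto simp: r_max_def\<close>)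
    next
      case r: 2
      show ?thesis
        by (rule main, unfold pS r, rule rdp_E7_2_2) (use assms(3) 2(3) r in \<open>auto simp: r_max_def\<close>)
    next
      case r: 3
      show ?thesis
        by (rule main, unfold pS r, rule rdp_E7_2_1) (use assms(3) 2(3) r in \<open>auto simp: r_max_def\<close>)
    next
      case r: 4
      show ?thesis
        by (rule main, unfold pS r, rule rdp_E7_2_0) (use assms(3) 2(3) r in \<open>auto simp: r_max_def\<close>)
    qed
  next
    case 3
    note pS = 3(1,2)
    have "r \<le> 4 + 1 - n" using bound by (simp add: pS r_max_def)
    then consider "r = 4" "n \<le> 1" | "r = 3" "n \<le> 2" | "r = 2" | "r = 1" | "r = 0"
      using assms(3) 3(3) by linarith
    then show ?thesis
    proof cases
      case r: 1
      show ?thesis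
        by (rule main, unfold pS r, rule rdp_E8_2_4) (use assms(3) 3(3) r in \<open>auto simp: r_max_def\<close>)
    next
      case r: 2
      show ?thesis
        by (rule main, unfold pS r, rule rdp_E8_2_3) (use assms(3) 3(3) r in \<open>auto simp: r_max_def\<close>)
    next
      case r: 3
      show ?thesis
        by (rule main, unfold pS r, rule rdp_E8_2_2) (use assms(3) 3(3) r in \<open>auto simp: r_max_def\<close>)
    next
      case r: 4
      show ?thesis
        by (rule main, unfold pS r, rule rdp_E8_2_1) (use assms(3) 3(3) r in \<open>auto simp: r_max_def\<close>)
    next
      case r: 5
      show ?thesis
        by (rule main, unfold pS r, rule rdp_E8_2_0) (use assms(3) 3(3) r in \<open>auto simp: r_max_def\<close>)
    qed
  next
    case 4
    note pS = 4(1,2)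
    have "r \<le> 1 + 1 - n" using bound by (simp add: pS r_max_def)
    then consider "r = 1" | "r = 0"
      using assms(3) 4(3) by linarith
    then show ?thesis
    proof cases
      case r: 1
      show ?thesis
        by (rule main, unfold pS r, rule rdp_E6_3_1) (use assms(3) 4(3) r in \<open>auto simp: r_max_def\<close>)
    next
      case r: 2
      show ?thesis
        by (rule main, unfold pS r, rule rdp_E6_3_0) (use assms(3) 4(3) r in \<open>auto simp: r_max_def\<close>)
    qed
  next
    case 5
    note pS = 5(1,2)
    have "r \<le> 1 + 1 - n" using bound by (simp add: pS r_max_def)
    then consider "r = 1" | "r = 0"
      using assms(3) 5(3) by linarith
    then show ?thesis
    proof cases
      case r: 1
      show ?thesis
        by (rule main, unfold pS r, rule rdp_E7_3_1) (use assms(3) 5(3) r in \<open>auto simp: r_max_def\<close>)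
    next
      case r: 2
      show ?thesis
        by (rule main, unfold pS r, rule rdp_E7_3_0) (use assms(3) 5(3) r in \<open>auto simp: r_max_def\<close>)
    qed
  next
    case 6
    note pS = 6(1,2)
    have "r \<le> 2 + 1 - n" using bound by (simp add: pS r_max_def)
    then consider "r = 2" "n \<le> 1" | "r = 1" | "r = 0"
      using assms(3) 6(3) by linarith
    then show ?thesis
    proof cases
      case r: 1
      show ?thesis
        by (rule main, unfold pS r, rule rdp_E8_3_2) (use assms(3) 6(3) r in \<open>auto simp: r_max_def\<close>)
    next
      case r: 2
      show ?thesis
        by (rule main, unfold pS r, rule rdp_E8_3_1) (use assms(3) 6(3) r in \<open>auto simp: r_max_def\<close>)
    next
      case r: 3
      show ?thesis
        by (rule main, unfold pS r, rule rdp_E8_3_0) (use assms(3) 6(3) r in \<open>auto simp: r_max_def\<close>)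
    qed
  next
    case 7
    note pS = 7(1,2)
    have "r \<le> 1 + 1 - n" using bound by (simp add: pS r_max_def)
    then consider "r = 1" | "r = 0"
      using assms(3) 7(3) by linarith
    then show ?thesis
    proof cases
      case r: 1
      have two: "(2 :: 'k) \<noteq> 0"
        using of_nat_eq_0_iff_char_dvd[of 2, where ?'a = 'k] assms(2) pS by simp
      show ?thesis
        by (rule main, unfold pS r, rule rdp_E8_5_1[OF two]) (use assms(3) 7(3) r in \<open>auto simp: r_max_def\<close>)
    next
      case r: 2
      show ?thesis
        by (rule main, unfold pS r, rule rdp_E8_5_0) (use assms(3) 7(3) r in \<open>auto simp: r_max_def\<close>)
    qed
  qed
qed

end
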